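(* Let $\Gamma$ be a finitely generated non-torsion group which does not have fixed price one. Then $\Gamma$ is not unitarizable.
   Context: A group is non-torsion if it contains an element of infinite order. Cost (Gaboriau). Let $\Gamma\curvearrowright(X,\nu)$ be a probability-measure-preserving (p.m.p.) essentially free action of a countable group on a standard probability space, with orbit equivalence relation $\mathcal R$. A graphing of $\mathcal R$ is a countable family of Borel isomorphisms $\varphi_i:A_i\to B_i$ between Borel subsets of $X$ with $(x,\varphi_i(x))\in\mathcal R$ for almost all $x\in A_i$, such that up to a null set $\mathcal R$ is the smallest equivalence relation containing all pairs $(x,\varphi_i(x))$. Its cost is $\sum_i\nu(A_i)$, and $\mathrm{cost}(\Gamma\curvearrowright X)$ is the infimum of the costs of all graphings of $\mathcal R$. An infinite group $\Gamma$ has fixed price one if all its p.m.p. essentially free actions have cost $1$. Unitarizability. A representation $\pi:\Gamma\to B(\mathcal H)^\times$ (a homomorphism into the group of invertible bounded operators on a Hilbert space $\mathcal H$) is uniformly bounded if $\sup_{g\in\Gamma}\|\pi(g)\|<\infty$. The group $\Gamma$ is unitarizable if every uniformly bounded representation of $\Gamma$ on a Hilbert space is conjugate to a unitary representation, i.e. there is $T\in B(\mathcal H)^\times$ such that $T\pi(g)T^{-1}$ is unitary for all $g\in\Gamma$. *)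

theory Defs
  imports
    "HOL-Probability.Probability_Measure"
    "HOL-Algebra.Group_Action"
    "HOL-Algebra.Generated_Groups"
    "HOL-Algebra.Module"
begin

section \<open>Groups\<close>

definition finitely_generated :: "('g, 'm) monoid_scheme \<Rightarrow> bool" where
  "finitely_generated G \<longleftrightarrow> (\<exists>S. finite S \<and> S \<subseteq> carrier G \<and> generate G S = carrier G)"

definition non_torsion :: "('g, 'm) monoid_scheme \<Rightarrow> bool" where
  "non_torsion G \<longleftrightarrow> (\<exists>g\<in>carrier G. \<forall>n::nat. n > 0 \<longrightarrow> g [^]\<^bsub>G\<^esub> n \<noteq> \<one>\<^bsub>G\<^esub>)"

section \<open>Cost\<close>

definition standard_borel :: "'x measure \<Rightarrow> bool" where
  "standard_borel M \<longleftrightarrow>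
     (\<exists>X. topspace X = space M \<and> completely_metrizable_space X \<and> second_countable X \<and>
          sets M = sigma_sets (space M) {U. openin X U})"

definition standard_prob_space :: "'x measure \<Rightarrow> bool" where
  "standard_prob_space M \<longleftrightarrow> prob_space M \<and> standard_borel M"

definition pmp_action :: "('g, 'm) monoid_scheme \<Rightarrow> 'x measure \<Rightarrow> ('g \<Rightarrow> 'x \<Rightarrow> 'x) \<Rightarrow> bool" where
  "pmp_action G M \<phi> \<longleftrightarrow>
     group_action G (space M) \<phi> \<and>
     (\<forall>g\<in>carrier G. \<phi> g \<in> measurable M M \<and> distr M M (\<phi> g) = M)"

definition essentially_free ::
    "('g, 'm) monoid_scheme \<Rightarrow> 'x measure \<Rightarrow> ('g \<Rightarrow> 'x \<Rightarrow> 'x) \<Rightarrow> bool" where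
  "essentially_free G M \<phi> \<longleftrightarrow> (AE x in M. stabilizer G \<phi> x = {\<one>\<^bsub>G\<^esub>})"

definition orbit_rel ::
    "('g, 'm) monoid_scheme \<Rightarrow> 'x measure \<Rightarrow> ('g \<Rightarrow> 'x \<Rightarrow> 'x) \<Rightarrow> 'x rel" where
  "orbit_rel G M \<phi> = {(x, y). x \<in> space M \<and> y \<in> orbit G \<phi> x}"

definition borel_isomorphism ::
    "'x measure \<Rightarrow> 'x set \<Rightarrow> 'x set \<Rightarrow> ('x \<Rightarrow> 'x) \<Rightarrow> bool" where
  "borel_isomorphism M A B f \<longleftrightarrow>
     A \<in> sets M \<and> B \<in> sets M \<and> bij_betw f A B \<and>
     f \<in> measurable (restrict_space M A) (restrict_space M B) \<and>
     inv_into A f \<in> measurable (restrict_space M B) (restrict_space M A)"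

definition smallest_equiv :: "'x set \<Rightarrow> 'x rel \<Rightarrow> 'x rel" where
  "smallest_equiv X E = \<Inter>{S. equiv X S \<and> E \<subseteq> S}"

text \<open>
  Families are indexed by the natural numbers; finite families are included because the
  domains may be empty.  ``Up to a null set'' means that after deleting a null set \<open>N\<close> from
  the space, the pairs of the graphing that survive generate what is left of \<open>R\<close>.  The
  deletion has to precede the generation: the maps may behave arbitrarily on null sets, so a
  generated relation could otherwise pass through a null set at no cost.
\<close>

definition graphing ::
    "'x measure \<Rightarrow> 'x rel \<Rightarrow> (nat \<Rightarrow> 'x set) \<Rightarrow> (nat \<Rightarrow> 'x set) \<Rightarrow> (nat \<Rightarrow> 'x \<Rightarrow> 'x) \<Rightarrow> bool" where
  "graphing M R A B f \<longleftrightarrow>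
     (\<forall>i. borel_isomorphism M (A i) (B i) (f i) \<and>
          (AE x in M. x \<in> A i \<longrightarrow> (x, f i x) \<in> R)) \<and>
     (\<exists>N\<in>null_sets M. let X = space M - N in
        smallest_equiv X ({(x, f i x) | i x. x \<in> A i} \<inter> X \<times> X) = R \<inter> X \<times> X)"

definition cost :: "'x measure \<Rightarrow> 'x rel \<Rightarrow> ennreal" where
  "cost M R = Inf {\<Sum>i. emeasure M (A i) | A B f. graphing M R A B f}"

text \<open>
  The type argument is the type whose subsets carry the probability spaces of the actions.
\<close>

definition fixed_price_one :: "'x itself \<Rightarrow> ('g, 'm) monoid_scheme \<Rightarrow> bool" where
  "fixed_price_one TYPE('x) G \<longleftrightarrow>
     infinite (carrier G) \<and>
     (\<forall>(M :: 'x measure) \<phi>.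
        standard_prob_space M \<and> pmp_action G M \<phi> \<and> essentially_free G M \<phi> \<longrightarrow>
        cost M (orbit_rel G M \<phi>) = 1)"

section \<open>Complex Hilbert spaces and unitarizability\<close>

definition complex_ring :: "complex ring" where
  "complex_ring = \<lparr>carrier = UNIV, mult = (*), one = 1, zero = 0, add = (+)\<rparr>"

text \<open>
  As always for HOL-Algebra modules, the fields \<open>mult\<close> and \<open>one\<close> inherited from the ring
  record are not used.
\<close>

record 'h inner_module = "(complex, 'h) module" +
  hinner :: "'h \<Rightarrow> 'h \<Rightarrow> complex"

definition hnorm :: "'h inner_module \<Rightarrow> 'h \<Rightarrow> real" where
  "hnorm H x = sqrt (Re (hinner H x x))"

locale complex_hilbert_space = Module.module complex_ring H
  for H :: "'h inner_module" (structure) +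
  assumes hinner_add_left: "\<lbrakk>x \<in> carrier H; y \<in> carrier H; z \<in> carrier H\<rbrakk> \<Longrightarrow>
      hinner H (x \<oplus>\<^bsub>H\<^esub> y) z = hinner H x z + hinner H y z"
    and hinner_scale_left: "\<lbrakk>x \<in> carrier H; y \<in> carrier H\<rbrakk> \<Longrightarrow>
      hinner H (c \<odot>\<^bsub>H\<^esub> x) y = c * hinner H x y"
    and hinner_commute: "\<lbrakk>x \<in> carrier H; y \<in> carrier H\<rbrakk> \<Longrightarrow>
      hinner H y x = cnj (hinner H x y)"
    and hinner_nonneg: "x \<in> carrier H \<Longrightarrow> 0 \<le> Re (hinner H x x)"
    and hinner_definite: "\<lbrakk>x \<in> carrier H; hinner H x x = 0\<rbrakk> \<Longrightarrow> x = \<zero>\<^bsub>H\<^esub>"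
    and complete: "Metric_space.mcomplete (carrier H) (\<lambda>x y. hnorm H (x \<ominus>\<^bsub>H\<^esub> y))"

definition bounded_linear_operator :: "'h inner_module \<Rightarrow> ('h \<Rightarrow> 'h) \<Rightarrow> bool" where
  "bounded_linear_operator H T \<longleftrightarrow>
     T \<in> carrier H \<rightarrow> carrier H \<and>
     (\<forall>x\<in>carrier H. \<forall>y\<in>carrier H. T (x \<oplus>\<^bsub>H\<^esub> y) = T x \<oplus>\<^bsub>H\<^esub> T y) \<and>
     (\<forall>c. \<forall>x\<in>carrier H. T (c \<odot>\<^bsub>H\<^esub> x) = c \<odot>\<^bsub>H\<^esub> T x) \<and>
     (\<exists>C. \<forall>x\<in>carrier H. hnorm H (T x) \<le> C * hnorm H x)"

definition op_norm :: "'h inner_module \<Rightarrow> ('h \<Rightarrow> 'h) \<Rightarrow> real" where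
  "op_norm H T = (SUP x\<in>{x \<in> carrier H. hnorm H x \<le> 1}. hnorm H (T x))"

text \<open>
  The monoid \<open>B(H)\<close>; its group of units is \<open>units_of (bounded_operators H)\<close>.  Operators are
  normalized to be \<open>undefined\<close> outside the carrier, so that equality of operators is
  equality of functions.
\<close>

definition bounded_operators :: "'h inner_module \<Rightarrow> ('h \<Rightarrow> 'h) monoid" where
  "bounded_operators H =
     \<lparr>carrier = {T \<in> extensional (carrier H). bounded_linear_operator H T},
      mult = compose (carrier H),
      one = (\<lambda>x\<in>carrier H. x)\<rparr>"

definition unitary_operator :: "'h inner_module \<Rightarrow> ('h \<Rightarrow> 'h) \<Rightarrow> bool" where
  "unitary_operator H U \<longleftrightarrow>
     U \<in> Units (bounded_operators H) \<and>
     (\<forall>x\<in>carrier H. \<forall>y\<in>carrier H. hinner H (U x) (U y) = hinner H x y)"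

definition uniformly_bounded_rep ::
    "('g, 'm) monoid_scheme \<Rightarrow> 'h inner_module \<Rightarrow> ('g \<Rightarrow> 'h \<Rightarrow> 'h) \<Rightarrow> bool" where
  "uniformly_bounded_rep G H \<pi> \<longleftrightarrow>
     \<pi> \<in> hom G (units_of (bounded_operators H)) \<and>
     bdd_above ((\<lambda>g. op_norm H (\<pi> g)) ` carrier G)"

definition conjugate_to_unitary ::
    "('g, 'm) monoid_scheme \<Rightarrow> 'h inner_module \<Rightarrow> ('g \<Rightarrow> 'h \<Rightarrow> 'h) \<Rightarrow> bool" where
  "conjugate_to_unitary G H \<pi> \<longleftrightarrow>
     (\<exists>T\<in>Units (bounded_operators H). \<forall>g\<in>carrier G.
        unitary_operator H
          (T \<otimes>\<^bsub>bounded_operators H\<^esub> \<pi> g \<otimes>\<^bsub>bounded_operators H\<^esub> inv\<^bsub>bounded_operators H\<^esub> T))"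

text \<open>
  The quantifier over Hilbert spaces ranges over all Hilbert space structures on subsets of
  the type argument.  Any type with at least continuum many elements, such as
  \<^typ>\<open>nat \<Rightarrow> complex\<close>, accommodates every separable Hilbert space up to isomorphism, and
  unitarizability of a countable group is determined by its representations on separable
  spaces.  Enlarging the type can only make the condition harder to satisfy.
\<close>

definition unitarizable :: "'h itself \<Rightarrow> ('g, 'm) monoid_scheme \<Rightarrow> bool" where
  "unitarizable TYPE('h) G \<longleftrightarrow>
     (\<forall>(H :: 'h inner_module) \<pi>.
        complex_hilbert_space H \<and> uniformly_bounded_rep G H \<pi> \<longrightarrow> conjugate_to_unitary G H \<pi>)"

end

(*
Suppose that G is unitarizable; we show that the orbit relation of every free pmp action has cost 1.
Let C be the infinite cyclic group generated by a.  The graphing by a has cost 1 and is completed to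
a graphing of the whole relation by the partial maps x |-> t x, x in E t, where t ranges over a
finite generating set.  Start with E t = X and delete edges which lie on a cycle, one type of cycle
at a time.  Each stage still generates the relation, and in the limit the edges form a forest on the
cosets of C.  So it is enough to show that each limit set E t is null.

If t^-1 C t and C are commensurable, then infinitely many disjoint translates of E t exist, because
two edges never join the same two cosets.  Otherwise direct every edge towards the root of its tree
and let p(u,v) be the probability that v is the parent of u.  The rows of p have sum at most 1 and
p + p^T is invariant, so that the derivation D(g) = g p g^-1 - p is antisymmetric and bounded by the
Schur test.  Unitarizability makes D inner: D(g) = g T g^-1 - T up to sign with T bounded, and then
T - p is an invariant matrix.  Letting g run through the infinite stabilizers of u and of v shows
that p(u,v) + p(v,u) = 0 if both stabilizers have infinite orbits, hence E t is null.

That the cost is at least 1 holds since, given a set Y of small measure which meets every orbit,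
every point outside Y has an edge which brings it closer to Y.
*)
theory Submission
  imports Defs "HOL-Analysis.Infinite_Sum"
begin

text \<open>A vertex of the forest has one parent but possibly an unbounded expected number of
  children. The matrix of edge probabilities is therefore invariant, but nothing bounds it as an
  operator. Directing the edges bounds the rows at the price of invariance, since the roots come
  from an enumeration of the group. The cocycle D measures this loss; its symmetric part vanishes,
  so its row bound is a column bound too.

  D becomes inner through the triangular representation with rows (g, D(g) g) and (0, g). Once this
  is unitary for an equivalent inner product, the orthogonal complement of the first summand is
  invariant, and it is the graph of a bounded operator, which is T up to sign.

  At the end an invariant matrix T - p is compared with itself along two orbits. Let f = p(u,v) +
  p(v,u). If v is fixed and u moves to infinity, then p(v,u) tends to 0, so p(u,v) tends to f, and T
  - p equals -f. If u is fixed and v moves, p(u,v) has bounded sum, and a bounded T cannot have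
  infinitely many entries near -f in one row.

  Only the finite stages of the pruning serve as graphings. The limit forest need not generate
  anything; it controls the measures of the stages.\<close>

section \<open>The Hilbert space of square summable sequences\<close>

text \<open>A type of its own can carry the classes \<open>real_inner\<close> and
  \<open>complete_space\<close>, so that the library on bounded linear maps applies. The record
  format of the definitions is reached later by transport.\<close>

typedef ell2 = "{x :: nat \<Rightarrow> complex. (\<lambda>n. (cmod (x n))\<^sup>2) summable_on UNIV}"
  morphisms coord Abs_ell2
  by (rule exI[of _ "\<lambda>_. 0"]) simp

setup_lifting type_definition_ell2

lemma coord_summable: "(\<lambda>n. (cmod (coord x n))\<^sup>2) summable_on UNIV"
  using coord[of x] by simp

lemma ell2_add_mem:
  assumes "(\<lambda>n. (cmod (x n))\<^sup>2) summable_on UNIV" "(\<lambda>n. (cmod (y n))\<^sup>2) summable_on UNIV"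
  shows "(\<lambda>n::nat. (cmod (x n + y n))\<^sup>2) summable_on UNIV"
proof (rule summable_on_comparison_test)
  show "(\<lambda>n. 2 * (cmod (x n))\<^sup>2 + 2 * (cmod (y n))\<^sup>2) summable_on UNIV"
    using assms by (intro summable_on_add summable_on_cmult_right)
  fix n
  have "(cmod (x n + y n))\<^sup>2 \<le> (cmod (x n) + cmod (y n))\<^sup>2"
    by (simp add: norm_triangle_ineq power_mono)
  also have "\<dots> \<le> 2 * (cmod (x n))\<^sup>2 + 2 * (cmod (y n))\<^sup>2"
    using sum_squares_bound[of "cmod (x n)" "cmod (y n)"] by (simp add: power2_sum)
  finally show "(cmod (x n + y n))\<^sup>2 \<le> 2 * (cmod (x n))\<^sup>2 + 2 * (cmod (y n))\<^sup>2" .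
qed auto

lemma ell2_mult_mem:
  assumes "(\<lambda>n. (cmod (x n))\<^sup>2) summable_on UNIV"
  shows "(\<lambda>n::nat. (cmod (c * x n))\<^sup>2) summable_on UNIV"
  using summable_on_cmult_right[OF assms] by (simp add: norm_mult power_mult_distrib)

lemma ell2_inner_abs_summable:
  assumes "(\<lambda>n. (cmod (x n))\<^sup>2) summable_on UNIV" "(\<lambda>n. (cmod (y n))\<^sup>2) summable_on UNIV"
  shows "(\<lambda>n::nat. cmod (x n * cnj (y n))) summable_on UNIV"
proof (rule summable_on_comparison_test)
  show "(\<lambda>n. (cmod (x n))\<^sup>2 + (cmod (y n))\<^sup>2) summable_on UNIV"
    using assms by (intro summable_on_add)
  fix n
  show "cmod (x n * cnj (y n)) \<le> (cmod (x n))\<^sup>2 + (cmod (y n))\<^sup>2"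
    using sum_squares_bound[of "cmod (x n)" "cmod (y n)"]
      mult_nonneg_nonneg[OF norm_ge_zero[of "x n"] norm_ge_zero[of "y n"]]
    unfolding norm_mult complex_mod_cnj by linarith
qed auto

instantiation ell2 :: ab_group_add
begin
lift_definition zero_ell2 :: ell2 is "\<lambda>_. 0" by simp
lift_definition plus_ell2 :: "ell2 \<Rightarrow> ell2 \<Rightarrow> ell2" is "\<lambda>x y n. x n + y n"
  by (rule ell2_add_mem)
lift_definition uminus_ell2 :: "ell2 \<Rightarrow> ell2" is "\<lambda>x n. - x n" by simp
definition minus_ell2 :: "ell2 \<Rightarrow> ell2 \<Rightarrow> ell2" where "minus_ell2 x y = x + (- y)"
instance
proof
  fix x y z :: ell2
  show "x + y + z = x + (y + z)" by transfer (simp add: add.assoc)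
  show "x + y = y + x" by transfer (simp add: add.commute)
  show "0 + x = x" by transfer simp
  show "- x + x = 0" by transfer simp
  show "x - y = x + - y" by (rule minus_ell2_def)
qed
end

lift_definition cscale :: "complex \<Rightarrow> ell2 \<Rightarrow> ell2" is "\<lambda>c x n. c * x n"
  by (rule ell2_mult_mem)

lift_definition cinner :: "ell2 \<Rightarrow> ell2 \<Rightarrow> complex" is "\<lambda>x y. \<Sum>\<^sub>\<infinity>n. x n * cnj (y n)" .

lemma coord_zero [simp]: "coord 0 n = 0"
  and coord_add [simp]: "coord (x + y) n = coord x n + coord y n"
  and coord_uminus [simp]: "coord (- x) n = - coord x n"
  and coord_cscale [simp]: "coord (cscale c x) n = c * coord x n"
  by (simp_all add: zero_ell2.rep_eq plus_ell2.rep_eq uminus_ell2.rep_eq cscale.rep_eq)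

lemma coord_diff [simp]: "coord (x - y) n = coord x n - coord y n"
  by (subst minus_ell2_def) (simp del: add_uminus_conv_diff)

lemma coord_eqI: "(\<And>n. coord x n = coord y n) \<Longrightarrow> x = y"
  by (simp add: coord_inject[symmetric] fun_eq_iff)

lemma coord_sum [simp]: "coord (\<Sum>i\<in>I. x i) n = (\<Sum>i\<in>I. coord (x i) n)"
  by (induction I rule: infinite_finite_induct) auto

lemma cinner_abs_summable: "(\<lambda>n. cmod (coord x n * cnj (coord y n))) summable_on UNIV"
  by (intro ell2_inner_abs_summable coord_summable)

lemma cinner_summable: "(\<lambda>n. coord x n * cnj (coord y n)) summable_on UNIV"
  using cinner_abs_summable by (rule abs_summable_summable)

lemma cinner_coord: "cinner x y = (\<Sum>\<^sub>\<infinity>n. coord x n * cnj (coord y n))"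
  by (rule cinner.rep_eq)

lemma cinner_add_left: "cinner (x + y) z = cinner x z + cinner y z"
  unfolding cinner_coord
  using infsum_add[OF cinner_summable[of x z] cinner_summable[of y z]]
  by (simp add: algebra_simps)

lemma cinner_cscale_left: "cinner (cscale c x) y = c * cinner x y"
  unfolding cinner_coord by (simp add: mult.assoc infsum_cmult_right')

lemma cinner_commute: "cinner y x = cnj (cinner x y)"
proof -
  have "cnj (cinner x y) = (\<Sum>\<^sub>\<infinity>n. cnj (coord x n * cnj (coord y n)))"
    unfolding cinner_coord by (rule infsum_cnj[symmetric])
  thus ?thesis by (simp add: cinner_coord mult.commute)
qed

lemma infsum_of_real:
  "(\<Sum>\<^sub>\<infinity>n\<in>A. complex_of_real (f n)) = of_real (\<Sum>\<^sub>\<infinity>n\<in>A. f n)" if "f summable_on A"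
  using has_sum_bounded_linear[OF bounded_linear_of_real has_sum_infsum[OF that]] by (rule infsumI)

lemma cinner_self: "cinner x x = of_real (\<Sum>\<^sub>\<infinity>n. (cmod (coord x n))\<^sup>2)"
  unfolding cinner_coord complex_norm_square[symmetric]
  using infsum_of_real[OF coord_summable[of x]] by simp

lemma Re_cinner_self: "Re (cinner x x) = (\<Sum>\<^sub>\<infinity>n. (cmod (coord x n))\<^sup>2)"
  by (simp add: cinner_self)

lemma cinner_self_eq_0: "Re (cinner x x) = 0 \<longleftrightarrow> x = 0"
proof
  assume "Re (cinner x x) = 0"
  hence "(cmod (coord x n))\<^sup>2 = 0" for n
    using nonneg_infsum_le_0D[of "\<lambda>n. (cmod (coord x n))\<^sup>2" UNIV n] coord_summable[of x]
    by (simp add: Re_cinner_self)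
  thus "x = 0" by (intro coord_eqI) simp
qed (simp add: cinner_coord)

text \<open>The real part of \<open>cinner\<close> induces the same norm. Orthogonality below is
  meant in this real sense, which suffices because only real parts of matrix entries are compared in
  the end.\<close>

instantiation ell2 :: real_inner
begin
definition scaleR_ell2 :: "real \<Rightarrow> ell2 \<Rightarrow> ell2" where "scaleR_ell2 r x = cscale (of_real r) x"
definition inner_ell2 :: "ell2 \<Rightarrow> ell2 \<Rightarrow> real" where "inner_ell2 x y = Re (cinner x y)"
definition norm_ell2 :: "ell2 \<Rightarrow> real" where "norm_ell2 x = sqrt (inner x x)"
definition dist_ell2 :: "ell2 \<Rightarrow> ell2 \<Rightarrow> real" where "dist_ell2 x y = norm (x - y)"
definition sgn_ell2 :: "ell2 \<Rightarrow> ell2" where "sgn_ell2 x = scaleR (inverse (norm x)) x"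
definition uniformity_ell2 :: "(ell2 \<times> ell2) filter" where
  "uniformity_ell2 = (INF e\<in>{0 <..}. principal {(x, y). dist x y < e})"
definition open_ell2 :: "ell2 set \<Rightarrow> bool" where
  "open_ell2 U = (\<forall>x\<in>U. \<forall>\<^sub>F (x', y) in uniformity. x' = x \<longrightarrow> y \<in> U)"
instance
proof
  fix x y z :: ell2 and r s :: real
  show "r *\<^sub>R (x + y) = r *\<^sub>R x + r *\<^sub>R y"
    by (rule coord_eqI) (simp add: scaleR_ell2_def distrib_left)
  show "(r + s) *\<^sub>R x = r *\<^sub>R x + s *\<^sub>R x"
    by (rule coord_eqI) (simp add: scaleR_ell2_def distrib_right)
  show "r *\<^sub>R s *\<^sub>R x = (r * s) *\<^sub>R x" "1 *\<^sub>R x = x"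
    by (rule coord_eqI, simp add: scaleR_ell2_def)+
  show "inner x y = inner y x"
    using cinner_commute[of x y] by (simp add: inner_ell2_def)
  show "inner (x + y) z = inner x z + inner y z"
    by (simp add: inner_ell2_def cinner_add_left)
  show "inner (r *\<^sub>R x) y = r * inner x y"
    by (simp add: inner_ell2_def scaleR_ell2_def cinner_cscale_left)
  show "0 \<le> inner x x" by (simp add: inner_ell2_def Re_cinner_self infsum_nonneg)
  show "(inner x x = 0) = (x = 0)" by (simp add: inner_ell2_def cinner_self_eq_0)
  show "norm x = sqrt (inner x x)" by (rule norm_ell2_def)
  show "dist x y = norm (x - y)" by (rule dist_ell2_def)
  show "sgn x = inverse (norm x) *\<^sub>R x" by (rule sgn_ell2_def)
  show "uniformity = (INF e\<in>{0 <..}. principal {(x :: ell2, y). dist x y < e})"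
    by (rule uniformity_ell2_def)
  show "open U = (\<forall>x\<in>U. \<forall>\<^sub>F (x', y) in uniformity. x' = x \<longrightarrow> y \<in> U)" for U :: "ell2 set"
    by (rule open_ell2_def)
qed
end

lemma coord_scaleR [simp]: "coord (r *\<^sub>R x) n = of_real r * coord x n"
  by (simp add: scaleR_ell2_def)

lemma norm_ell2_sq: "(norm x)\<^sup>2 = (\<Sum>\<^sub>\<infinity>n. (cmod (coord x n))\<^sup>2)"
  by (simp add: power2_norm_eq_inner inner_ell2_def Re_cinner_self)

lemma sum_coord_le: "finite F \<Longrightarrow> (\<Sum>n\<in>F. (cmod (coord x n))\<^sup>2) \<le> (norm x)\<^sup>2"
  unfolding norm_ell2_sq by (rule finite_sum_le_infsum) (auto intro: coord_summable)

lemma coord_le_norm: "cmod (coord x n) \<le> norm x"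
  by (rule power2_le_imp_le) (use sum_coord_le[of "{n}" x] in simp_all)

text \<open>A single bound on finite partial sums yields both square summability and the norm
  estimate. It produces most of the vectors below that are given by a formula for their
  coordinates.\<close>

lemma ell2_of_finite_sums:
  fixes c :: real
  assumes "0 \<le> c" "\<And>F. finite F \<Longrightarrow> (\<Sum>n\<in>F. (cmod (x n))\<^sup>2) \<le> c\<^sup>2"
  obtains y where "coord y = x" "norm y \<le> c"
proof -
  have s: "(\<lambda>n. (cmod (x n))\<^sup>2) summable_on UNIV"
    using assms(2) by (intro nonneg_bdd_above_summable_on bdd_aboveI2[where M = "c\<^sup>2"]) auto
  hence y: "coord (Abs_ell2 x) = x" by (simp add: Abs_ell2_inverse)
  have "(norm (Abs_ell2 x))\<^sup>2 \<le> c\<^sup>2"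
    unfolding norm_ell2_sq y by (rule infsum_le_finite_sums[OF s]) (rule assms(2))
  hence "norm (Abs_ell2 x) \<le> c" using assms(1) by (rule power2_le_imp_le)
  with y show ?thesis by (rule that)
qed

instance ell2 :: complete_space
proof
  fix X :: "nat \<Rightarrow> ell2" assume "Cauchy X"
  have C: "Cauchy (\<lambda>m. coord (X m) n)" for n
  proof (rule metric_CauchyI)
    fix e :: real assume "e > 0"
    then obtain M where M: "\<forall>k\<ge>M. \<forall>l\<ge>M. dist (X k) (X l) < e"
      using metric_CauchyD[OF \<open>Cauchy X\<close>] by blast
    have "dist (coord (X k) n) (coord (X l) n) \<le> dist (X k) (X l)" for k l
      using coord_le_norm[of "X k - X l" n] by (simp add: dist_norm)
    with M show "\<exists>M. \<forall>k\<ge>M. \<forall>l\<ge>M. dist (coord (X k) n) (coord (X l) n) < e"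
      by (blast intro: le_less_trans)
  qed
  define L where "L n = lim (\<lambda>m. coord (X m) n)" for n
  have L: "(\<lambda>m. coord (X m) n) \<longlonglongrightarrow> L n" for n
    using C[of n] unfolding L_def
    by (simp add: Cauchy_convergent_iff convergent_LIMSEQ_iff)
  \<comment> \<open>The difference is estimated on finite sets of coordinates, where the limit in
    \<open>k\<close> can be taken; this also shows that it is square summable.\<close>
  have *: "\<exists>y. coord y = (\<lambda>n. coord (X m) n - L n) \<and> norm y \<le> e"
    if e: "e > 0" "\<And>k. k \<ge> M \<Longrightarrow> dist (X m) (X k) < e" for m M e
  proof -
    have "(\<Sum>n\<in>F. (cmod (coord (X m) n - L n))\<^sup>2) \<le> e\<^sup>2" if "finite F" for F
    proof (rule LIMSEQ_le_const2)
      show "(\<lambda>k. \<Sum>n\<in>F. (cmod (coord (X m) n - coord (X k) n))\<^sup>2)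
          \<longlonglongrightarrow> (\<Sum>n\<in>F. (cmod (coord (X m) n - L n))\<^sup>2)"
        by (intro tendsto_intros L)
      show "\<exists>N. \<forall>k\<ge>N. (\<Sum>n\<in>F. (cmod (coord (X m) n - coord (X k) n))\<^sup>2) \<le> e\<^sup>2"
      proof (intro exI allI impI)
        fix k assume "k \<ge> M"
        have "(\<Sum>n\<in>F. (cmod (coord (X m - X k) n))\<^sup>2) \<le> (norm (X m - X k))\<^sup>2"
          using \<open>finite F\<close> by (rule sum_coord_le)
        also have "\<dots> \<le> e\<^sup>2"
          using e(2)[OF \<open>k \<ge> M\<close>] by (intro power_mono) (auto simp: dist_norm)
        finally show "(\<Sum>n\<in>F. (cmod (coord (X m) n - coord (X k) n))\<^sup>2) \<le> e\<^sup>2" by simp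
      qed
    qed
    thus ?thesis
      using ell2_of_finite_sums[of e "\<lambda>n. coord (X m) n - L n"] e(1) by fastforce
  qed
  \<comment> \<open>The radius 1 is arbitrary: one square summable difference
    \<open>X M0 - L\<close> puts \<open>L\<close> itself into the space.\<close>
  obtain M0 where "\<forall>k\<ge>M0. \<forall>l\<ge>M0. dist (X k) (X l) < 1"
    using metric_CauchyD[OF \<open>Cauchy X\<close> zero_less_one] by blast
  then obtain y where y: "coord y = (\<lambda>n. coord (X M0) n - L n)"
    using *[of 1 M0 M0] by auto
  define Y where "Y = X M0 - y"
  have Y: "coord Y n = L n" for n by (simp add: Y_def y)
  have "X \<longlonglongrightarrow> Y"
  proof (rule metric_LIMSEQ_I)
    fix e :: real assume "e > 0"
    then obtain M where M: "\<forall>k\<ge>M. \<forall>l\<ge>M. dist (X k) (X l) < e / 2"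
      using metric_CauchyD[OF \<open>Cauchy X\<close> half_gt_zero] by blast
    have "dist (X m) Y < e" if "m \<ge> M" for m
    proof -
      have "\<exists>z. coord z = (\<lambda>n. coord (X m) n - L n) \<and> norm z \<le> e / 2"
        using M that \<open>e > 0\<close> by (intro *[of "e/2" M m]) auto
      then obtain z where z: "coord z = (\<lambda>n. coord (X m) n - L n)" "norm z \<le> e / 2"
        by blast
      have "z = X m - Y" by (rule coord_eqI) (simp add: z Y)
      with z(2) \<open>e > 0\<close> show ?thesis by (simp add: dist_norm)
    qed
    thus "\<exists>M. \<forall>m\<ge>M. dist (X m) Y < e" by blast
  qed
  thus "convergent X" by (auto simp: convergent_def)
qed

lift_definition ket :: "nat \<Rightarrow> ell2" is "\<lambda>i n. if n = i then 1 else 0"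
proof -
  fix i
  have "(\<lambda>n. (cmod (if n = i then 1 else 0))\<^sup>2) summable_on {i}" by simp
  thus "(\<lambda>n. (cmod (if n = i then 1 else 0))\<^sup>2) summable_on UNIV"
    by (rule summable_on_cong_neutral[THEN iffD1, rotated -1]) auto
qed

lemma coord_ket: "coord (ket i) n = (if n = i then 1 else 0)"
  by (simp add: ket.rep_eq)

lemma norm_sum_ket:
  assumes "finite F"
  shows "norm (\<Sum>i\<in>F. ket i) = sqrt (card F)"
proof -
  have "(norm (\<Sum>i\<in>F. ket i))\<^sup>2 = (\<Sum>\<^sub>\<infinity>n. if n \<in> F then 1 else 0)"
    unfolding norm_ell2_sq
    by (rule infsum_cong) (use assms in \<open>simp add: coord_ket\<close>)
  also have "\<dots> = (\<Sum>\<^sub>\<infinity>n\<in>F. 1)"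
    by (rule infsum_cong_neutral) auto
  also have "\<dots> = card F" using assms by simp
  finally show ?thesis by (intro real_sqrt_unique[symmetric]) auto
qed

section \<open>Cauchy-Schwarz for sequences, orthogonal projections and Schur's test\<close>

lemma ell2_cauchy_schwarz:
  assumes "(\<lambda>n::nat. (x n)\<^sup>2) summable_on UNIV" "(\<lambda>n. (y n)\<^sup>2) summable_on UNIV"
  shows "(\<lambda>n. \<bar>x n * y n\<bar> :: real) summable_on UNIV"
    "(\<Sum>\<^sub>\<infinity>n. \<bar>x n * y n\<bar>)\<^sup>2 \<le> (\<Sum>\<^sub>\<infinity>n. (x n)\<^sup>2) * (\<Sum>\<^sub>\<infinity>n. (y n)\<^sup>2)"
proof -
  define X where "X = Abs_ell2 (\<lambda>n. of_real \<bar>x n\<bar>)"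
  define Y where "Y = Abs_ell2 (\<lambda>n. of_real \<bar>y n\<bar>)"
  have X: "coord X n = of_real \<bar>x n\<bar>" and Y: "coord Y n = of_real \<bar>y n\<bar>" for n
    using assms by (simp_all add: X_def Y_def Abs_ell2_inverse)
  show XY: "(\<lambda>n. \<bar>x n * y n\<bar> :: real) summable_on UNIV"
    using cinner_abs_summable[of X Y] by (simp add: X Y norm_mult abs_mult)
  have "inner X Y = (\<Sum>\<^sub>\<infinity>n. \<bar>x n * y n\<bar>)"
    using infsum_of_real[of "\<lambda>n. \<bar>x n * y n\<bar>" UNIV] XY
    by (simp add: inner_ell2_def cinner_coord X Y abs_mult)
  moreover have "(inner X Y)\<^sup>2 \<le> (norm X)\<^sup>2 * (norm Y)\<^sup>2"
    using Cauchy_Schwarz_ineq[of X Y] by (simp add: power2_norm_eq_inner)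
  ultimately show "(\<Sum>\<^sub>\<infinity>n. \<bar>x n * y n\<bar>)\<^sup>2 \<le> (\<Sum>\<^sub>\<infinity>n. (x n)\<^sup>2) * (\<Sum>\<^sub>\<infinity>n. (y n)\<^sup>2)"
    by (simp add: norm_ell2_sq X Y)
qed

text \<open>A minimizing sequence for the squared distance is Cauchy by the parallelogram law. The
  application is to the image of a subspace under an operator \<open>S\<close>, which amounts to
  projecting for the inner product of \<open>S x\<close> and \<open>S y\<close>.\<close>

lemma orthogonal_projection_exists:
  fixes W :: "'a::real_inner set"
  assumes W: "subspace W" "complete W"
  shows "\<exists>w\<in>W. \<forall>v\<in>W. inner (z - w) v = 0"
proof -
  define q where "q w = (norm (z - w))\<^sup>2" for w
  define \<delta> where "\<delta> = Inf (q ` W)"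
  have ne: "q ` W \<noteq> {}" using subspace_0[OF W(1)] by auto
  have bdd: "bdd_below (q ` W)" by (rule bdd_belowI2[of _ 0]) (simp add: q_def)
  have \<delta>: "\<delta> \<le> q w" if "w \<in> W" for w
    unfolding \<delta>_def using bdd that by (intro cINF_lower)
  have par: "(norm (v - w))\<^sup>2 \<le> 2 * (q v - \<delta>) + 2 * (q w - \<delta>)" if "v \<in> W" "w \<in> W" for v w
  proof -
    have "(1/2) *\<^sub>R (v + w) \<in> W" using W(1) that by (intro subspace_scale subspace_add)
    note \<delta>[OF this]
    moreover have "(norm (v - w))\<^sup>2 = 2 * q v + 2 * q w - 4 * q ((1/2) *\<^sub>R (v + w))"
      by (simp add: q_def power2_norm_eq_inner algebra_simps inner_commute inner_add_right inner_diff_right)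
    ultimately show ?thesis by (simp add: algebra_simps)
  qed
  have "\<exists>w\<in>W. q w < \<delta> + 1 / real (Suc n)" for n
  proof -
    have "\<exists>y\<in>q ` W. y < \<delta> + 1 / real (Suc n)"
      unfolding \<delta>_def by (rule cInf_lessD[OF ne]) simp
    thus ?thesis by auto
  qed
  then obtain u where u: "u n \<in> W" "q (u n) < \<delta> + 1 / real (Suc n)" for n by metis
  have "Cauchy u"
  proof (rule metric_CauchyI)
    fix e :: real assume "e > 0"
    \<comment> \<open>Beyond \<open>N\<close> both excesses over \<open>\<delta>\<close> are below a
      quarter of the square of \<open>e\<close>, and \<open>par\<close> counts each of them
      twice.\<close>
    obtain N where N: "4 / e\<^sup>2 < real N" using reals_Archimedean2 by blast
    have "dist (u m) (u n) < e" if "m \<ge> N" "n \<ge> N" for m n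
    proof -
      have r: "1 / real (Suc k) < e\<^sup>2 / 4" if "k \<ge> N" for k
      proof -
        have "4 / e\<^sup>2 < real (Suc k)" using N that by linarith
        thus ?thesis using \<open>e > 0\<close> by (simp add: field_simps)
      qed
      have "(norm (u m - u n))\<^sup>2 \<le> 2 * (q (u m) - \<delta>) + 2 * (q (u n) - \<delta>)"
        by (rule par[OF u(1) u(1)])
      also have "\<dots> < e\<^sup>2" using u(2)[of m] u(2)[of n] r[OF that(1)] r[OF that(2)] by argo
      finally show ?thesis
        using \<open>e > 0\<close> unfolding dist_norm by (rule power2_less_imp_less[OF _ less_imp_le])
    qed
    thus "\<exists>N. \<forall>m\<ge>N. \<forall>n\<ge>N. dist (u m) (u n) < e" by blast
  qed
  with W(2) u(1) obtain w where w: "w \<in> W" "u \<longlonglongrightarrow> w"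
    unfolding complete_def by blast
  have "(\<lambda>n. q (u n)) \<longlonglongrightarrow> q w" unfolding q_def by (intro tendsto_intros w(2))
  moreover have "(\<lambda>n. \<delta> + 1 / real (Suc n)) \<longlonglongrightarrow> \<delta> + 0"
    by (intro tendsto_intros LIMSEQ_Suc lim_1_over_n)
  ultimately have qw: "q w \<le> \<delta>"
    using u(2) by (intro LIMSEQ_le[of "\<lambda>n. q (u n)" "q w" "\<lambda>n. \<delta> + 1 / real (Suc n)"]) (auto intro: less_imp_le)
  have "inner (z - w) v = 0" if "v \<in> W" for v
  proof (cases "v = 0")
    case False
    \<comment> \<open>\<open>w + t v\<close> is the point nearest to \<open>z\<close> on the line
      through \<open>w\<close> in direction \<open>v\<close>. Moving there would gain
      \<open>(inner (z - w) v)^2 / inner v v\<close>, so this vanishes.\<close>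
    define t where "t = inner (z - w) v / inner v v"
    have "w + t *\<^sub>R v \<in> W" using W(1) w(1) that by (intro subspace_scale subspace_add)
    hence "q w \<le> q (w + t *\<^sub>R v)" using qw \<delta> by force
    also have "q (w + t *\<^sub>R v) = q w - 2 * t * inner (z - w) v + t\<^sup>2 * inner v v"
      unfolding q_def power2_norm_eq_inner
      by (simp add: algebra_simps inner_commute power2_eq_square inner_add_right inner_diff_right)
    also have "\<dots> = q w - (inner (z - w) v)\<^sup>2 / inner v v"
      using False by (simp add: t_def power2_eq_square field_simps)
    finally have "(inner (z - w) v)\<^sup>2 / inner v v \<le> 0" by simp
    moreover have "inner v v > 0" using False by simp
    ultimately show ?thesis by (simp add: divide_le_0_iff)
  qed simp
  with w(1) show ?thesis by blast
qed

lemma schur_row_bound: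
  fixes K :: "nat \<Rightarrow> real" and x :: ell2
  assumes K: "(\<lambda>j. \<bar>K j\<bar>) summable_on UNIV" "(\<Sum>\<^sub>\<infinity>j. \<bar>K j\<bar>) \<le> c"
  shows "(\<lambda>j. of_real (K j) * coord x j) summable_on UNIV"
    and "(\<lambda>j. \<bar>K j\<bar> * (cmod (coord x j))\<^sup>2) summable_on UNIV"
    and "(cmod (\<Sum>\<^sub>\<infinity>j. of_real (K j) * coord x j))\<^sup>2 \<le> c * (\<Sum>\<^sub>\<infinity>j. \<bar>K j\<bar> * (cmod (coord x j))\<^sup>2)"
proof -
  show s2: "(\<lambda>j. \<bar>K j\<bar> * (cmod (coord x j))\<^sup>2) summable_on UNIV"
  proof (rule summable_on_comparison_test)
    show "(\<lambda>j. \<bar>K j\<bar> * (norm x)\<^sup>2) summable_on UNIV" by (rule summable_on_cmult_left[OF K(1)])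
  qed (auto intro!: mult_left_mono power_mono coord_le_norm)
  \<comment> \<open>Cauchy-Schwarz for the splitting \<open>sqrt |K| * (sqrt |K| |x|)\<close>: the
    first factor gives the row sum, the second a weighted sum that can be added over all
    rows.\<close>
  define a where "a j = sqrt \<bar>K j\<bar>" for j
  define b where "b j = sqrt \<bar>K j\<bar> * cmod (coord x j)" for j
  have a2: "(a j)\<^sup>2 = \<bar>K j\<bar>" and b2: "(b j)\<^sup>2 = \<bar>K j\<bar> * (cmod (coord x j))\<^sup>2"
    and ab: "\<bar>a j * b j\<bar> = cmod (of_real (K j) * coord x j)" for j
    by (auto simp: a_def b_def power_mult_distrib norm_mult abs_mult simp flip: mult.assoc)
  note cs = ell2_cauchy_schwarz[of a b, unfolded a2 b2 ab, OF K(1) s2]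
  show s: "(\<lambda>j. of_real (K j) * coord x j) summable_on UNIV"
    using cs(1) by (rule abs_summable_summable)
  have "(cmod (\<Sum>\<^sub>\<infinity>j. of_real (K j) * coord x j))\<^sup>2 \<le> (\<Sum>\<^sub>\<infinity>j. cmod (of_real (K j) * coord x j))\<^sup>2"
    by (intro power_mono norm_infsum_bound cs(1)) simp
  also note cs(2)
  also have "(\<Sum>\<^sub>\<infinity>j. \<bar>K j\<bar>) * (\<Sum>\<^sub>\<infinity>j. \<bar>K j\<bar> * (cmod (coord x j))\<^sup>2)
      \<le> c * (\<Sum>\<^sub>\<infinity>j. \<bar>K j\<bar> * (cmod (coord x j))\<^sup>2)"
    by (intro mult_right_mono K(2) infsum_nonneg) auto
  finally show "(cmod (\<Sum>\<^sub>\<infinity>j. of_real (K j) * coord x j))\<^sup>2 \<le> c * (\<Sum>\<^sub>\<infinity>j. \<bar>K j\<bar> * (cmod (coord x j))\<^sup>2)" .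
qed

lemma infsum_sum:
  fixes f :: "'i \<Rightarrow> 'j \<Rightarrow> real"
  assumes "finite F" "\<And>i. i \<in> F \<Longrightarrow> f i summable_on A"
  shows "(\<lambda>j. \<Sum>i\<in>F. f i j) summable_on A"
    and "(\<Sum>\<^sub>\<infinity>j\<in>A. \<Sum>i\<in>F. f i j) = (\<Sum>i\<in>F. \<Sum>\<^sub>\<infinity>j\<in>A. f i j)"
  using assms by (induction F rule: finite_induct) (auto simp: infsum_add intro: summable_on_add)

text \<open>One factor \<open>c\<close> comes from the rows through \<open>schur_row_bound\<close>,
  the other from the columns once the sums over \<open>i\<close> and \<open>j\<close> are
  interchanged; together they give \<open>(c * norm x)^2\<close>.\<close>

lemma schur_test:
  fixes K :: "nat \<Rightarrow> nat \<Rightarrow> real" and x :: ell2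
  assumes row: "\<And>i. (\<lambda>j. \<bar>K i j\<bar>) summable_on UNIV" "\<And>i. (\<Sum>\<^sub>\<infinity>j. \<bar>K i j\<bar>) \<le> c"
    and col: "\<And>j. (\<lambda>i. \<bar>K i j\<bar>) summable_on UNIV" "\<And>j. (\<Sum>\<^sub>\<infinity>i. \<bar>K i j\<bar>) \<le> c"
  obtains y where "coord y = (\<lambda>i. \<Sum>\<^sub>\<infinity>j. of_real (K i j) * coord x j)" "norm y \<le> c * norm x"
proof -
  have "0 \<le> (\<Sum>\<^sub>\<infinity>j. \<bar>K 0 j\<bar>)" by (rule infsum_nonneg) simp
  hence c: "0 \<le> c" using row(2)[of 0] by simp
  have "(\<Sum>i\<in>F. (cmod (\<Sum>\<^sub>\<infinity>j. of_real (K i j) * coord x j))\<^sup>2) \<le> (c * norm x)\<^sup>2"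
    if F: "finite F" for F
  proof -
    have "(\<Sum>i\<in>F. (cmod (\<Sum>\<^sub>\<infinity>j. of_real (K i j) * coord x j))\<^sup>2)
        \<le> (\<Sum>i\<in>F. c * (\<Sum>\<^sub>\<infinity>j. \<bar>K i j\<bar> * (cmod (coord x j))\<^sup>2))"
      by (rule sum_mono, rule schur_row_bound(3)[OF row])
    also have "\<dots> = c * (\<Sum>\<^sub>\<infinity>j. \<Sum>i\<in>F. \<bar>K i j\<bar> * (cmod (coord x j))\<^sup>2)"
      by (subst infsum_sum(2)) (auto simp: sum_distrib_left intro!: schur_row_bound(2)[OF row] F)
    also have "(\<Sum>\<^sub>\<infinity>j. \<Sum>i\<in>F. \<bar>K i j\<bar> * (cmod (coord x j))\<^sup>2) \<le> (\<Sum>\<^sub>\<infinity>j. c * (cmod (coord x j))\<^sup>2)"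
    proof (rule infsum_mono)
      show "(\<lambda>j. \<Sum>i\<in>F. \<bar>K i j\<bar> * (cmod (coord x j))\<^sup>2) summable_on UNIV"
        by (intro infsum_sum(1) schur_row_bound(2)[OF row] F)
      show "(\<lambda>j. c * (cmod (coord x j))\<^sup>2) summable_on UNIV"
        by (intro summable_on_cmult_right coord_summable)
      fix j
      have "(\<Sum>i\<in>F. \<bar>K i j\<bar>) \<le> c"
        using finite_sum_le_infsum[OF col(1) F, of j] col(2)[of j] by auto
      thus "(\<Sum>i\<in>F. \<bar>K i j\<bar> * (cmod (coord x j))\<^sup>2) \<le> c * (cmod (coord x j))\<^sup>2"
        by (simp add: mult_right_mono flip: sum_distrib_right)
    qed
    also have "(\<Sum>\<^sub>\<infinity>j. c * (cmod (coord x j))\<^sup>2) = c * (norm x)\<^sup>2"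
      by (simp add: infsum_cmult_right' norm_ell2_sq)
    finally show ?thesis using c by (simp add: power_mult_distrib power2_eq_square mult_left_mono mult.assoc mult.left_commute)
  qed
  from ell2_of_finite_sums[OF mult_nonneg_nonneg[OF c norm_ge_zero[of x]] this] that
  show ?thesis by metis
qed

section \<open>Transport of \<open>ell2\<close> to the Hilbert space format of the
  definitions\<close>

section \<open>Bounded operators and unitarizability\<close>

lemma inj_squash: "inj (\<lambda>z::complex. z / of_real (1 + cmod z))"
proof (rule injI)
  fix z w :: complex
  assume eq: "z / of_real (1 + cmod z) = w / of_real (1 + cmod w)"
  have pos: "1 + cmod z > 0" "1 + cmod w > 0" by (simp_all add: add_pos_nonneg)
  have "cmod z / (1 + cmod z) = cmod w / (1 + cmod w)"
    using arg_cong[OF eq, of cmod] pos by (simp add: norm_divide del: of_real_add)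
  hence "cmod z = cmod w" using pos by (simp add: field_simps)
  thus "z = w" using eq pos by (simp del: of_real_add)
qed

text \<open>By Schroeder-Bernstein. A sequence is made square summable injectively by squeezing each
  coordinate into the unit disc and weighting it by \<open>(1/2)^n\<close>.\<close>

lemma ex_bij_ell2: "\<exists>f :: ell2 \<Rightarrow> nat \<Rightarrow> complex. bij f"
proof -
  define h where "h z = z / of_real (1 + cmod z)" for z
  have h: "cmod (h z) \<le> 1" for z
    by (simp add: h_def norm_divide add_pos_nonneg divide_le_eq_1 del: of_real_add)
  define g where "g x = Abs_ell2 (\<lambda>n. (1/2) ^ n * h (x n))" for x :: "nat \<Rightarrow> complex"
  have g: "coord (g x) n = (1/2) ^ n * h (x n)" for x n
  proof -
    have "(\<lambda>n. (cmod ((1/2) ^ n * h (x n)))\<^sup>2) summable_on UNIV"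
    proof (rule summable_on_comparison_test)
      have "summable (\<lambda>n. (1/4::real) ^ n)" by (rule summable_geometric) simp
      thus "(\<lambda>n. (1/4::real) ^ n) summable_on UNIV"
        by (rule summable_nonneg_imp_summable_on) simp
      fix n
      have "(cmod ((1/2) ^ n * h (x n)))\<^sup>2 = (1/4) ^ n * (cmod (h (x n)))\<^sup>2"
        by (simp add: norm_mult norm_power norm_divide power_mult_distrib power2_eq_square flip: power_mult_distrib)
      also have "\<dots> \<le> (1/4) ^ n" using h[of "x n"] by (intro mult_left_le power_le_one) auto
      finally show "(cmod ((1/2) ^ n * h (x n)))\<^sup>2 \<le> (1/4) ^ n" .
    qed auto
    thus ?thesis by (simp add: g_def Abs_ell2_inverse)
  qed
  have "inj g"
  proof (rule injI, rule ext)
    fix x y n assume "g x = g y"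
    hence "h (x n) = h (y n)" using g[of x n] g[of y n] by simp
    thus "x n = y n" unfolding h_def by (rule injD[OF inj_squash])
  qed
  moreover have "inj coord" by (simp add: inj_def coord_inject)
  ultimately have "\<exists>f :: ell2 \<Rightarrow> nat \<Rightarrow> complex. bij_betw f UNIV UNIV"
    by (intro Schroeder_Bernstein[of coord UNIV UNIV g]) auto
  thus ?thesis .
qed

text \<open>
  A transport along a bijection, rather than along the inclusion, makes the carrier the whole
  type.  \<^const>\<open>Metric_space\<close> demands symmetry also off the carrier, where the subtraction of a
  module is arbitrary.
\<close>

definition ell2_code :: "ell2 \<Rightarrow> nat \<Rightarrow> complex" where
  "ell2_code = (SOME f. bij f)"

lemma bij_ell2_code: "bij ell2_code"
  unfolding ell2_code_def using ex_bij_ell2 by (rule someI_ex)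

lemma ell2_code_inject: "ell2_code x = ell2_code y \<longleftrightarrow> x = y"
  using bij_ell2_code by (simp add: bij_def inj_eq)

definition ell2_decode :: "(nat \<Rightarrow> complex) \<Rightarrow> ell2" where
  "ell2_decode = inv_into UNIV ell2_code"

lemma ell2_decode_code [simp]: "ell2_decode (ell2_code x) = x"
  using bij_ell2_code by (simp add: bij_def ell2_decode_def)

lemma all_ell2_code: "(\<forall>v. Q v) \<longleftrightarrow> (\<forall>x. Q (ell2_code x))"
  using bij_ell2_code by (metis bij_pointE)

lemma ell2_code_cases: obtains x where "v = ell2_code x"
  using bij_ell2_code by (metis bij_pointE)

definition ell2_module :: "(nat \<Rightarrow> complex) inner_module" where
  "ell2_module = \<lparr>carrier = UNIV, mult = undefined, one = undefined, zero = ell2_code 0,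
     add = (\<lambda>v w. ell2_code (ell2_decode v + ell2_decode w)),
     smult = (\<lambda>c v. ell2_code (cscale c (ell2_decode v))),
     hinner = (\<lambda>v w. cinner (ell2_decode v) (ell2_decode w))\<rparr>"

lemma ell2_module_simps:
  shows carrier_ell2: "carrier ell2_module = UNIV"
    and zero_ell2_module: "\<zero>\<^bsub>ell2_module\<^esub> = ell2_code 0"
    and add_ell2: "ell2_code x \<oplus>\<^bsub>ell2_module\<^esub> ell2_code y = ell2_code (x + y)"
    and smult_ell2: "c \<odot>\<^bsub>ell2_module\<^esub> ell2_code x = ell2_code (cscale c x)"
    and hinner_ell2: "hinner ell2_module (ell2_code x) (ell2_code y) = cinner x y"
    and hnorm_ell2: "hnorm ell2_module (ell2_code x) = norm x"
  by (simp_all add: ell2_module_def hnorm_def norm_ell2_def inner_ell2_def)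

lemma cscale_add_right: "cscale c (x + y) = cscale c x + cscale c y"
  and cscale_add_left: "cscale (c + d) x = cscale c x + cscale d x"
  and cscale_cscale: "cscale c (cscale d x) = cscale (c * d) x"
  and cscale_one: "cscale 1 x = x"
  by (rule coord_eqI; simp add: algebra_simps)+

lemma cring_complex_ring: "cring complex_ring"
proof (intro cringI abelian_groupI comm_monoidI)
  fix x assume "x \<in> carrier complex_ring"
  show "\<exists>y\<in>carrier complex_ring. y \<oplus>\<^bsub>complex_ring\<^esub> x = \<zero>\<^bsub>complex_ring\<^esub>"
    by (rule bexI[of _ "- x"]) (simp_all add: complex_ring_def)
qed (auto simp: complex_ring_def algebra_simps)

lemma abelian_group_ell2: "abelian_group ell2_module"
proof (rule abelian_groupI)
  fix u v w
  obtain x y z where [simp]: "u = ell2_code x" "v = ell2_code y" "w = ell2_code z"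
    by (metis ell2_code_cases)
  show "u \<oplus>\<^bsub>ell2_module\<^esub> v \<oplus>\<^bsub>ell2_module\<^esub> w = u \<oplus>\<^bsub>ell2_module\<^esub> (v \<oplus>\<^bsub>ell2_module\<^esub> w)"
    "u \<oplus>\<^bsub>ell2_module\<^esub> v = v \<oplus>\<^bsub>ell2_module\<^esub> u" "\<zero>\<^bsub>ell2_module\<^esub> \<oplus>\<^bsub>ell2_module\<^esub> u = u"
    by (simp_all add: ell2_module_simps ac_simps)
  show "\<exists>y\<in>carrier ell2_module. y \<oplus>\<^bsub>ell2_module\<^esub> u = \<zero>\<^bsub>ell2_module\<^esub>"
    by (rule bexI[of _ "ell2_code (- x)"]) (simp_all add: ell2_module_simps)
qed (auto simp: ell2_module_simps)

lemma minus_ell2: "ell2_code x \<ominus>\<^bsub>ell2_module\<^esub> ell2_code y = ell2_code (x - y)"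
proof -
  interpret abelian_group ell2_module by (rule abelian_group_ell2)
  have "\<ominus>\<^bsub>ell2_module\<^esub> ell2_code y = ell2_code (- y)"
    by (rule minus_equality) (simp_all add: ell2_module_simps)
  thus ?thesis by (simp add: a_minus_def add_ell2)
qed

lemma complex_hilbert_space_ell2: "complex_hilbert_space ell2_module"
proof -
  have dist: "hnorm ell2_module (ell2_code x \<ominus>\<^bsub>ell2_module\<^esub> ell2_code y) = dist x y" for x y
    by (simp add: minus_ell2 hnorm_ell2 dist_norm)
  interpret M: Metric_space "carrier ell2_module" "\<lambda>x y. hnorm ell2_module (x \<ominus>\<^bsub>ell2_module\<^esub> y)"
  proof
    fix u v w
    obtain x y z where [simp]: "u = ell2_code x" "v = ell2_code y" "w = ell2_code z"
      by (metis ell2_code_cases)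
    show "0 \<le> hnorm ell2_module (u \<ominus>\<^bsub>ell2_module\<^esub> v)"
      "hnorm ell2_module (u \<ominus>\<^bsub>ell2_module\<^esub> v) = hnorm ell2_module (v \<ominus>\<^bsub>ell2_module\<^esub> u)"
      "hnorm ell2_module (u \<ominus>\<^bsub>ell2_module\<^esub> v) = 0 \<longleftrightarrow> u = v"
      "hnorm ell2_module (u \<ominus>\<^bsub>ell2_module\<^esub> w)
        \<le> hnorm ell2_module (u \<ominus>\<^bsub>ell2_module\<^esub> v) + hnorm ell2_module (v \<ominus>\<^bsub>ell2_module\<^esub> w)"
      by (simp_all add: dist dist_commute ell2_code_inject dist_triangle)
  qed
  have "M.mcomplete"
    unfolding M.mcomplete_def
  proof (intro allI impI)
    fix \<sigma> assume \<sigma>: "M.MCauchy \<sigma>"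
    define X where "X n = ell2_decode (\<sigma> n)" for n
    have X: "\<sigma> n = ell2_code (X n)" for n
      unfolding X_def by (metis ell2_code_cases ell2_decode_code)
    have *: "\<forall>e>0. \<exists>N. \<forall>n n'. N \<le> n \<longrightarrow> N \<le> n' \<longrightarrow> dist (X n) (X n') < e"
      using \<sigma> by (simp add: M.MCauchy_def X dist)
    have "Cauchy X"
    proof (rule metric_CauchyI)
      fix e :: real assume "e > 0"
      with * obtain N where "\<forall>n n'. N \<le> n \<longrightarrow> N \<le> n' \<longrightarrow> dist (X n) (X n') < e" by blast
      thus "\<exists>N. \<forall>n\<ge>N. \<forall>n'\<ge>N. dist (X n) (X n') < e" by (intro exI[of _ N]) simp
    qed
    then obtain L where L: "X \<longlonglongrightarrow> L" by (auto simp: Cauchy_convergent_iff convergent_def)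
    have "limitin M.mtopology \<sigma> (ell2_code L) sequentially"
      unfolding M.limitin_metric
      using L by (auto simp: X dist carrier_ell2 tendsto_iff)
    thus "\<exists>x. limitin M.mtopology \<sigma> x sequentially" by blast
  qed
  note complete = this
  interpret Module.module complex_ring ell2_module
  proof (rule moduleI[OF cring_complex_ring abelian_group_ell2])
    fix a b u v
    obtain x y where [simp]: "u = ell2_code x" "v = ell2_code y" by (metis ell2_code_cases)
    show "(a \<oplus>\<^bsub>complex_ring\<^esub> b) \<odot>\<^bsub>ell2_module\<^esub> u
        = a \<odot>\<^bsub>ell2_module\<^esub> u \<oplus>\<^bsub>ell2_module\<^esub> b \<odot>\<^bsub>ell2_module\<^esub> u"
      "a \<odot>\<^bsub>ell2_module\<^esub> (u \<oplus>\<^bsub>ell2_module\<^esub> v) = a \<odot>\<^bsub>ell2_module\<^esub> u \<oplus>\<^bsub>ell2_module\<^esub> a \<odot>\<^bsub>ell2_module\<^esub> v"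
      "(a \<otimes>\<^bsub>complex_ring\<^esub> b) \<odot>\<^bsub>ell2_module\<^esub> u = a \<odot>\<^bsub>ell2_module\<^esub> (b \<odot>\<^bsub>ell2_module\<^esub> u)"
      "\<one>\<^bsub>complex_ring\<^esub> \<odot>\<^bsub>ell2_module\<^esub> u = u"
      by (simp_all add: ell2_module_simps complex_ring_def cscale_add_left cscale_add_right
          cscale_cscale cscale_one)
  qed (simp_all add: carrier_ell2)
  show ?thesis
  proof
    fix c u v w
    obtain x y z where [simp]: "u = ell2_code x" "v = ell2_code y" "w = ell2_code z"
      by (metis ell2_code_cases)
    show "hinner ell2_module (u \<oplus>\<^bsub>ell2_module\<^esub> v) w = hinner ell2_module u w + hinner ell2_module v w"
      "hinner ell2_module (c \<odot>\<^bsub>ell2_module\<^esub> u) v = c * hinner ell2_module u v"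
      "hinner ell2_module v u = cnj (hinner ell2_module u v)"
      "0 \<le> Re (hinner ell2_module u u)"
      by (simp_all add: ell2_module_simps cinner_add_left cinner_cscale_left Re_cinner_self
          infsum_nonneg cinner_commute[of y x])
    show "u = \<zero>\<^bsub>ell2_module\<^esub>" if "hinner ell2_module u u = 0"
      using that cinner_self_eq_0[of x] by (simp add: ell2_module_simps ell2_code_inject)
  qed (rule complete)
qed

definition clinear_ell2 :: "(ell2 \<Rightarrow> ell2) \<Rightarrow> bool" where
  "clinear_ell2 f \<longleftrightarrow> (\<forall>x y. f (x + y) = f x + f y) \<and> (\<forall>c x. f (cscale c x) = cscale c (f x)) \<and>
     (\<exists>C. \<forall>x. norm (f x) \<le> C * norm x)"

definition ell2_op :: "(ell2 \<Rightarrow> ell2) \<Rightarrow> (nat \<Rightarrow> complex) \<Rightarrow> (nat \<Rightarrow> complex)" where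
  "ell2_op f v = ell2_code (f (ell2_decode v))"

lemma ell2_op_code [simp]: "ell2_op f (ell2_code x) = ell2_code (f x)"
  by (simp add: ell2_op_def)

lemma ell2_op_inject: "ell2_op f = ell2_op g \<longleftrightarrow> f = g"
proof
  assume eq: "ell2_op f = ell2_op g"
  show "f = g"
  proof
    fix x show "f x = g x"
      using fun_cong[OF eq, of "ell2_code x"] by (simp add: ell2_code_inject)
  qed
qed simp

lemma ell2_op_cases: obtains f where "T = ell2_op f"
proof
  show "T = ell2_op (\<lambda>x. ell2_decode (T (ell2_code x)))"
  proof
    fix v
    obtain x y where "v = ell2_code x" "T v = ell2_code y" by (metis ell2_code_cases)
    thus "T v = ell2_op (\<lambda>x. ell2_decode (T (ell2_code x))) v" by simp
  qed
qed

lemma clinear_ell2_bounded_linear: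
  assumes "clinear_ell2 f" shows "bounded_linear f"
proof -
  obtain C where "\<And>x. norm (f x) \<le> C * norm x" using assms by (auto simp: clinear_ell2_def)
  thus ?thesis
    using assms by (intro bounded_linear_intro[of f C]) (auto simp: clinear_ell2_def scaleR_ell2_def mult.commute)
qed

lemma clinear_ell2_id: "clinear_ell2 (\<lambda>x. x)"
  unfolding clinear_ell2_def by (auto intro: exI[of _ 1])

text \<open>The carrier is the whole type, so the normalization of operators outside the carrier is
  vacuous and operators correspond to maps of \<open>ell2\<close>.\<close>

lemma bounded_operator_ell2:
  "ell2_op f \<in> carrier (bounded_operators ell2_module) \<longleftrightarrow> clinear_ell2 f"
  by (simp add: bounded_operators_def bounded_linear_operator_def carrier_ell2 all_ell2_code
      ell2_module_simps clinear_ell2_def ell2_code_inject)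

lemma mult_bounded_operators_ell2:
  "ell2_op f \<otimes>\<^bsub>bounded_operators ell2_module\<^esub> ell2_op g = ell2_op (f \<circ> g)"
  by (simp add: bounded_operators_def carrier_ell2 compose_def ell2_op_def fun_eq_iff)

lemma one_bounded_operators_ell2: "\<one>\<^bsub>bounded_operators ell2_module\<^esub> = ell2_op (\<lambda>x. x)"
proof
  fix v
  obtain x where "v = ell2_code x" by (rule ell2_code_cases)
  thus "\<one>\<^bsub>bounded_operators ell2_module\<^esub> v = ell2_op (\<lambda>x. x) v"
    by (simp add: bounded_operators_def carrier_ell2)
qed

lemma clinear_ell2_comp:
  assumes "clinear_ell2 f" "clinear_ell2 g"
  shows "clinear_ell2 (f \<circ> g)"
  unfolding clinear_ell2_def
proof (intro conjI)
  obtain K where "\<And>x. norm ((f \<circ> g) x) \<le> norm x * K"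
    using bounded_linear.bounded[OF bounded_linear_compose[OF assms[THEN clinear_ell2_bounded_linear]]]
    by (auto simp: o_def)
  thus "\<exists>C. \<forall>x. norm ((f \<circ> g) x) \<le> C * norm x" by (auto simp: mult.commute)
qed (use assms in \<open>auto simp: clinear_ell2_def\<close>)

lemma monoid_bounded_operators_ell2: "monoid (bounded_operators ell2_module)"
proof (rule monoidI)
  fix T U V
  assume TUV: "T \<in> carrier (bounded_operators ell2_module)" "U \<in> carrier (bounded_operators ell2_module)"
  obtain f g h where [simp]: "T = ell2_op f" "U = ell2_op g" "V = ell2_op h" by (metis ell2_op_cases)
  show "T \<otimes>\<^bsub>bounded_operators ell2_module\<^esub> U \<in> carrier (bounded_operators ell2_module)"
    using TUV by (simp add: mult_bounded_operators_ell2 bounded_operator_ell2 clinear_ell2_comp)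
  show "T \<otimes>\<^bsub>bounded_operators ell2_module\<^esub> U \<otimes>\<^bsub>bounded_operators ell2_module\<^esub> V
      = T \<otimes>\<^bsub>bounded_operators ell2_module\<^esub> (U \<otimes>\<^bsub>bounded_operators ell2_module\<^esub> V)"
    "\<one>\<^bsub>bounded_operators ell2_module\<^esub> \<otimes>\<^bsub>bounded_operators ell2_module\<^esub> T = T"
    "T \<otimes>\<^bsub>bounded_operators ell2_module\<^esub> \<one>\<^bsub>bounded_operators ell2_module\<^esub> = T"
    by (simp_all add: mult_bounded_operators_ell2 one_bounded_operators_ell2 o_def)
qed (simp add: one_bounded_operators_ell2 bounded_operator_ell2 clinear_ell2_id)

lemma Units_bounded_operators_ell2:
  "ell2_op f \<in> Units (bounded_operators ell2_module) \<longleftrightarrow>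
     clinear_ell2 f \<and> (\<exists>f'. clinear_ell2 f' \<and> (\<forall>x. f (f' x) = x) \<and> (\<forall>x. f' (f x) = x))"
proof
  assume "ell2_op f \<in> Units (bounded_operators ell2_module)"
  then obtain T where f: "clinear_ell2 f" and T: "T \<in> carrier (bounded_operators ell2_module)"
    "T \<otimes>\<^bsub>bounded_operators ell2_module\<^esub> ell2_op f = \<one>\<^bsub>bounded_operators ell2_module\<^esub>"
    "ell2_op f \<otimes>\<^bsub>bounded_operators ell2_module\<^esub> T = \<one>\<^bsub>bounded_operators ell2_module\<^esub>"
    unfolding Units_def by (auto simp: bounded_operator_ell2)
  obtain f' where [simp]: "T = ell2_op f'" by (rule ell2_op_cases)
  have "f' \<circ> f = (\<lambda>x. x)" "f \<circ> f' = (\<lambda>x. x)"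
    using T(2,3) by (simp_all add: mult_bounded_operators_ell2 one_bounded_operators_ell2 ell2_op_inject)
  with f T(1) show "clinear_ell2 f \<and> (\<exists>f'. clinear_ell2 f' \<and> (\<forall>x. f (f' x) = x) \<and> (\<forall>x. f' (f x) = x))"
    by (intro conjI exI[of _ f']) (auto simp: bounded_operator_ell2 fun_eq_iff)
next
  assume "clinear_ell2 f \<and> (\<exists>f'. clinear_ell2 f' \<and> (\<forall>x. f (f' x) = x) \<and> (\<forall>x. f' (f x) = x))"
  then obtain f' where "clinear_ell2 f" "clinear_ell2 f'" "f \<circ> f' = (\<lambda>x. x)" "f' \<circ> f = (\<lambda>x. x)"
    by (auto simp: fun_eq_iff)
  thus "ell2_op f \<in> Units (bounded_operators ell2_module)"
    unfolding Units_def
    by (auto simp: bounded_operator_ell2 mult_bounded_operators_ell2 one_bounded_operators_ell2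
        intro!: bexI[of _ "ell2_op f'"])
qed

text \<open>The conjugating operator becomes \<open>S\<close>. Unitarity of the conjugate of
  \<open>P g\<close>, evaluated at \<open>S x\<close> and \<open>S y\<close>, says that
  \<open>P\<close> preserves an equivalent inner product; in this form it yields invariant
  orthogonal complements.\<close>

lemma unitarizable_ell2:
  fixes P :: "'g \<Rightarrow> ell2 \<Rightarrow> ell2"
  assumes "group G" "unitarizable TYPE(nat \<Rightarrow> complex) G"
    and lin: "\<And>g. g \<in> carrier G \<Longrightarrow> clinear_ell2 (P g)"
    and mult: "\<And>g h x. g \<in> carrier G \<Longrightarrow> h \<in> carrier G \<Longrightarrow> P (g \<otimes>\<^bsub>G\<^esub> h) x = P g (P h x)"
    and one: "\<And>x. P \<one>\<^bsub>G\<^esub> x = x"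
    and bound: "\<And>g x. g \<in> carrier G \<Longrightarrow> norm (P g x) \<le> c * norm x"
  obtains S S' :: "ell2 \<Rightarrow> ell2" where "bounded_linear S" "bounded_linear S'" "\<And>x. S' (S x) = x"
    "\<And>g x y. g \<in> carrier G \<Longrightarrow> inner (S (P g x)) (S (P g y)) = inner (S x) (S y)"
proof -
  interpret group G by fact
  let ?B = "bounded_operators ell2_module"
  interpret B: monoid ?B by (rule monoid_bounded_operators_ell2)
  define \<pi> where "\<pi> g = ell2_op (P g)" for g
  have unit: "\<pi> g \<in> Units ?B" if "g \<in> carrier G" for g
    unfolding Units_bounded_operators_ell2 \<pi>_def
    using lin[OF that] lin[OF inv_closed[OF that]]
      mult[OF that inv_closed[OF that]] mult[OF inv_closed[OF that] that] that
    by (intro conjI exI[of _ "P (inv\<^bsub>G\<^esub> g)"]) (simp_all add: one)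
  have "\<pi> \<in> hom G (units_of ?B)"
  proof (rule homI)
    fix g h assume gh: "g \<in> carrier G" "h \<in> carrier G"
    hence "P (g \<otimes>\<^bsub>G\<^esub> h) = P g \<circ> P h" by (simp add: fun_eq_iff mult)
    thus "\<pi> (g \<otimes>\<^bsub>G\<^esub> h) = \<pi> g \<otimes>\<^bsub>units_of ?B\<^esub> \<pi> h"
      by (simp add: \<pi>_def units_of_mult mult_bounded_operators_ell2)
  qed (simp add: units_of_carrier unit)
  moreover have "op_norm ell2_module (\<pi> g) \<le> c" if "g \<in> carrier G" for g
    unfolding op_norm_def
  proof (rule cSUP_least)
    show "{x \<in> carrier ell2_module. hnorm ell2_module x \<le> 1} \<noteq> {}"
      using hnorm_ell2[of 0] by (auto simp: carrier_ell2 intro!: exI[of _ "ell2_code 0"])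
    fix x assume "x \<in> {x \<in> carrier ell2_module. hnorm ell2_module x \<le> 1}"
    moreover obtain v where "x = ell2_code v" by (rule ell2_code_cases)
    ultimately have v: "x = ell2_code v" "norm v \<le> 1" by (auto simp: hnorm_ell2)
    \<comment> \<open>Testing on a unit vector gives \<open>0 \<le> c\<close>, so that the bound
      extends to vectors of norm at most 1.\<close>
    have "0 \<le> norm (P g (ket 0))" by simp
    also have "\<dots> \<le> c * norm (ket 0)" using bound[OF that] .
    also have "norm (ket 0) = 1" using norm_sum_ket[of "{0}"] by simp
    finally have "0 \<le> c" by simp
    hence "norm (P g v) \<le> c" using bound[OF that, of v] v(2) mult_left_mono[of "norm v" 1 c] by simp
    thus "hnorm ell2_module (\<pi> g x) \<le> c" by (simp add: v \<pi>_def hnorm_ell2)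
  qed
  ultimately have "uniformly_bounded_rep G ell2_module \<pi>"
    by (auto simp: uniformly_bounded_rep_def intro!: bdd_aboveI2[where M = c])
  with assms(2) complex_hilbert_space_ell2 have "conjugate_to_unitary G ell2_module \<pi>"
    by (simp add: unitarizable_def)
  then obtain T where T: "T \<in> Units ?B"
    and U: "\<And>g. g \<in> carrier G \<Longrightarrow> unitary_operator ell2_module (T \<otimes>\<^bsub>?B\<^esub> \<pi> g \<otimes>\<^bsub>?B\<^esub> inv\<^bsub>?B\<^esub> T)"
    by (auto simp: conjugate_to_unitary_def)
  obtain S S' where S: "clinear_ell2 S" "clinear_ell2 S'" "\<And>x. S (S' x) = x" "\<And>x. S' (S x) = x" "T = ell2_op S"
    using T Units_bounded_operators_ell2 by (metis ell2_op_cases)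
  have "inv\<^bsub>?B\<^esub> T = ell2_op S'"
    by (rule B.inv_unique'[symmetric])
      (use S in \<open>simp_all add: bounded_operator_ell2 mult_bounded_operators_ell2
        one_bounded_operators_ell2 o_def\<close>)
  hence conj: "T \<otimes>\<^bsub>?B\<^esub> \<pi> g \<otimes>\<^bsub>?B\<^esub> inv\<^bsub>?B\<^esub> T = ell2_op (\<lambda>x. S (P g (S' x)))" for g
    by (simp add: S \<pi>_def mult_bounded_operators_ell2 o_def)
  have "inner (S (P g x)) (S (P g y)) = inner (S x) (S y)" if "g \<in> carrier G" for g x y
  proof -
    have "hinner ell2_module (ell2_op (\<lambda>x. S (P g (S' x))) (ell2_code (S x)))
        (ell2_op (\<lambda>x. S (P g (S' x))) (ell2_code (S y))) = hinner ell2_module (ell2_code (S x)) (ell2_code (S y))"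
      using U[OF that] unfolding conj unitary_operator_def carrier_ell2 by blast
    thus ?thesis by (simp add: hinner_ell2 S inner_ell2_def)
  qed
  with S show ?thesis by (intro that[of S S'] clinear_ell2_bounded_linear)
qed

section \<open>A bounded cocycle and the vanishing of the flow between two points with spreading
  stabilizers\<close>

section \<open>Invariant flows\<close>

lemma ell2_reindex:
  assumes "inj \<sigma>"
  obtains y where "\<And>n. coord y n = coord x (\<sigma> n)" "norm y \<le> norm x"
proof -
  have "(\<Sum>n\<in>F. (cmod (coord x (\<sigma> n)))\<^sup>2) \<le> (norm x)\<^sup>2" if "finite F" for F
  proof -
    have "(\<Sum>n\<in>F. (cmod (coord x (\<sigma> n)))\<^sup>2) = (\<Sum>n\<in>\<sigma> ` F. (cmod (coord x n))\<^sup>2)"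
      using assms by (subst sum.reindex) (auto intro: inj_on_subset)
    also have "\<dots> \<le> (norm x)\<^sup>2" using that by (intro sum_coord_le) simp
    finally show ?thesis .
  qed
  then obtain y where "coord y = (\<lambda>n. coord x (\<sigma> n))" "norm y \<le> norm x"
    by (rule ell2_of_finite_sums[OF norm_ge_zero])
  thus ?thesis by (intro that[of y]) simp_all
qed

lemma ell2_even_part:
  obtains w where "\<And>n. coord w n = (if even n then coord y (n div 2) else 0)" "norm w \<le> norm y"
proof -
  have "(\<Sum>n\<in>F. (cmod (if even n then coord y (n div 2) else 0))\<^sup>2) \<le> (norm y)\<^sup>2" if F: "finite F" for F
  proof -
    have inj: "inj_on (\<lambda>n. n div 2) {n\<in>F. even n}" by (auto simp: inj_on_def elim!: evenE)
    have "(\<Sum>n\<in>F. (cmod (if even n then coord y (n div 2) else 0))\<^sup>2)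
        = (\<Sum>n\<in>{n\<in>F. even n}. (cmod (coord y (n div 2)))\<^sup>2)"
      using F by (intro sum.mono_neutral_cong_right) auto
    also have "\<dots> = (\<Sum>n\<in>(\<lambda>n. n div 2) ` {n\<in>F. even n}. (cmod (coord y n))\<^sup>2)"
      using inj by (subst sum.reindex) auto
    also have "\<dots> \<le> (norm y)\<^sup>2" using F by (intro sum_coord_le) simp
    finally show ?thesis .
  qed
  then obtain w where "coord w = (\<lambda>n. if even n then coord y (n div 2) else 0)" "norm w \<le> norm y"
    by (rule ell2_of_finite_sums[OF norm_ge_zero])
  thus ?thesis by (intro that[of w]) simp_all
qed

lemma summable_on_inj_tendsto_0:
  fixes f :: "'a \<Rightarrow> real" and a :: "nat \<Rightarrow> 'a"
  assumes "f summable_on UNIV" "inj a"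
  shows "(\<lambda>n. f (a n)) \<longlonglongrightarrow> 0"
proof -
  have "f summable_on range a" using assms(1) by (rule summable_on_subset_banach) simp
  hence "(\<lambda>n. f (a n)) summable_on UNIV"
    using summable_on_reindex[OF assms(2), of f] by (simp add: o_def)
  hence "summable (\<lambda>n. f (a n))" by (rule summable_on_imp_summable)
  thus ?thesis by (rule summable_LIMSEQ_zero)
qed

text \<open>The model for \<open>p i j\<close> is the probability that \<open>j\<close> is the
  parent of \<open>i\<close>. The sum over parents is at most 1, the sum over children is not
  controlled. \<open>p\<close> depends on the choice of roots; only the probability of an edge in
  either direction is invariant.\<close>

locale invariant_flow = group G for G (structure) +
  fixes A :: "'a \<Rightarrow> nat \<Rightarrow> nat" and p :: "nat \<Rightarrow> nat \<Rightarrow> real"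
  assumes act_mult: "\<lbrakk>g \<in> carrier G; h \<in> carrier G\<rbrakk> \<Longrightarrow> A (g \<otimes> h) i = A g (A h i)"
    and act_one: "A \<one> i = i"
    and p_nonneg: "0 \<le> p i j"
    and p_summable: "p i summable_on UNIV"
    and p_sum_le: "(\<Sum>\<^sub>\<infinity>j. p i j) \<le> 1"
    and p_invariant: "g \<in> carrier G \<Longrightarrow> p (A g i) (A g j) + p (A g j) (A g i) = p i j + p j i"
begin

abbreviation B where "B g i \<equiv> A (inv g) i"

lemma AB [simp]: "g \<in> carrier G \<Longrightarrow> A g (B g i) = i"
  and BA [simp]: "g \<in> carrier G \<Longrightarrow> B g (A g i) = i"
  by (simp_all add: act_one flip: act_mult)

lemma bij_B: "g \<in> carrier G \<Longrightarrow> bij (B g)"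
  by (rule o_bij[of "A g"]) (auto simp: fun_eq_iff)

lemma B_mult: "\<lbrakk>g \<in> carrier G; h \<in> carrier G\<rbrakk> \<Longrightarrow> B (g \<otimes> h) i = B h (B g i)"
  by (simp add: inv_mult_group act_mult)

text \<open>The entries of \<open>g p g^-1 - p\<close>. This looks like a coboundary, but
  \<open>p\<close> need not be a bounded operator.\<close>

definition D :: "'a \<Rightarrow> nat \<Rightarrow> nat \<Rightarrow> real" where
  "D g i j = p (B g i) (B g j) - p i j"

lemma D_antisym: "g \<in> carrier G \<Longrightarrow> D g i j = - D g j i"
  using p_invariant[of "inv g" i j] by (simp add: D_def)

lemma D_row:
  assumes g: "g \<in> carrier G"
  shows "(\<lambda>j. \<bar>D g i j\<bar>) summable_on UNIV" "(\<Sum>\<^sub>\<infinity>j. \<bar>D g i j\<bar>) \<le> 2"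
proof -
  have s: "(\<lambda>j. p (B g i) (B g j)) summable_on UNIV"
    using p_summable[of "B g i"] by (simp add: summable_on_reindex_bij_betw[OF bij_B[OF g]])
  have e: "(\<Sum>\<^sub>\<infinity>j. p (B g i) (B g j)) = (\<Sum>\<^sub>\<infinity>j. p (B g i) j)"
    by (rule infsum_reindex_bij_betw[OF bij_B[OF g]])
  have s2: "(\<lambda>j. p (B g i) (B g j) + p i j) summable_on UNIV"
    using s p_summable by (rule summable_on_add)
  have le: "\<bar>D g i j\<bar> \<le> p (B g i) (B g j) + p i j" for j
    using p_nonneg[of "B g i" "B g j"] p_nonneg[of i j] by (simp add: D_def)
  show s3: "(\<lambda>j. \<bar>D g i j\<bar>) summable_on UNIV"
    by (rule summable_on_comparison_test[OF s2]) (use le in auto)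
  have "(\<Sum>\<^sub>\<infinity>j. \<bar>D g i j\<bar>) \<le> (\<Sum>\<^sub>\<infinity>j. p (B g i) (B g j) + p i j)"
    by (rule infsum_mono[OF s3 s2 le])
  also have "\<dots> = (\<Sum>\<^sub>\<infinity>j. p (B g i) j) + (\<Sum>\<^sub>\<infinity>j. p i j)"
    using infsum_add[OF s p_summable[of i]] e by simp
  finally show "(\<Sum>\<^sub>\<infinity>j. \<bar>D g i j\<bar>) \<le> 2" using p_sum_le[of "B g i"] p_sum_le[of i] by linarith
qed

text \<open>Antisymmetry turns columns of \<open>D\<close> into rows; the columns of
  \<open>p\<close> themselves have no such bound.\<close>

lemma D_col:
  assumes "g \<in> carrier G"
  shows "(\<lambda>i. \<bar>D g i j\<bar>) summable_on UNIV" "(\<Sum>\<^sub>\<infinity>i. \<bar>D g i j\<bar>) \<le> 2"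
proof -
  have "(\<lambda>i. \<bar>D g i j\<bar>) = (\<lambda>i. \<bar>D g j i\<bar>)"
    by (intro ext, subst D_antisym[OF assms]) simp
  thus "(\<lambda>i. \<bar>D g i j\<bar>) summable_on UNIV" "(\<Sum>\<^sub>\<infinity>i. \<bar>D g i j\<bar>) \<le> 2"
    using D_row[OF assms, of j] by simp_all
qed

text \<open>
  Sequences indexed by even and by odd numbers model \<open>\<ell>\<^sup>2 \<oplus> \<ell>\<^sup>2\<close>; there \<open>P g\<close> is the triangular
  matrix with the permutation representation on the diagonal and the derivation \<open>D\<close> above it.
\<close>

definition lift :: "'a \<Rightarrow> nat \<Rightarrow> nat" where
  "lift g n = 2 * B g (n div 2) + n mod 2"

definition P_coord :: "'a \<Rightarrow> (nat \<Rightarrow> complex) \<Rightarrow> nat \<Rightarrow> complex" where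
  "P_coord g x n = x (lift g n) +
     (if even n then \<Sum>\<^sub>\<infinity>j. of_real (D g (n div 2) j) * x (2 * B g j + 1) else 0)"

definition P :: "'a \<Rightarrow> ell2 \<Rightarrow> ell2" where
  "P g x = Abs_ell2 (P_coord g (coord x))"

lemma inj_lift: "g \<in> carrier G \<Longrightarrow> inj (lift g)"
proof (rule injI)
  fix m n assume g: "g \<in> carrier G" and eq: "lift g m = lift g n"
  have "lift g k div 2 = B g (k div 2)" "lift g k mod 2 = k mod 2" for k by (simp_all add: lift_def)
  with eq have "B g (m div 2) = B g (n div 2)" "m mod 2 = n mod 2" by metis+
  with bij_B[OF g] have "m div 2 = n div 2" "m mod 2 = n mod 2" by (auto simp: bij_def inj_eq)
  thus "m = n" by (metis mult_div_mod_eq)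
qed

lemma odd_part:
  assumes g: "g \<in> carrier G"
  obtains z where "\<And>j. coord z j = coord x (2 * B g j + 1)" "norm z \<le> norm x"
proof -
  have "inj (\<lambda>j. 2 * B g j + 1)" using bij_B[OF g] by (auto simp: inj_def bij_def)
  thus ?thesis by (rule ell2_reindex[of _ x]) (rule that)
qed

lemma P_summable:
  assumes g: "g \<in> carrier G"
  shows "(\<lambda>j. of_real (D g i j) * coord x (2 * B g j + 1)) summable_on UNIV"
proof -
  obtain z where "\<And>j. coord z j = coord x (2 * B g j + 1)" using odd_part[OF g] by blast
  thus ?thesis using schur_row_bound(1)[OF D_row[OF g, of i], of z] by simp
qed

text \<open>The diagonal part permutes coordinates and has norm at most 1, the upper right part has
  Schur bound 2. Hence the constant 3, uniform in \<open>g\<close>.\<close>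

lemma P:
  assumes g: "g \<in> carrier G"
  shows coord_P: "coord (P g x) n = P_coord g (coord x) n" and norm_P: "norm (P g x) \<le> 3 * norm x"
proof -
  obtain x1 where x1: "\<And>n. coord x1 n = coord x (lift g n)" "norm x1 \<le> norm x"
    using ell2_reindex[OF inj_lift[OF g]] by blast
  obtain z where z: "\<And>j. coord z j = coord x (2 * B g j + 1)" "norm z \<le> norm x"
    using odd_part[OF g] by blast
  obtain y where y: "coord y = (\<lambda>i. \<Sum>\<^sub>\<infinity>j. of_real (D g i j) * coord z j)" "norm y \<le> 2 * norm z"
    using schur_test[OF D_row[OF g] D_col[OF g]] by blast
  obtain w where w: "\<And>n. coord w n = (if even n then coord y (n div 2) else 0)" "norm w \<le> norm y"
    using ell2_even_part by blast
  have c: "coord (x1 + w) = P_coord g (coord x)"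
    by (rule ext) (simp add: P_coord_def x1 w y z)
  hence P: "P g x = x1 + w" unfolding P_def by (metis coord_inverse)
  show "coord (P g x) n = P_coord g (coord x) n" unfolding P c ..
  show "norm (P g x) \<le> 3 * norm x"
    unfolding P using norm_triangle_ineq[of x1 w] x1(2) w(2) y(2) z(2) by linarith
qed

lemma P_add: "g \<in> carrier G \<Longrightarrow> P g (x + y) = P g x + P g y"
  by (rule coord_eqI)
    (simp add: coord_P P_coord_def distrib_left infsum_add[OF P_summable P_summable, simplified])

lemma P_cscale: "g \<in> carrier G \<Longrightarrow> P g (cscale c x) = cscale c (P g x)"
proof (rule coord_eqI)
  fix n assume g: "g \<in> carrier G"
  have "(\<Sum>\<^sub>\<infinity>j. of_real (D g i j) * (c * coord x (2 * B g j + 1)))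
      = c * (\<Sum>\<^sub>\<infinity>j. of_real (D g i j) * coord x (2 * B g j + 1))" for i
    by (subst infsum_cmult_right'[symmetric]) (simp add: mult.left_commute)
  thus "coord (P g (cscale c x)) n = coord (cscale c (P g x)) n"
    by (simp add: coord_P[OF g] P_coord_def distrib_left)
qed

lemma clinear_P: "g \<in> carrier G \<Longrightarrow> clinear_ell2 (P g)"
  unfolding clinear_ell2_def using P_add P_cscale norm_P by blast

lemma P_odd: "g \<in> carrier G \<Longrightarrow> coord (P g x) (2 * i + 1) = coord x (2 * B g i + 1)"
  by (simp add: coord_P P_coord_def lift_def)

lemma P_even: "g \<in> carrier G \<Longrightarrow> coord (P g x) (2 * i) = coord x (2 * B g i) +
    (\<Sum>\<^sub>\<infinity>j. of_real (D g i j) * coord x (2 * B g j + 1))"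
  by (simp add: coord_P P_coord_def lift_def)

lemma coord_even_odd_eqI:
  assumes "\<And>i. coord x (2 * i) = coord y (2 * i)" "\<And>i. coord x (2 * i + 1) = coord y (2 * i + 1)"
  shows "x = y"
proof (rule coord_eqI)
  fix n show "coord x n = coord y n" using assms by (cases "even n") (auto elim!: evenE oddE)
qed

text \<open>The upper right block of \<open>P g\<close> is \<open>D g\<close> times the permutation
  by \<open>g\<close>, so multiplicativity amounts to the cocycle identity
  \<open>D(g h) = g D(h) g^-1 + D(g)\<close>. The sum for \<open>h\<close> has to be reindexed by
  \<open>g\<close>.\<close>

lemma P_mult:
  assumes g: "g \<in> carrier G" and h: "h \<in> carrier G"
  shows "P (g \<otimes> h) x = P g (P h x)"
proof (rule coord_even_odd_eqI)
  fix i
  have gh: "g \<otimes> h \<in> carrier G" using g h by simp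
  show "coord (P (g \<otimes> h) x) (2 * i + 1) = coord (P g (P h x)) (2 * i + 1)"
    unfolding P_odd[OF gh] P_odd[OF g] P_odd[OF h] B_mult[OF g h] ..
  have D: "D (g \<otimes> h) i j = D h (B g i) (B g j) + D g i j" for j
    by (simp add: D_def B_mult[OF g h])
  have s: "(\<lambda>j. of_real (D h (B g i) (B g j)) * coord x (2 * B h (B g j) + 1)) summable_on UNIV"
    using P_summable[OF h, of "B g i" x]
      summable_on_reindex_bij_betw[OF bij_B[OF g], of "\<lambda>j. of_real (D h (B g i) j) * coord x (2 * B h j + 1)"]
    by simp
  have t: "(\<lambda>j. of_real (D g i j) * coord x (2 * B h (B g j) + 1)) summable_on UNIV"
    using P_summable[OF g, of i "P h x"] unfolding P_odd[OF h] .
  have "(\<Sum>\<^sub>\<infinity>j. of_real (D (g \<otimes> h) i j) * coord x (2 * B (g \<otimes> h) j + 1))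
      = (\<Sum>\<^sub>\<infinity>j. of_real (D h (B g i) (B g j)) * coord x (2 * B h (B g j) + 1)
          + of_real (D g i j) * coord x (2 * B h (B g j) + 1))"
    by (simp add: D B_mult[OF g h] distrib_right)
  also have "\<dots> = (\<Sum>\<^sub>\<infinity>j. of_real (D h (B g i) (B g j)) * coord x (2 * B h (B g j) + 1))
      + (\<Sum>\<^sub>\<infinity>j. of_real (D g i j) * coord x (2 * B h (B g j) + 1))"
    by (rule infsum_add[OF s t])
  also have "(\<Sum>\<^sub>\<infinity>j. of_real (D h (B g i) (B g j)) * coord x (2 * B h (B g j) + 1))
      = (\<Sum>\<^sub>\<infinity>j. of_real (D h (B g i) j) * coord x (2 * B h j + 1))"
    by (rule infsum_reindex_bij_betw[OF bij_B[OF g]])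
  finally show "coord (P (g \<otimes> h) x) (2 * i) = coord (P g (P h x)) (2 * i)"
    by (simp add: P_even[OF gh] P_even[OF g] P_even[OF h] P_odd[OF h, simplified] B_mult[OF g h])
qed

lemma P_one: "P \<one> x = x"
  by (rule coord_even_odd_eqI)
    (simp_all add: P_even P_odd[simplified] D_def act_one)

text \<open>The first summand, on which \<open>P\<close> is the permutation representation. The
  second summand is not invariant, and \<open>D\<close> measures the failure.\<close>

definition W :: "ell2 set" where
  "W = {x. \<forall>i. coord x (2 * i + 1) = 0}"

lemma subspace_W: "subspace W"
  by (auto simp: W_def subspace_def)

lemma P_W_even: "\<lbrakk>g \<in> carrier G; x \<in> W\<rbrakk> \<Longrightarrow> coord (P g x) (2 * i) = coord x (2 * B g i)"
  by (simp add: P_even W_def)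

lemma P_W: "\<lbrakk>g \<in> carrier G; x \<in> W\<rbrakk> \<Longrightarrow> P g x \<in> W"
  unfolding W_def using P_odd by simp

text \<open>This isolates the error of \<open>P g\<close> on a basis vector of the second summand: a
  column of \<open>D g\<close>, placed in \<open>W\<close>. Comparison with an invariant complement
  of \<open>W\<close> will make \<open>D\<close> inner.\<close>

lemma P_ket_diff:
  assumes g: "g \<in> carrier G"
  shows "P g (ket (2 * v + 1)) - ket (2 * A g v + 1) \<in> W"
    and "coord (P g (ket (2 * v + 1)) - ket (2 * A g v + 1)) (2 * u) = of_real (D g u (A g v))"
proof -
  have eq: "B g i = v \<longleftrightarrow> i = A g v" for i using AB[OF g] BA[OF g] by metis
  have odd_ket: "coord (ket (2 * v + 1)) (2 * i + 1) = (if i = v then 1 else 0)"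
    and even_ket: "coord (ket (2 * v + 1)) (2 * i) = 0" for i v
    by (simp_all add: coord_ket) presburger
  show "P g (ket (2 * v + 1)) - ket (2 * A g v + 1) \<in> W"
    unfolding W_def mem_Collect_eq coord_diff P_odd[OF g] odd_ket eq by simp
  have "(\<Sum>\<^sub>\<infinity>j. of_real (D g u j) * (if j = A g v then 1 else 0)) = (\<Sum>\<^sub>\<infinity>j\<in>{A g v}. complex_of_real (D g u j))"
    by (rule infsum_cong_neutral) auto
  thus "coord (P g (ket (2 * v + 1)) - ket (2 * A g v + 1)) (2 * u) = of_real (D g u (A g v))"
    unfolding coord_diff P_even[OF g] odd_ket even_ket eq by simp
qed

text \<open>The \<open>k n\<close> fix \<open>u\<close> and spread \<open>v\<close>, the
  \<open>l n\<close> fix \<open>v\<close> and spread \<open>u\<close>. The invariant matrix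
  \<open>Z\<close> is evaluated along both orbits, and the results are compatible only if no flow
  passes between \<open>u\<close> and \<open>v\<close>.\<close>

lemma flow_balanced:
  assumes unit: "unitarizable TYPE(nat \<Rightarrow> complex) G"
    and k: "\<And>n::nat. k n \<in> carrier G" "\<And>n. A (k n) u = u" "inj (\<lambda>n. A (k n) v)"
    and l: "\<And>n::nat. l n \<in> carrier G" "\<And>n. A (l n) v = v" "inj (\<lambda>n. A (l n) u)"
  shows "p u v + p v u = 0"
proof -
  obtain S S' :: "ell2 \<Rightarrow> ell2" where S: "bounded_linear S" and S': "bounded_linear S'"
    and inv: "\<And>x. S' (S x) = x"
    and iso: "\<And>g x y. g \<in> carrier G \<Longrightarrow> inner (S (P g x)) (S (P g y)) = inner (S x) (S y)"
    using unitarizable_ell2[OF group_axioms unit clinear_P P_mult P_one norm_P] by blast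
  interpret S: bounded_linear S by (rule S)
  interpret S': bounded_linear S' by (rule S')
  define e where "e v = ket (2 * v + 1)" for v
  have "subspace (S ` W)"
    using subspace_W S.linear by (rule linear_subspace_image[rotated])
  \<comment> \<open>Preimages are recovered by the bounded left inverse \<open>S'\<close>; they
    converge, and their odd coordinates stay 0 in the limit.\<close>
  moreover have "complete (S ` W)"
  proof (rule completeI)
    fix f assume f: "\<forall>n. f n \<in> S ` W" "Cauchy f"
    obtain y where y: "f \<longlonglongrightarrow> y" using Cauchy_convergent[OF f(2)] by (auto simp: convergent_def)
    have W: "S' (f n) \<in> W" "S (S' (f n)) = f n" for n using f(1) by (auto simp: inv dest: spec[of _ n])
    have lim: "(\<lambda>n. S' (f n)) \<longlonglongrightarrow> S' y" by (rule S'.tendsto[OF y])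
    have "coord (S' y) (2 * i + 1) = 0" for i
    proof -
      have "cmod (coord (S' y) (2 * i + 1)) \<le> norm (S' y - S' (f n))" for n
        using coord_le_norm[of "S' y - S' (f n)" "2 * i + 1"] W(1)[of n] by (simp add: W_def)
      moreover have "(\<lambda>n. norm (S' y - S' (f n))) \<longlonglongrightarrow> norm (S' y - S' y)"
        by (intro tendsto_intros lim)
      ultimately have "cmod (coord (S' y) (2 * i + 1)) \<le> norm (S' y - S' y)"
        by (intro LIMSEQ_le_const) auto
      thus ?thesis by simp
    qed
    hence "S' y \<in> W" by (simp add: W_def)
    moreover have "S (S' y) = y"
      using LIMSEQ_unique[OF S.tendsto[OF lim]] y by (simp add: W(2))
    ultimately show "\<exists>l\<in>S ` W. f \<longlonglongrightarrow> l" using y by (metis imageI)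
  qed
  \<comment> \<open>\<open>\<tau> v\<close> is the projection of \<open>e v\<close> to
    \<open>W\<close> for the inner product preserved by \<open>P\<close>.\<close>
  ultimately have "\<exists>t\<in>W. \<forall>w\<in>W. inner (S (e v) - S t) (S w) = 0" for v
    using orthogonal_projection_exists[of "S ` W" "S (e v)"] by blast
  then obtain \<tau> where \<tau>: "\<And>v. \<tau> v \<in> W" "\<And>v w. w \<in> W \<Longrightarrow> inner (S (e v) - S (\<tau> v)) (S w) = 0"
    by metis
  have unique: "t = \<tau> v" if t: "t \<in> W" "\<And>w. w \<in> W \<Longrightarrow> inner (S (e v) - S t) (S w) = 0" for t v
  proof -
    have W: "t - \<tau> v \<in> W" using subspace_diff[OF subspace_W] t(1) \<tau>(1) .
    have "inner (S (t - \<tau> v)) (S (t - \<tau> v)) = 0"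
      using t(2)[OF W] \<tau>(2)[OF W, of v] by (simp add: S.diff inner_diff_left)
    hence "S (t - \<tau> v) = 0" by simp
    hence "t - \<tau> v = 0" using inv[of "t - \<tau> v"] by (simp add: S'.zero)
    thus ?thesis by simp
  qed
  define T where "T u v = coord (\<tau> v) (2 * u)" for u v
  \<comment> \<open>\<open>P g\<close> preserves the new inner product and \<open>W\<close>, hence
    also orthogonality to \<open>W\<close>. So the projection of \<open>e (A g v)\<close> is
    \<open>P g (\<tau> v)\<close> corrected by the error \<open>d\<close>.\<close>
  have equiv: "T u (A g v) = T (B g u) v - of_real (D g u (A g v))" if g: "g \<in> carrier G" for g u v
  proof -
    define d where "d = P g (e v) - e (A g v)"
    have d: "d \<in> W" "\<And>u. coord d (2 * u) = of_real (D g u (A g v))"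
      using P_ket_diff[OF g, of v] by (simp_all add: d_def e_def)
    interpret P: bounded_linear "P g" by (rule clinear_ell2_bounded_linear[OF clinear_P[OF g]])
    have "P g (\<tau> v) - d = \<tau> (A g v)"
    proof (rule unique)
      show "P g (\<tau> v) - d \<in> W" by (intro subspace_diff[OF subspace_W] P_W g \<tau>(1) d(1))
      fix w assume w: "w \<in> W"
      have "inner (S (e (A g v)) - S (P g (\<tau> v) - d)) (S w) = inner (S (P g (e v - \<tau> v))) (S w)"
        by (simp add: d_def S.diff P.diff)
      also have "\<dots> = inner (S (P g (e v - \<tau> v))) (S (P g (P (inv g) w)))"
        using P_mult[of g "inv g" w] g by (simp add: P_one)
      also have "inner (S (P g (e v - \<tau> v))) (S (P g (P (inv g) w))) = inner (S (e v) - S (\<tau> v)) (S (P (inv g) w))"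
        by (simp only: iso[OF g] S.diff)
      also have "\<dots> = 0" using g w by (intro \<tau>(2) P_W) auto
      finally show "inner (S (e (A g v)) - S (P g (\<tau> v) - d)) (S w) = 0" .
    qed
    hence "coord (\<tau> (A g v)) (2 * u) = coord (P g (\<tau> v)) (2 * u) - coord d (2 * u)"
      by (metis coord_diff)
    thus ?thesis using P_W_even[OF g \<tau>(1), of v u] d(2)[of u] by (simp add: T_def)
  qed
  \<comment> \<open>By \<open>equiv\<close>, the entries of \<open>T\<close> and of \<open>p\<close>
    change by the same amount under \<open>g\<close>.\<close>
  define Z where "Z u v = Re (T u v) - p u v" for u v
  have Z: "Z (A g u) (A g v) = Z u v" if "g \<in> carrier G" for g u v
    using equiv[OF that, of "A g u" v] that by (simp add: Z_def D_def)
  define f where "f = p u v + p v u"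
  \<comment> \<open>Along the \<open>l n\<close>, column \<open>v\<close> of \<open>T\<close> tends
    to 0 because it is square summable, and row \<open>v\<close> of \<open>p\<close> tends to 0
    because it is summable. By invariance of the symmetrized flow, \<open>p (A (l n) u) v\<close>
    then tends to \<open>f\<close>.\<close>
  have Zf: "Z u v = - f"
  proof (rule LIMSEQ_unique)
    show "(\<lambda>n. Re (T (A (l n) u) v) + p v (A (l n) u) - f) \<longlonglongrightarrow> Z u v"
    proof -
      have "Re (T (A (l n) u) v) + p v (A (l n) u) - f = Z u v" for n
        using Z[OF l(1), of n u v] p_invariant[OF l(1), of n u v] by (simp add: Z_def f_def l(2))
      thus ?thesis by simp
    qed
    have "inj (\<lambda>n. 2 * A (l n) u)" using l(3) by (simp add: inj_def)
    hence "(\<lambda>n. (cmod (T (A (l n) u) v))\<^sup>2) \<longlonglongrightarrow> 0"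
      unfolding T_def by (rule summable_on_inj_tendsto_0[OF coord_summable])
    hence "(\<lambda>n. cmod (T (A (l n) u) v)) \<longlonglongrightarrow> 0"
      using tendsto_real_sqrt[of "\<lambda>n. (cmod (T (A (l n) u) v))\<^sup>2" 0] by simp
    hence "(\<lambda>n. T (A (l n) u) v) \<longlonglongrightarrow> 0" by (rule tendsto_norm_zero_cancel)
    moreover have "(\<lambda>n. p v (A (l n) u)) \<longlonglongrightarrow> 0"
      using p_summable l(3) by (rule summable_on_inj_tendsto_0)
    ultimately have "(\<lambda>n. Re (T (A (l n) u) v) + p v (A (l n) u) - f) \<longlonglongrightarrow> Re 0 + 0 - f"
      by (intro tendsto_intros)
    thus "(\<lambda>n. Re (T (A (l n) u) v) + p v (A (l n) u) - f) \<longlonglongrightarrow> - f" by simp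
  qed
  obtain c where c: "\<And>x. norm (S x) \<le> norm x * c" "0 < c" using S.pos_bounded by blast
  obtain c' where c': "\<And>x. norm (S' x) \<le> norm x * c'" "0 < c'" using S'.pos_bounded by blast
  \<comment> \<open>Along the \<open>k n\<close> the value \<open>- f\<close> of \<open>Z\<close>
    appears in \<open>N\<close> columns of row \<open>u\<close>. Their sum is at most of order
    \<open>sqrt N\<close>, the norm of a sum of \<open>N\<close> basis vectors, because projecting
    does not increase the norm of \<open>S y\<close>. The 1 is the row sum of
    \<open>p\<close>.\<close>
  have bound: "f * real N \<le> 1 + c * c' * sqrt (real N)" for N
  proof -
    define I where "I = (\<lambda>n. A (k n) v) ` {..<N}"
    have inj: "inj_on (\<lambda>n. A (k n) v) {..<N}" using k(3) by (rule inj_on_subset) simp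
    define y where "y = (\<Sum>i\<in>I. e i)"
    define t where "t = (\<Sum>i\<in>I. \<tau> i)"
    have card: "card I = N" unfolding I_def using card_image[OF inj] by simp
    have fin: "finite I" by (simp add: I_def)
    have "y = (\<Sum>i\<in>(\<lambda>v. 2 * v + 1) ` I. ket i)"
      unfolding y_def e_def by (subst sum.reindex) (auto simp: inj_on_def)
    hence y: "norm y = sqrt N"
      using norm_sum_ket[of "(\<lambda>v. 2 * v + 1) ` I"] fin card by (simp add: card_image inj_on_def)
    have tW: "t \<in> W" unfolding t_def by (intro subspace_sum[OF subspace_W] \<tau>(1))
    have "S y - S t = (\<Sum>i\<in>I. S (e i) - S (\<tau> i))"
      by (simp add: y_def t_def S.sum sum_subtractf)
    hence "inner (S y - S t) (S t) = (\<Sum>i\<in>I. inner (S (e i) - S (\<tau> i)) (S t))"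
      by (simp add: inner_sum_left)
    also have "\<dots> = 0" by (intro sum.neutral ballI \<tau>(2) tW)
    finally have orth: "inner (S y - S t) (S t) = 0" .
    have "norm (S t) \<le> norm (S y)"
    proof (rule power2_le_imp_le)
      have "(norm (S y))\<^sup>2 = (norm (S y - S t))\<^sup>2 + 2 * inner (S y - S t) (S t) + (norm (S t))\<^sup>2"
        unfolding power2_norm_eq_inner by (simp add: inner_diff_left inner_diff_right inner_commute)
      with orth show "(norm (S t))\<^sup>2 \<le> (norm (S y))\<^sup>2" by simp
    qed simp
    also have "\<dots> \<le> sqrt N * c" using c(1)[of y] y by simp
    finally have "norm (S t) * c' \<le> sqrt N * c * c'" using c'(2) by simp
    hence "norm t \<le> c * c' * sqrt N" using c'(1)[of "S t"] by (simp add: inv mult_ac)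
    hence "cmod (coord t (2 * u)) \<le> c * c' * sqrt N" using coord_le_norm[of t "2 * u"] by linarith
    hence 1: "- Re (coord t (2 * u)) \<le> c * c' * sqrt N"
      using abs_Re_le_cmod[of "coord t (2 * u)"] by linarith
    have "Re (T u (A (k n) v)) = p u (A (k n) v) - f" for n
      using Z[OF k(1), of n u v] Zf by (simp add: Z_def k(2))
    hence "(\<Sum>i\<in>I. Re (T u i)) = (\<Sum>i\<in>I. p u i - f)"
      by (intro sum.cong) (auto simp: I_def)
    hence 2: "Re (coord t (2 * u)) = (\<Sum>i\<in>I. p u i) - f * N"
      by (simp add: t_def T_def sum_subtractf card)
    have "(\<Sum>i\<in>I. p u i) \<le> (\<Sum>\<^sub>\<infinity>i. p u i)"
      using fin by (intro finite_sum_le_infsum p_summable) (auto simp: p_nonneg)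
    hence "(\<Sum>i\<in>I. p u i) \<le> 1" using p_sum_le[of u] by linarith
    with 1 2 show ?thesis by linarith
  qed
  have "f \<le> 0"
  proof (rule ccontr)
    assume "\<not> f \<le> 0"
    \<comment> \<open>\<open>bound\<close> will be used for the square \<open>m * m\<close>, where
      it contradicts \<open>f * m > 1 + c * c'\<close> as \<open>m \<ge> 1\<close>.\<close>
    then obtain m where m: "(1 + c * c') / f < real m" using reals_Archimedean2 by blast
    hence "1 + c * c' < f * real m" using \<open>\<not> f \<le> 0\<close> by (simp add: field_simps)
    moreover have "0 < (1 + c * c') / f" using c(2) c'(2) \<open>\<not> f \<le> 0\<close> by (simp add: add_pos_nonneg)
    hence m1: "1 \<le> real m" using m by (cases m) auto
    ultimately have "(1 + c * c') * real m < f * real m * real m" by (intro mult_strict_right_mono) auto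
    moreover have "f * (real m * real m) \<le> 1 + c * c' * real m"
      using bound[of "m * m"] by simp
    ultimately show False using m1 by (simp add: algebra_simps)
  qed
  with p_nonneg[of u v] p_nonneg[of v u] show ?thesis by (simp add: f_def)
qed

end

section \<open>Bridges and orientation towards a root in graphs with contracted classes\<close>

section \<open>Rooted forests\<close>

text \<open>Links in \<open>base\<close> are never cut, so the classes of \<open>conn {}\<close>
  play the role of vertices. Edges have a type of their own because parallel edges must be told
  apart.\<close>

locale multigraph =
  fixes base :: "'v rel" and src tgt :: "'e \<Rightarrow> 'v"
begin

definition links :: "'e set \<Rightarrow> 'v rel" where
  "links Q = base \<union> {(src e, tgt e) | e. e \<in> Q}"

definition conn :: "'e set \<Rightarrow> 'v rel" where
  "conn Q = (links Q \<union> (links Q)\<inverse>)\<^sup>*"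

lemma conn_refl [simp, intro]: "(u, u) \<in> conn Q"
  by (simp add: conn_def)

lemma conn_sym: "(u, v) \<in> conn Q \<Longrightarrow> (v, u) \<in> conn Q"
proof -
  have "sym (conn Q)" unfolding conn_def by (intro sym_rtrancl sym_Un_converse)
  thus "(u, v) \<in> conn Q \<Longrightarrow> (v, u) \<in> conn Q" by (rule symD)
qed

lemma conn_trans: "\<lbrakk>(u, v) \<in> conn Q; (v, w) \<in> conn Q\<rbrakk> \<Longrightarrow> (u, w) \<in> conn Q"
  unfolding conn_def by (rule rtrancl_trans)

lemma links_mono: "Q \<subseteq> Q' \<Longrightarrow> links Q \<subseteq> links Q'"
  by (auto simp: links_def)

lemma conn_mono: "Q \<subseteq> Q' \<Longrightarrow> conn Q \<subseteq> conn Q'"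
  unfolding conn_def by (intro rtrancl_mono Un_mono converse_mono[THEN iffD2] links_mono)

lemma conn_edge: "e \<in> Q \<Longrightarrow> (src e, tgt e) \<in> conn Q"
  unfolding conn_def links_def by (intro r_into_rtrancl) blast

lemma conn_base: "b \<in> base \<Longrightarrow> b \<in> conn Q"
  unfolding conn_def links_def by (intro r_into_rtrancl) blast

lemma conn_induct [consumes 1, case_names refl base base' edge edge']:
  assumes "(u, v) \<in> conn Q" "R u"
    and "\<And>x y. \<lbrakk>(u, x) \<in> conn Q; R x; (x, y) \<in> base\<rbrakk> \<Longrightarrow> R y"
    and "\<And>x y. \<lbrakk>(u, x) \<in> conn Q; R x; (y, x) \<in> base\<rbrakk> \<Longrightarrow> R y"
    and "\<And>e. \<lbrakk>(u, src e) \<in> conn Q; R (src e); e \<in> Q\<rbrakk> \<Longrightarrow> R (tgt e)"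
    and "\<And>e. \<lbrakk>(u, tgt e) \<in> conn Q; R (tgt e); e \<in> Q\<rbrakk> \<Longrightarrow> R (src e)"
  shows "R v"
proof -
  have "(u, v) \<in> (links Q \<union> (links Q)\<inverse>)\<^sup>*" using assms(1) by (simp add: conn_def)
  thus ?thesis
  proof (induction rule: rtrancl_induct)
    case base show ?case by (rule assms(2))
  next
    case (step x y)
    have u: "(u, x) \<in> conn Q" using step(1) by (simp add: conn_def)
    consider "(x, y) \<in> base" | "(y, x) \<in> base" | e where "e \<in> Q" "x = src e" "y = tgt e"
      | e where "e \<in> Q" "y = src e" "x = tgt e"
      using step(2) unfolding links_def by blast
    thus ?case
      by cases (use u step(3) assms(3-6) in metis)+
  qed
qed

text \<open>A path uses finitely many edges. This makes connectedness a countable union of events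
  and a countable list of cycle types exhaustive.\<close>

lemma conn_finite:
  assumes "(u, v) \<in> conn Q"
  obtains Q' where "finite Q'" "Q' \<subseteq> Q" "(u, v) \<in> conn Q'"
proof -
  define R where "R v \<longleftrightarrow> (\<exists>Q'. finite Q' \<and> Q' \<subseteq> Q \<and> (u, v) \<in> conn Q')" for v
  have "R v"
    using assms
  proof (induction rule: conn_induct)
    case refl show ?case by (auto simp: R_def intro: exI[of _ "{}"])
  next
    case (base x y) thus ?case unfolding R_def by (meson conn_base conn_trans)
  next
    case (base' x y) thus ?case unfolding R_def by (meson conn_base conn_sym conn_trans)
  next
    case (edge e)
    then obtain Q' where Q': "finite Q'" "Q' \<subseteq> Q" "(u, src e) \<in> conn Q'" by (auto simp: R_def)
    have "(u, tgt e) \<in> conn (insert e Q')"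
      using conn_trans[of u "src e" "insert e Q'" "tgt e"] conn_mono[of Q' "insert e Q'"]
        conn_edge[of e "insert e Q'"] Q'(3) by blast
    with Q' \<open>e \<in> Q\<close> show ?case unfolding R_def by (intro exI[of _ "insert e Q'"]) auto
  next
    case (edge' e)
    then obtain Q' where Q': "finite Q'" "Q' \<subseteq> Q" "(u, tgt e) \<in> conn Q'" by (auto simp: R_def)
    have "(u, src e) \<in> conn (insert e Q')"
      using conn_trans[of u "tgt e" "insert e Q'" "src e"] conn_mono[of Q' "insert e Q'"]
        conn_sym[OF conn_edge[of e "insert e Q'"]] Q'(3) by blast
    with Q' \<open>e \<in> Q\<close> show ?case unfolding R_def by (intro exI[of _ "insert e Q'"]) auto
  qed
  thus ?thesis using that by (auto simp: R_def)
qed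

text \<open>After its last passage through \<open>e\<close>, a walk from \<open>u\<close> to
  \<open>v\<close> proceeds from an end of \<open>e\<close> within \<open>Q\<close>. The invariant
  \<open>R\<close> expresses this without speaking of walks.\<close>

lemma conn_insertE:
  assumes "(u, v) \<in> conn (insert e Q)" "(u, v) \<notin> conn Q"
  shows "(v, src e) \<in> conn Q \<or> (v, tgt e) \<in> conn Q"
proof -
  define R where "R v \<longleftrightarrow> (u, v) \<in> conn Q \<or> (v, src e) \<in> conn Q \<or> (v, tgt e) \<in> conn Q" for v
  have "R v"
    using assms(1)
  proof (induction rule: conn_induct)
    case refl show ?case by (simp add: R_def)
  next
    case (base x y) thus ?case unfolding R_def by (meson conn_base conn_sym conn_trans)
  next
    case (base' x y) thus ?case unfolding R_def by (meson conn_base conn_sym conn_trans)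
  next
    case (edge e') thus ?case unfolding R_def by (metis conn_edge conn_refl conn_sym conn_trans insertE)
  next
    case (edge' e') thus ?case unfolding R_def by (metis conn_edge conn_refl conn_sym conn_trans insertE)
  qed
  with assms(2) show ?thesis by (simp add: R_def)
qed

text \<open>Every edge is a bridge modulo \<open>base\<close>. This excludes loops and parallel
  edges between classes as well.\<close>

definition forest :: "'e set \<Rightarrow> bool" where
  "forest Q \<longleftrightarrow> (\<forall>e\<in>Q. (src e, tgt e) \<notin> conn (Q - {e}))"

definition joins :: "'e \<Rightarrow> 'v \<Rightarrow> 'v \<Rightarrow> bool" where
  "joins e u v \<longleftrightarrow> (u, src e) \<in> conn {} \<and> (v, tgt e) \<in> conn {} \<or>
     (u, tgt e) \<in> conn {} \<and> (v, src e) \<in> conn {}"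

lemma conn_emptyD: "(u, v) \<in> conn {} \<Longrightarrow> (u, v) \<in> conn Q"
  using conn_mono[of "{}" Q] by blast

lemma joins_sym: "joins e u v \<longleftrightarrow> joins e v u"
  by (auto simp: joins_def)

lemma joins_conn: "joins e u v \<Longrightarrow> e \<in> Q \<Longrightarrow> (u, v) \<in> conn Q"
  unfolding joins_def by (meson conn_edge conn_emptyD conn_sym conn_trans)

lemma joins_cong: "\<lbrakk>(u, u') \<in> conn {}; (v, v') \<in> conn {}\<rbrakk> \<Longrightarrow> joins e u v \<longleftrightarrow> joins e u' v'"
  unfolding joins_def by (meson conn_sym conn_trans)

lemma joins_unique: "\<lbrakk>joins e u v; joins e u v'\<rbrakk> \<Longrightarrow> (v, v') \<in> conn {}"
  unfolding joins_def by (meson conn_sym conn_trans)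

lemma joins_not_conn: "\<lbrakk>forest Q; e \<in> Q; joins e u v\<rbrakk> \<Longrightarrow> (u, v) \<notin> conn (Q - {e})"
  unfolding forest_def joins_def by (meson conn_emptyD conn_sym conn_trans)

end

locale rooted_multigraph = multigraph base src tgt
  for base :: "'v rel" and src tgt :: "'e \<Rightarrow> 'v" +
  fixes enum :: "nat \<Rightarrow> 'v"
begin

text \<open>
  Each tree is rooted at the vertex of least number.  An edge is directed towards the root, that
  is, from \<open>u\<close> to \<open>v\<close> if the least number occurs on the side of \<open>v\<close> once the edge is removed.
\<close>

definition towards_root :: "'e set \<Rightarrow> 'e \<Rightarrow> 'v \<Rightarrow> 'v \<Rightarrow> bool" where
  "towards_root Q e u v \<longleftrightarrow>
     (\<exists>n. (v, enum n) \<in> conn (Q - {e}) \<and> (\<forall>m\<le>n. (u, enum m) \<notin> conn (Q - {e})))"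

definition parent :: "'e set \<Rightarrow> 'v \<Rightarrow> 'v \<Rightarrow> bool" where
  "parent Q u v \<longleftrightarrow> (\<exists>e\<in>Q. joins e u v \<and> towards_root Q e u v)"

lemma parent_cong:
  assumes "(u, u') \<in> conn {}" "(v, v') \<in> conn {}"
  shows "parent Q u v \<longleftrightarrow> parent Q u' v'"
proof -
  have "(u, x) \<in> conn Q' \<longleftrightarrow> (u', x) \<in> conn Q'" "(v, x) \<in> conn Q' \<longleftrightarrow> (v', x) \<in> conn Q'" for x Q'
    using assms conn_emptyD conn_sym conn_trans by metis+
  with joins_cong[OF assms] show ?thesis by (simp add: parent_def towards_root_def)
qed

text \<open>If the way from \<open>v\<close> to \<open>enum n\<close> outside \<open>e\<close> used
  \<open>e'\<close>, then \<open>enum n\<close> would be linked to an end of \<open>e'\<close>, and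
  both ends are linked to \<open>u\<close> outside \<open>e\<close>. So the way avoids
  \<open>e'\<close> too, and \<open>e\<close> extends it to \<open>u\<close>.\<close>

lemma parent_unique_aux:
  assumes e: "e \<in> Q" "joins e u v" and e': "e' \<in> Q" "joins e' u v'" and ne: "e \<noteq> e'"
    and n: "(v, enum n) \<in> conn (Q - {e})" "(u, enum n) \<notin> conn (Q - {e})"
  shows "(u, enum n) \<in> conn (Q - {e'})"
proof -
  have Q: "Q - {e} = insert e' (Q - {e, e'})" using e'(1) ne by auto
  have sub: "Q - {e, e'} \<subseteq> Q - {e}" "Q - {e, e'} \<subseteq> Q - {e'}" by auto
  have end_conn: "(u, src e') \<in> conn (Q - {e}) \<and> (u, tgt e') \<in> conn (Q - {e})"
    using e'(2) conn_edge[of e' "Q - {e}"] e'(1) ne unfolding joins_def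
    by (metis DiffI conn_emptyD conn_sym conn_trans singletonD)
  have "(v, enum n) \<in> conn (Q - {e, e'})"
  proof (rule ccontr)
    assume "(v, enum n) \<notin> conn (Q - {e, e'})"
    hence "(enum n, src e') \<in> conn (Q - {e, e'}) \<or> (enum n, tgt e') \<in> conn (Q - {e, e'})"
      using conn_insertE[of v "enum n" e' "Q - {e, e'}"] n(1) Q by simp
    hence "(enum n, src e') \<in> conn (Q - {e}) \<or> (enum n, tgt e') \<in> conn (Q - {e})"
      using conn_mono[OF sub(1)] by blast
    with end_conn have "(u, enum n) \<in> conn (Q - {e})" by (meson conn_sym conn_trans)
    with n(2) show False ..
  qed
  hence "(v, enum n) \<in> conn (Q - {e'})" using conn_mono[OF sub(2)] by blast
  moreover have "(u, v) \<in> conn (Q - {e'})" 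
    by (rule joins_conn[OF e(2)]) (use e(1) ne in auto)
  ultimately show ?thesis by (rule conn_trans[rotated])
qed

text \<open>With two different edges, the number witnessing either one would be reachable from
  \<open>u\<close> without the other, so each number would be smaller than the other.\<close>

lemma parent_unique:
  assumes "parent Q u v" "parent Q u v'"
  shows "(v, v') \<in> conn {}"
proof -
  obtain e n where e: "e \<in> Q" "joins e u v" and n: "(v, enum n) \<in> conn (Q - {e})"
    "\<forall>m\<le>n. (u, enum m) \<notin> conn (Q - {e})"
    using assms(1) by (auto simp: parent_def towards_root_def)
  obtain e' n' where e': "e' \<in> Q" "joins e' u v'" and n': "(v', enum n') \<in> conn (Q - {e'})"
    "\<forall>m\<le>n'. (u, enum m) \<notin> conn (Q - {e'})"
    using assms(2) by (auto simp: parent_def towards_root_def)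
  show ?thesis
  proof (cases "e = e'")
    case True
    with e(2) e'(2) show ?thesis by (metis joins_unique)
  next
    case False
    have "(u, enum n) \<in> conn (Q - {e'})"
      using parent_unique_aux[OF e e' False n(1)] n(2) by simp
    hence "n' < n" using n'(2) by (meson not_le)
    moreover have "(u, enum n') \<in> conn (Q - {e})"
      using parent_unique_aux[OF e' e False[symmetric] n'(1)] n'(2) by simp
    hence "n < n'" using n(2) by (meson not_le)
    ultimately show ?thesis by simp
  qed
qed

lemma parent_total:
  assumes "forest Q" "e \<in> Q" "joins e u v" "u \<in> range enum" "v \<in> range enum"
  shows "parent Q u v \<or> parent Q v u"
proof -
  \<comment> \<open>The least number on the side of \<open>x\<close> after removal of
    \<open>e\<close>. The sides of \<open>u\<close> and \<open>v\<close> are different because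
    \<open>e\<close> is a bridge, so the minima differ.\<close>
  define m where "m x = (LEAST n. (x, enum n) \<in> conn (Q - {e}))" for x
  have m: "(x, enum (m x)) \<in> conn (Q - {e})" if "x \<in> range enum" for x
    unfolding m_def using that by (auto intro: LeastI)
  have m_less: "(x, enum k) \<notin> conn (Q - {e})" if "k < m x" for k x
    using that unfolding m_def by (rule not_less_Least)
  have "m u \<noteq> m v"
    using joins_not_conn[OF assms(1-3)] m[OF assms(4)] m[OF assms(5)] by (metis conn_sym conn_trans)
  hence "m v < m u \<or> m u < m v" by linarith
  hence "towards_root Q e u v \<or> towards_root Q e v u"
    unfolding towards_root_def using m[OF assms(4)] m[OF assms(5)] m_less by (meson le_less_trans)
  thus ?thesis using assms(2,3) by (auto simp: parent_def joins_sym[of e v u])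
qed

lemma parent_antisym:
  assumes "forest Q" "parent Q u v"
  shows "\<not> parent Q v u"
proof
  assume "parent Q v u"
  then obtain e' n' where e': "e' \<in> Q" "joins e' v u" and n': "(u, enum n') \<in> conn (Q - {e'})"
    "\<forall>m\<le>n'. (v, enum m) \<notin> conn (Q - {e'})"
    by (auto simp: parent_def towards_root_def)
  obtain e n where e: "e \<in> Q" "joins e u v" and n: "(v, enum n) \<in> conn (Q - {e})"
    "\<forall>m\<le>n. (u, enum m) \<notin> conn (Q - {e})"
    using assms(2) by (auto simp: parent_def towards_root_def)
  have "e = e'"
  proof (rule ccontr)
    assume "e \<noteq> e'"
    hence "(u, v) \<in> conn (Q - {e})" using joins_conn[of e' u v "Q - {e}"] e' by (auto simp: joins_sym)
    with joins_not_conn[OF assms(1) e] show False ..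
  qed
  with n n' have "\<not> n' \<le> n" "\<not> n \<le> n'" by blast+
  thus False by simp
qed

end

section \<open>Right cosets of an infinite cyclic subgroup as vertices of a graph\<close>

locale infinite_order = group G for G (structure) +
  fixes a :: 'a
  assumes a: "a \<in> carrier G" and a_pow: "\<And>n::nat. n > 0 \<Longrightarrow> a [^] n \<noteq> \<one>"
    and countable_carrier: "countable (carrier G)"
begin

lemma a_pow_closed [simp]: "a [^] (n::nat) \<in> carrier G"
  using a by simp

lemma a_pow_shift:
  assumes "u \<in> carrier G"
  shows "a \<otimes> (a [^] (n::nat) \<otimes> u) = a [^] Suc n \<otimes> u" "a [^] (n::nat) \<otimes> (a \<otimes> u) = a [^] Suc n \<otimes> u"
  using a assms nat_pow_Suc2[OF a, of n] by (simp_all flip: m_assoc)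

lemma a_pow_mult:
  assumes "u \<in> carrier G"
  shows "a [^] (m::nat) \<otimes> (a [^] (n::nat) \<otimes> u) = a [^] (m + n) \<otimes> u"
  using a assms by (simp add: nat_pow_mult flip: m_assoc)

lemma a_pow_inj: "a [^] (m::nat) = a [^] (n::nat) \<longleftrightarrow> m = n"
proof
  assume eq: "a [^] m = a [^] n"
  have *: "m = n" if "m \<le> n" "a [^] m = a [^] n" for m n :: nat
  proof (rule ccontr)
    assume "m \<noteq> n"
    hence "n - m > 0" "n = m + (n - m)" using that by auto
    hence "a [^] m \<otimes> a [^] (n - m) = a [^] m \<otimes> \<one>" using that(2) a by (metis nat_pow_mult a_pow_closed r_one)
    hence "a [^] (n - m) = \<one>" by simp
    with a_pow \<open>n - m > 0\<close> show False by blast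
  qed
  show "m = n" using *[of m n] *[of n m] eq by (metis nat_le_linear)
qed simp

text \<open>
  The vertices of the multigraph are the group elements and the pair \<open>(q, t)\<close> is an edge from \<open>q\<close>
  to \<open>t \<otimes> q\<close>.  All base edges \<open>q\<close> to \<open>a \<otimes> q\<close> are always present, which amounts to contracting
  the right cosets of the group generated by \<open>a\<close>.
\<close>

sublocale rooted_multigraph "{(q, a \<otimes> q) | q. q \<in> carrier G}" "fst" "\<lambda>(q, t). t \<otimes> q"
    "from_nat_into (carrier G)" .

abbreviation enum :: "nat \<Rightarrow> 'a" where "enum \<equiv> from_nat_into (carrier G)"

lemma range_enum: "range enum = carrier G"
  using countable_carrier carrier_not_empty by (rule range_from_nat_into[rotated])

lemma enum_closed [simp]: "enum n \<in> carrier G"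
  using range_enum by auto

text \<open>Edges multiply on the left, so right translation is an automorphism of the graph that
  only renames the starting points of edges.\<close>

lemma conn_translate:
  assumes "(u, v) \<in> conn Q" "g \<in> carrier G" "Q \<subseteq> carrier G \<times> carrier G"
  shows "(u \<otimes> g, v \<otimes> g) \<in> conn ((\<lambda>(q, t). (q \<otimes> g, t)) ` Q)"
  using assms(1)
proof (induction rule: conn_induct)
  case refl show ?case by simp
next
  case (base x y)
  hence "(x \<otimes> g, y \<otimes> g) \<in> conn ((\<lambda>(q, t). (q \<otimes> g, t)) ` Q)"
    using assms(2) a by (intro conn_base) (auto simp: m_assoc)
  thus ?case by (rule conn_trans[OF base.IH])
next
  case (base' x y)
  hence "(y \<otimes> g, x \<otimes> g) \<in> conn ((\<lambda>(q, t). (q \<otimes> g, t)) ` Q)"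
    using assms(2) a by (intro conn_base) (auto simp: m_assoc)
  hence "(x \<otimes> g, y \<otimes> g) \<in> conn ((\<lambda>(q, t). (q \<otimes> g, t)) ` Q)" by (rule conn_sym)
  thus ?case by (rule conn_trans[OF base'.IH])
next
  case (edge e)
  obtain q t where e: "e = (q, t)" by (cases e)
  hence "(q \<otimes> g, t) \<in> (\<lambda>(q, t). (q \<otimes> g, t)) ` Q" using \<open>e \<in> Q\<close> by force
  from conn_edge[OF this] have "(q \<otimes> g, t \<otimes> (q \<otimes> g)) \<in> conn ((\<lambda>(q, t). (q \<otimes> g, t)) ` Q)" by simp
  moreover have "t \<otimes> (q \<otimes> g) = t \<otimes> q \<otimes> g"
    using \<open>e \<in> Q\<close> e assms(2,3) by (auto simp: m_assoc)
  ultimately have "(q \<otimes> g, t \<otimes> q \<otimes> g) \<in> conn ((\<lambda>(q, t). (q \<otimes> g, t)) ` Q)" by simp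
  thus ?case using conn_trans[OF edge.IH] by (simp add: e)
next
  case (edge' e)
  obtain q t where e: "e = (q, t)" by (cases e)
  hence "(q \<otimes> g, t) \<in> (\<lambda>(q, t). (q \<otimes> g, t)) ` Q" using \<open>e \<in> Q\<close> by force
  from conn_edge[OF this] have "(q \<otimes> g, t \<otimes> (q \<otimes> g)) \<in> conn ((\<lambda>(q, t). (q \<otimes> g, t)) ` Q)" by simp
  moreover have "t \<otimes> (q \<otimes> g) = t \<otimes> q \<otimes> g"
    using \<open>e \<in> Q\<close> e assms(2,3) by (auto simp: m_assoc)
  ultimately have "(t \<otimes> q \<otimes> g, q \<otimes> g) \<in> conn ((\<lambda>(q, t). (q \<otimes> g, t)) ` Q)"
    by (simp add: conn_sym)
  thus ?case using conn_trans[OF edge'.IH] by (simp add: e)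
qed

lemma conn_empty_translate:
  assumes "g \<in> carrier G"
  shows "(u, v) \<in> conn {} \<Longrightarrow> (u \<otimes> g, v \<otimes> g) \<in> conn {}"
  using conn_translate[OF _ assms, of u v "{}"] by simp

lemma conn_empty_pow: "u \<in> carrier G \<Longrightarrow> (u, a [^] (n::nat) \<otimes> u) \<in> conn {}"
proof (induction n)
  case (Suc n)
  have "(a [^] n \<otimes> u, a \<otimes> (a [^] n \<otimes> u)) \<in> conn {}"
    using Suc.prems by (intro conn_base) auto
  thus ?case unfolding a_pow_shift(1)[OF Suc.prems] by (rule conn_trans[OF Suc.IH[OF Suc.prems]])
qed simp

text \<open>With natural powers the two directions in the cyclic group are separate cases. The
  induction keeps an equation \<open>a^m v = a^n u\<close>, from which the smaller power is
  cancelled.\<close>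

lemma conn_empty_cases:
  assumes "(u, v) \<in> conn {}" "u \<in> carrier G"
  obtains n :: nat where "v = a [^] n \<otimes> u" | n :: nat where "u = a [^] n \<otimes> v"
proof -
  have "v \<in> carrier G \<and> (\<exists>(m::nat) (n::nat). a [^] m \<otimes> v = a [^] n \<otimes> u)"
    using assms(1)
  proof (induction rule: conn_induct)
    case refl show ?case using assms(2) by blast
  next
    case (base x y)
    then obtain m n :: nat where mn: "a [^] m \<otimes> x = a [^] n \<otimes> u" and x: "x \<in> carrier G" by auto
    have y: "y = a \<otimes> x" using base by auto
    have "a [^] m \<otimes> y = a \<otimes> (a [^] m \<otimes> x)" using x by (simp only: y a_pow_shift)
    also have "\<dots> = a [^] Suc n \<otimes> u" using assms(2) by (simp only: mn a_pow_shift)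
    finally show ?case using a x y by blast
  next
    case (base' x y)
    then obtain m n :: nat where mn: "a [^] m \<otimes> x = a [^] n \<otimes> u" by auto
    have y: "x = a \<otimes> y" "y \<in> carrier G" using base' by auto
    have "a [^] Suc m \<otimes> y = a [^] n \<otimes> u" using y mn by (simp only: a_pow_shift(2)[symmetric])
    thus ?case using y by blast
  qed auto
  then obtain m n :: nat where v: "v \<in> carrier G" and mn: "a [^] m \<otimes> v = a [^] n \<otimes> u" by blast
  show ?thesis
  proof (cases "m \<le> n")
    case True
    hence "a [^] m \<otimes> v = a [^] m \<otimes> (a [^] (n - m) \<otimes> u)"
      using assms(2) mn by (simp add: a_pow_mult)
    thus ?thesis using v assms(2) that(1) by simp
  next
    case False
    hence "a [^] n \<otimes> u = a [^] n \<otimes> (a [^] (m - n) \<otimes> v)"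
      using v mn by (simp add: a_pow_mult)
    thus ?thesis using v assms(2) that(2) by simp
  qed
qed

definition coset_index :: "'a \<Rightarrow> nat" where
  "coset_index u = (LEAST n. (u, enum n) \<in> conn {})"

lemma coset_index:
  assumes "u \<in> carrier G"
  shows "(u, enum (coset_index u)) \<in> conn {}"
proof -
  obtain n where "u = enum n" using assms range_enum by blast
  hence "(u, enum n) \<in> conn {}" by simp
  thus ?thesis unfolding coset_index_def by (rule LeastI)
qed

lemma coset_index_eq:
  assumes "u \<in> carrier G" "v \<in> carrier G"
  shows "coset_index u = coset_index v \<longleftrightarrow> (u, v) \<in> conn {}"
proof
  assume "coset_index u = coset_index v"
  thus "(u, v) \<in> conn {}"
    using conn_trans[OF coset_index[OF assms(1)] conn_sym, of v] coset_index[OF assms(2)] by simp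
next
  assume "(u, v) \<in> conn {}"
  hence "(u, x) \<in> conn {} \<longleftrightarrow> (v, x) \<in> conn {}" for x
    using conn_sym conn_trans by blast
  thus "coset_index u = coset_index v" by (simp add: coset_index_def)
qed

text \<open>Right multiplication by \<open>inv g\<close>, in terms of the numbers of cosets. Numbers
  that belong to no coset are fixed, which gives an action on all of \<open>nat\<close>, the index
  set of \<open>ell2\<close>.\<close>

definition coset_act :: "'a \<Rightarrow> nat \<Rightarrow> nat" where
  "coset_act g i = (if i \<in> coset_index ` carrier G then coset_index (enum i \<otimes> inv g) else i)"

lemma coset_act_index:
  assumes "g \<in> carrier G" "u \<in> carrier G"
  shows "coset_act g (coset_index u) = coset_index (u \<otimes> inv g)"
proof -
  have "(u \<otimes> inv g, enum (coset_index u) \<otimes> inv g) \<in> conn {}"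
    using assms by (intro conn_empty_translate coset_index) auto
  hence "coset_index (u \<otimes> inv g) = coset_index (enum (coset_index u) \<otimes> inv g)"
    using assms by (subst coset_index_eq) auto
  thus ?thesis using assms by (simp add: coset_act_def)
qed

lemma coset_act_one: "coset_act \<one> i = i"
  using coset_act_index[of \<one>] by (cases "i \<in> coset_index ` carrier G") (auto simp: coset_act_def)

lemma coset_act_mult:
  assumes "g \<in> carrier G" "h \<in> carrier G"
  shows "coset_act (g \<otimes> h) i = coset_act g (coset_act h i)"
proof (cases "i \<in> coset_index ` carrier G")
  case True
  then obtain u where "i = coset_index u" "u \<in> carrier G" by blast
  thus ?thesis using assms by (simp add: coset_act_index inv_mult_group m_assoc)
qed (simp add: coset_act_def)

end

section \<open>Orbits as copies of the group, and measurability of the graphs on them\<close>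

section \<open>Free actions\<close>

text \<open>A countable base works because complements of finite sets are open. The sets
  \<open>U n\<close> later allow a measurable choice of one point among finitely many in an
  orbit.\<close>

lemma standard_borel_separating:
  assumes "standard_borel M"
  obtains U :: "nat \<Rightarrow> 'x set" where "\<And>n. U n \<in> sets M"
    "\<And>y F. \<lbrakk>y \<in> space M; finite F; F \<subseteq> space M; y \<notin> F\<rbrakk> \<Longrightarrow> \<exists>n. y \<in> U n \<and> U n \<inter> F = {}"
proof -
  obtain X where X: "topspace X = space M" "completely_metrizable_space X" "second_countable X"
    "sets M = sigma_sets (space M) {U. openin X U}"
    using assms by (auto simp: standard_borel_def)
  obtain \<B> where B: "countable \<B>" "\<And>V. V \<in> \<B> \<Longrightarrow> openin X V"
    "\<And>U x. \<lbrakk>openin X U; x \<in> U\<rbrakk> \<Longrightarrow> \<exists>V\<in>\<B>. x \<in> V \<and> V \<subseteq> U"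
    using X(3) unfolding second_countable_def by metis
  have t1: "t1_space X"
    using X(2) by (intro metrizable_imp_t1_space completely_metrizable_imp_metrizable_space)
  define U where "U = from_nat_into (insert {} \<B>)"
  have range: "range U = insert {} \<B>"
    unfolding U_def using B(1) by (intro range_from_nat_into) auto
  show ?thesis
  proof (rule that[of U])
    fix n
    have "U n \<in> insert {} \<B>" using range by blast
    hence "openin X (U n)" using B(2) by auto
    thus "U n \<in> sets M" unfolding X(4) by (intro sigma_sets.Basic) simp
  next
    fix y F assume y: "y \<in> space M" "finite F" "F \<subseteq> space M" "y \<notin> F"
    have "closedin X F" using t1 y(2,3) X(1) by (simp add: t1_space_closedin_finite)
    hence "openin X (topspace X - F)" by blast
    then obtain V where "V \<in> \<B>" "y \<in> V" "V \<subseteq> topspace X - F"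
      using B(3)[of "topspace X - F" y] y X(1) by auto
    moreover then obtain n where "V = U n" using range by (metis insertI2 rangeE)
    ultimately show "\<exists>n. y \<in> U n \<and> U n \<inter> F = {}" by blast
  qed
qed

locale free_pmp = infinite_order G a for G (structure) and a +
  fixes M :: "'x measure" and \<phi> :: "'a \<Rightarrow> 'x \<Rightarrow> 'x"
  assumes standard: "standard_prob_space M"
    and pmp: "pmp_action G M \<phi>"
    and ess_free: "essentially_free G M \<phi>"
begin

sublocale prob_space M
  using standard by (simp add: standard_prob_space_def)

sublocale act: group_action G "space M" \<phi>
  using pmp by (simp add: pmp_action_def)

lemma act_closed: "\<lbrakk>g \<in> carrier G; x \<in> space M\<rbrakk> \<Longrightarrow> \<phi> g x \<in> space M"
  by (rule act.element_image) auto

lemma act_one: "x \<in> space M \<Longrightarrow> \<phi> \<one> x = x"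
  using act.id_eq_one by (metis restrict_apply')

lemma act_mult: "\<lbrakk>x \<in> space M; g \<in> carrier G; h \<in> carrier G\<rbrakk> \<Longrightarrow> \<phi> (g \<otimes> h) x = \<phi> g (\<phi> h x)"
  by (rule act.composition_rule)

lemma act_inv: "\<lbrakk>x \<in> space M; g \<in> carrier G\<rbrakk> \<Longrightarrow> \<phi> (inv g) (\<phi> g x) = x"
  by (simp add: act_one flip: act_mult)

lemma act_measurable [measurable]: "g \<in> carrier G \<Longrightarrow> \<phi> g \<in> measurable M M"
  using pmp by (simp add: pmp_action_def)

lemma act_preimage_sets:
  assumes "g \<in> carrier G" "B \<in> sets M"
  shows "{x \<in> space M. \<phi> g x \<in> B} \<in> sets M"
  using measurable_sets[OF act_measurable[OF assms(1)] assms(2)] by (simp add: vimage_def Int_def conj_commute)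

lemma act_preimage_measure:
  assumes "g \<in> carrier G" "B \<in> sets M"
  shows "emeasure M {x \<in> space M. \<phi> g x \<in> B} = emeasure M B"
proof -
  have "emeasure M B = emeasure (distr M M (\<phi> g)) B"
    using pmp assms(1) by (simp add: pmp_action_def)
  also have "\<dots> = emeasure M {x \<in> space M. \<phi> g x \<in> B}"
    using assms by (subst emeasure_distr) (auto simp: vimage_def Int_def conj_commute)
  finally show ?thesis ..
qed

text \<open>Points whose whole orbit avoids a null set form an invariant conull set; the null set is
  taken to contain \<open>N\<close> and all points with nontrivial stabilizer.\<close>

lemma ex_free_part:
  assumes "N \<in> null_sets M"
  shows "\<exists>X\<in>sets M. space M - X \<in> null_sets M \<and> X \<inter> N = {} \<and>
    (\<forall>g\<in>carrier G. \<forall>x\<in>X. \<phi> g x \<in> X \<and> (\<phi> g x = x \<longrightarrow> g = \<one>))"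
proof -
  obtain N' where N': "N' \<in> null_sets M" "{x \<in> space M. stabilizer G \<phi> x \<noteq> {\<one>}} \<subseteq> N'"
    using ess_free unfolding essentially_free_def eventually_ae_filter by blast
  define N0 where "N0 = N \<union> N'"
  have N0: "N0 \<in> null_sets M" using assms N'(1) by (auto simp: N0_def)
  define X where "X = {x \<in> space M. \<forall>g\<in>carrier G. \<phi> g x \<notin> N0}"
  have "space M - X = (\<Union>g\<in>carrier G. {x \<in> space M. \<phi> g x \<in> N0})"
    by (auto simp: X_def)
  moreover have "{x \<in> space M. \<phi> g x \<in> N0} \<in> null_sets M" if "g \<in> carrier G" for g
    using act_preimage_sets[OF that] act_preimage_measure[OF that] N0 by (auto simp: null_sets_def)
  ultimately have null: "space M - X \<in> null_sets M"
    using countable_carrier by (auto intro: null_sets_UN')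
  have "X = space M - (space M - X)" by (auto simp: X_def)
  hence "X \<in> sets M" using null by (metis null_setsD2 sets.compl_sets)
  moreover have "\<phi> g x \<in> X" if "g \<in> carrier G" "x \<in> X" for g x
    using that by (auto simp: X_def act_closed simp flip: act_mult)
  moreover have "g = \<one>" if "g \<in> carrier G" "x \<in> X" "\<phi> g x = x" for g x
  proof -
    have "\<phi> \<one> x \<notin> N0" using that by (auto simp: X_def)
    hence "x \<notin> N'" using that by (auto simp: X_def act_one N0_def)
    hence "stabilizer G \<phi> x = {\<one>}" using N'(2) that by (auto simp: X_def)
    thus ?thesis using that by (auto simp: stabilizer_def)
  qed
  moreover have "X \<inter> N = {}"
  proof -
    have "x \<notin> N" if "x \<in> X" for x
    proof -
      have "\<phi> \<one> x \<notin> N0" using that by (auto simp: X_def)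
      thus ?thesis using that by (auto simp: X_def act_one N0_def)
    qed
    thus ?thesis by blast
  qed
  ultimately show ?thesis using null by blast
qed

definition free_part :: "'x set" where
  "free_part = (SOME X. X \<in> sets M \<and> space M - X \<in> null_sets M \<and>
    (\<forall>g\<in>carrier G. \<forall>x\<in>X. \<phi> g x \<in> X \<and> (\<phi> g x = x \<longrightarrow> g = \<one>)))"

lemma free_part:
  shows free_part_sets [measurable]: "free_part \<in> sets M"
    and free_part_null: "space M - free_part \<in> null_sets M"
    and free_part_act: "\<lbrakk>g \<in> carrier G; x \<in> free_part\<rbrakk> \<Longrightarrow> \<phi> g x \<in> free_part"
    and free_part_free: "\<lbrakk>g \<in> carrier G; x \<in> free_part; \<phi> g x = x\<rbrakk> \<Longrightarrow> g = \<one>"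
proof -
  have "\<exists>X. X \<in> sets M \<and> space M - X \<in> null_sets M \<and>
    (\<forall>g\<in>carrier G. \<forall>x\<in>X. \<phi> g x \<in> X \<and> (\<phi> g x = x \<longrightarrow> g = \<one>))"
    using ex_free_part[of "{}"] by auto
  from someI_ex[OF this, folded free_part_def]
  show "free_part \<in> sets M" "space M - free_part \<in> null_sets M"
    "\<lbrakk>g \<in> carrier G; x \<in> free_part\<rbrakk> \<Longrightarrow> \<phi> g x \<in> free_part"
    "\<lbrakk>g \<in> carrier G; x \<in> free_part; \<phi> g x = x\<rbrakk> \<Longrightarrow> g = \<one>" by auto
qed

lemma free_part_space: "x \<in> free_part \<Longrightarrow> x \<in> space M"
  using free_part_sets sets.sets_into_space by blast

lemma emeasure_free_part: "B \<in> sets M \<Longrightarrow> emeasure M (B \<inter> free_part) = emeasure M B"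
proof -
  assume B: "B \<in> sets M"
  have "emeasure M (B \<inter> free_part) = emeasure M (B - (space M - free_part))"
    using sets.sets_into_space[OF B] by (intro arg_cong[of _ _ "emeasure M"]) auto
  thus ?thesis using emeasure_Diff_null_set[OF free_part_null B] by simp
qed

text \<open>The graph on the orbit of \<open>x\<close>, pulled back to the group along the orbit map
  of \<open>x\<close>, which is injective on the free part. Changing the base point within the orbit
  becomes a right translation.\<close>

definition edges :: "('a \<Rightarrow> 'x set) \<Rightarrow> 'x \<Rightarrow> ('a \<times> 'a) set" where
  "edges E x = {(q, t). q \<in> carrier G \<and> t \<in> carrier G \<and> \<phi> q x \<in> E t}"

lemma edges_subset: "edges E x \<subseteq> carrier G \<times> carrier G"
  by (auto simp: edges_def)

lemma edges_translate:
  assumes "x \<in> space M" "g \<in> carrier G"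
  shows "edges E x = (\<lambda>(q, t). (q \<otimes> g, t)) ` edges E (\<phi> g x)"
proof (intro equalityI subsetI)
  fix e assume "e \<in> edges E x"
  then obtain q t where e: "e = (q, t)" "q \<in> carrier G" "t \<in> carrier G" "\<phi> q x \<in> E t"
    by (auto simp: edges_def)
  have "(q \<otimes> inv g, t) \<in> edges E (\<phi> g x)"
    using e assms by (simp add: edges_def m_assoc act_closed flip: act_mult)
  moreover have "e = (\<lambda>(q, t). (q \<otimes> g, t)) (q \<otimes> inv g, t)"
    using e assms by (simp add: m_assoc)
  ultimately show "e \<in> (\<lambda>(q, t). (q \<otimes> g, t)) ` edges E (\<phi> g x)" by (rule rev_image_eqI)
next
  fix e assume "e \<in> (\<lambda>(q, t). (q \<otimes> g, t)) ` edges E (\<phi> g x)"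
  thus "e \<in> edges E x" using assms by (auto simp: edges_def act_mult)
qed

text \<open>A connection is witnessed by one of countably many finite edge sets, and the presence of
  each is a finite intersection of preimages.\<close>

lemma conn_edges_sets:
  assumes E: "\<And>t. E t \<in> sets M"
  shows "{x \<in> space M. (u, v) \<in> conn (edges E x - {e})} \<in> sets M"
proof -
  define \<Q> where "\<Q> = {Q. finite Q \<and> Q \<subseteq> carrier G \<times> carrier G \<and> e \<notin> Q \<and> (u, v) \<in> conn Q}"
  have "countable {Q. finite Q \<and> Q \<subseteq> carrier G \<times> carrier G}"
    using countable_carrier by (intro countable_Collect_finite_subset) auto
  hence c: "countable \<Q>" by (rule countable_subset[rotated]) (auto simp: \<Q>_def)
  have "{x \<in> space M. (u, v) \<in> conn (edges E x - {e})}
      = {x \<in> space M. \<exists>Q\<in>\<Q>. \<forall>(q, t)\<in>Q. \<phi> q x \<in> E t}" (is "?L = ?R")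
  proof (intro equalityI subsetI)
    fix x assume x: "x \<in> ?L"
    hence "(u, v) \<in> conn (edges E x - {e})" by simp
    then obtain Q where "finite Q" "Q \<subseteq> edges E x - {e}" "(u, v) \<in> conn Q"
      by (rule conn_finite)
    hence "Q \<in> \<Q>" "\<forall>(q, t)\<in>Q. \<phi> q x \<in> E t" by (auto simp: \<Q>_def edges_def)
    thus "x \<in> ?R" using x by blast
  next
    fix x assume "x \<in> ?R"
    then obtain Q where x: "x \<in> space M" and Q: "Q \<in> \<Q>" "\<forall>(q, t)\<in>Q. \<phi> q x \<in> E t" by blast
    hence "Q \<subseteq> edges E x - {e}" by (auto simp: \<Q>_def edges_def)
    hence "conn Q \<subseteq> conn (edges E x - {e})" by (rule conn_mono)
    thus "x \<in> ?L" using x Q(1) by (auto simp: \<Q>_def)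
  qed
  also have "\<dots> \<in> sets M"
  proof (intro sets.sets_Collect_countable_Ex' c)
    fix Q assume "Q \<in> \<Q>"
    hence Q: "finite Q" "Q \<subseteq> carrier G \<times> carrier G" by (auto simp: \<Q>_def)
    show "{x \<in> space M. \<forall>(q, t)\<in>Q. \<phi> q x \<in> E t} \<in> sets M"
    proof (rule sets.sets_Collect_countable_All')
      fix e assume "e \<in> Q"
      then obtain q t where "e = (q, t)" "q \<in> carrier G" using Q(2) by auto
      thus "{x \<in> space M. case e of (q, t) \<Rightarrow> \<phi> q x \<in> E t} \<in> sets M"
        using act_preimage_sets[OF _ E] by simp
    qed (use Q(1) in \<open>simp add: countable_finite\<close>)
  qed
  finally show ?thesis .
qed

lemma mem_edges:
  "e \<in> edges E x \<longleftrightarrow> e \<in> carrier G \<times> carrier G \<and> \<phi> (fst e) x \<in> E (snd e)"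
  by (cases e) (simp add: edges_def)

lemma parent_sets:
  assumes E: "\<And>t. E t \<in> sets M"
  shows "{x \<in> space M. parent (edges E x) u v} \<in> sets M"
proof -
  have "parent (edges E x) u v \<longleftrightarrow> (\<exists>e\<in>carrier G \<times> carrier G. \<phi> (fst e) x \<in> E (snd e) \<and> joins e u v \<and>
      (\<exists>n. (v, enum n) \<in> conn (edges E x - {e}) \<and> (\<forall>m. m \<le> n \<longrightarrow> \<not> (u, enum m) \<in> conn (edges E x - {e}))))" for x
    by (simp only: parent_def towards_root_def Bex_def mem_edges conj_assoc)
  moreover have "{x \<in> space M. \<exists>e\<in>carrier G \<times> carrier G. \<phi> (fst e) x \<in> E (snd e) \<and> joins e u v \<and>
      (\<exists>n. (v, enum n) \<in> conn (edges E x - {e}) \<and> (\<forall>m. m \<le> n \<longrightarrow> \<not> (u, enum m) \<in> conn (edges E x - {e})))}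
    \<in> sets M"
  proof (rule sets.sets_Collect_countable_Ex')
    fix e assume e: "e \<in> carrier G \<times> carrier G"
    hence "fst e \<in> carrier G" by auto
    thus "{x \<in> space M. \<phi> (fst e) x \<in> E (snd e) \<and> joins e u v \<and>
      (\<exists>n. (v, enum n) \<in> conn (edges E x - {e}) \<and> (\<forall>m. m \<le> n \<longrightarrow> \<not> (u, enum m) \<in> conn (edges E x - {e})))}
      \<in> sets M"
      by (intro sets.sets_Collect_conj act_preimage_sets E sets.sets_Collect_const
          sets.sets_Collect_countable_Ex sets.sets_Collect_countable_All sets.sets_Collect_imp
          sets.sets_Collect_neg conn_edges_sets)
  qed (use countable_carrier in simp)
  ultimately show ?thesis by simp
qed

lemma joined_sets:
  assumes E: "\<And>t. E t \<in> sets M"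
  shows "{x \<in> space M. \<exists>e\<in>edges E x. joins e u v} \<in> sets M"
proof -
  have "(\<exists>e\<in>edges E x. joins e u v) \<longleftrightarrow>
      (\<exists>e\<in>carrier G \<times> carrier G. \<phi> (fst e) x \<in> E (snd e) \<and> joins e u v)" for x
    by (simp only: Bex_def mem_edges conj_assoc)
  moreover have "{x \<in> space M. \<exists>e\<in>carrier G \<times> carrier G. \<phi> (fst e) x \<in> E (snd e) \<and> joins e u v} \<in> sets M"
  proof (rule sets.sets_Collect_countable_Ex')
    fix e assume e: "e \<in> carrier G \<times> carrier G"
    hence "fst e \<in> carrier G" by auto
    thus "{x \<in> space M. \<phi> (fst e) x \<in> E (snd e) \<and> joins e u v} \<in> sets M"
      by (intro sets.sets_Collect_conj act_preimage_sets E sets.sets_Collect_const)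
  qed (use countable_carrier in simp)
  ultimately show ?thesis by simp
qed

end

section \<open>The random forest on the cosets as an invariant flow\<close>

context infinite_order
begin

lemma joins_translate:
  assumes "joins (q, t) u v" "g \<in> carrier G" "q \<in> carrier G" "t \<in> carrier G"
  shows "joins (q \<otimes> g, t) (u \<otimes> g) (v \<otimes> g)"
  using assms(1) conn_empty_translate[OF assms(2)] assms(2-4)
  unfolding joins_def by (auto simp: m_assoc dest: conn_empty_translate[OF assms(2)])

lemma joins_translate_iff:
  assumes "g \<in> carrier G" "q \<in> carrier G" "t \<in> carrier G" "u \<in> carrier G" "v \<in> carrier G"
  shows "joins (q \<otimes> g, t) u v \<longleftrightarrow> joins (q, t) (u \<otimes> inv g) (v \<otimes> inv g)"
proof
  assume "joins (q \<otimes> g, t) u v"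
  hence "joins (q \<otimes> g \<otimes> inv g, t) (u \<otimes> inv g) (v \<otimes> inv g)"
    by (rule joins_translate) (use assms in auto)
  thus "joins (q, t) (u \<otimes> inv g) (v \<otimes> inv g)" using assms by (simp add: m_assoc)
next
  assume "joins (q, t) (u \<otimes> inv g) (v \<otimes> inv g)"
  hence "joins (q \<otimes> g, t) (u \<otimes> inv g \<otimes> g) (v \<otimes> inv g \<otimes> g)"
    by (rule joins_translate) (use assms in auto)
  thus "joins (q \<otimes> g, t) u v" using assms by (simp add: m_assoc)
qed

lemma coset_index_enum:
  assumes "i \<in> coset_index ` carrier G"
  shows "coset_index (enum i) = i"
proof -
  obtain u where u: "u \<in> carrier G" "i = coset_index u" using assms by blast
  have "(enum i, u) \<in> conn {}" using coset_index[OF u(1)] u(2) by (simp add: conn_sym)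
  thus ?thesis using u by (simp add: coset_index_eq)
qed

end

locale coset_forest = free_pmp G a M \<phi>
  for G (structure) and a and M :: "'x measure" and \<phi> +
  fixes E :: "'a \<Rightarrow> 'x set"
  assumes E_sets [measurable]: "\<And>t. E t \<in> sets M"
    and E_forest: "\<And>x. x \<in> free_part \<Longrightarrow> forest (edges E x)"
begin

definition parent_prob :: "'a \<Rightarrow> 'a \<Rightarrow> real" where
  "parent_prob u v = prob {x \<in> free_part. parent (edges E x) u v}"

definition joined_prob :: "'a \<Rightarrow> 'a \<Rightarrow> real" where
  "joined_prob u v = prob {x \<in> free_part. \<exists>e\<in>edges E x. joins e u v}"

lemma free_part_Collect: "{x \<in> free_part. Q x} = free_part \<inter> {x \<in> space M. Q x}"
  using free_part_space by auto

lemma parent_event: "{x \<in> free_part. parent (edges E x) u v} \<in> sets M"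
  unfolding free_part_Collect using parent_sets[OF E_sets] by auto

lemma joined_event: "{x \<in> free_part. \<exists>e\<in>edges E x. joins e u v} \<in> sets M"
  unfolding free_part_Collect using joined_sets[OF E_sets] by auto

lemma parent_prob_cong:
  "\<lbrakk>(u, u') \<in> conn {}; (v, v') \<in> conn {}\<rbrakk> \<Longrightarrow> parent_prob u v = parent_prob u' v'"
  unfolding parent_prob_def using parent_cong by simp

text \<open>In a forest every edge is directed in exactly one way, so the two parent events
  partition the edge event.\<close>

lemma parent_prob_joined:
  assumes "u \<in> carrier G" "v \<in> carrier G"
  shows "parent_prob u v + parent_prob v u = joined_prob u v"
proof -
  have "{x \<in> free_part. \<exists>e\<in>edges E x. joins e u v}
      = {x \<in> free_part. parent (edges E x) u v} \<union> {x \<in> free_part. parent (edges E x) v u}"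
  proof (intro equalityI subsetI)
    fix x assume "x \<in> {x \<in> free_part. \<exists>e\<in>edges E x. joins e u v}"
    then obtain e where x: "x \<in> free_part" "e \<in> edges E x" "joins e u v" by auto
    have "parent (edges E x) u v \<or> parent (edges E x) v u"
      by (rule parent_total[OF E_forest[OF x(1)] x(2,3)]) (use assms in \<open>simp_all add: range_enum\<close>)
    thus "x \<in> {x \<in> free_part. parent (edges E x) u v} \<union> {x \<in> free_part. parent (edges E x) v u}"
      using x(1) by auto
  next
    fix x assume "x \<in> {x \<in> free_part. parent (edges E x) u v} \<union> {x \<in> free_part. parent (edges E x) v u}"
    thus "x \<in> {x \<in> free_part. \<exists>e\<in>edges E x. joins e u v}"
      unfolding parent_def by (auto simp: joins_sym[of _ v u])
  qed
  moreover have "{x \<in> free_part. parent (edges E x) u v} \<inter> {x \<in> free_part. parent (edges E x) v u} = {}"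
    using parent_antisym E_forest by blast
  ultimately show ?thesis
    unfolding parent_prob_def joined_prob_def
    using finite_measure_Union[OF parent_event[of u v] parent_event[of v u]] by simp
qed

text \<open>The action preserves the measure and right translation preserves \<open>joins\<close>.
  The same argument fails for \<open>parent_prob\<close>, since the roots refer to
  \<open>enum\<close>.\<close>

lemma joined_prob_translate:
  assumes "g \<in> carrier G" "u \<in> carrier G" "v \<in> carrier G"
  shows "joined_prob (u \<otimes> inv g) (v \<otimes> inv g) = joined_prob u v"
proof -
  have edge: "(\<exists>e\<in>edges E x. joins e u v) \<longleftrightarrow> (\<exists>e\<in>edges E (\<phi> g x). joins e (u \<otimes> inv g) (v \<otimes> inv g))"
    if x: "x \<in> space M" for x
  proof -
    have "joins ((\<lambda>(q, t). (q \<otimes> g, t)) e) u v \<longleftrightarrow> joins e (u \<otimes> inv g) (v \<otimes> inv g)"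
      if "e \<in> edges E (\<phi> g x)" for e
      using that assms joins_translate_iff by (auto simp: edges_def)
    thus ?thesis unfolding edges_translate[OF x assms(1)] by auto
  qed
  have part: "\<phi> g x \<in> free_part \<longleftrightarrow> x \<in> free_part" if "x \<in> space M" for x
    using free_part_act[OF assms(1), of x] free_part_act[of "inv g" "\<phi> g x"] act_inv[OF that assms(1)] assms(1)
    by auto
  have "{x \<in> free_part. \<exists>e\<in>edges E x. joins e u v} = {x \<in> space M. \<phi> g x \<in>
      {x \<in> free_part. \<exists>e\<in>edges E x. joins e (u \<otimes> inv g) (v \<otimes> inv g)}}"
    using edge part free_part_space by auto
  thus ?thesis
    unfolding joined_prob_def measure_def using act_preimage_measure[OF assms(1) joined_event] by simp
qed

definition flow :: "nat \<Rightarrow> nat \<Rightarrow> real" where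
  "flow i j = (if i \<in> coset_index ` carrier G \<and> j \<in> coset_index ` carrier G
     then parent_prob (enum i) (enum j) else 0)"

lemma flow_index:
  assumes "u \<in> carrier G" "v \<in> carrier G"
  shows "flow (coset_index u) (coset_index v) = parent_prob u v"
proof -
  have "parent_prob u v = parent_prob (enum (coset_index u)) (enum (coset_index v))"
    by (intro parent_prob_cong coset_index assms)
  thus ?thesis using assms by (simp add: flow_def)
qed

text \<open>Uniqueness of parents makes the events for different cosets disjoint.\<close>

lemma sum_flow_le:
  assumes "finite F"
  shows "(\<Sum>j\<in>F. flow i j) \<le> 1"
proof (cases "i \<in> coset_index ` carrier G")
  case True
  define C where "C j = {x \<in> free_part. parent (edges E x) (enum i) (enum j)}" for j
  have "disjoint_family_on C (F \<inter> coset_index ` carrier G)"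
    unfolding disjoint_family_on_def
  proof (intro ballI impI equals0I)
    fix j k x
    assume jk: "j \<in> F \<inter> coset_index ` carrier G" "k \<in> F \<inter> coset_index ` carrier G" "j \<noteq> k" "x \<in> C j \<inter> C k"
    hence "(enum j, enum k) \<in> conn {}"
      by (intro parent_unique[of "edges E x" "enum i"]) (auto simp: C_def)
    hence "coset_index (enum j) = coset_index (enum k)" by (subst coset_index_eq) auto
    thus False using jk by (simp add: coset_index_enum)
  qed
  moreover have "C j \<in> sets M" for j unfolding C_def by (rule parent_event)
  ultimately have "(\<Sum>j\<in>F \<inter> coset_index ` carrier G. prob (C j)) = prob (\<Union>j\<in>F \<inter> coset_index ` carrier G. C j)"
    using assms by (intro finite_measure_finite_Union[symmetric]) auto
  also have "\<dots> \<le> 1" by (rule prob_le_1)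
  also have "(\<Sum>j\<in>F \<inter> coset_index ` carrier G. prob (C j)) = (\<Sum>j\<in>F. flow i j)"
    using assms True by (intro sum.mono_neutral_cong_left) (auto simp: flow_def C_def parent_prob_def)
  finally show ?thesis .
qed (simp add: flow_def)

lemma flow_nonneg: "0 \<le> flow i j"
  by (simp add: flow_def parent_prob_def)

sublocale flow: invariant_flow G coset_act flow
proof
  fix i j
  show "flow i summable_on UNIV"
    using sum_flow_le by (intro nonneg_bdd_above_summable_on bdd_aboveI2[where M = 1]) (auto simp: flow_nonneg)
  thus "(\<Sum>\<^sub>\<infinity>j. flow i j) \<le> 1" using sum_flow_le by (intro infsum_le_finite_sums) auto
  fix g assume g: "g \<in> carrier G"
  show "flow (coset_act g i) (coset_act g j) + flow (coset_act g j) (coset_act g i) = flow i j + flow j i"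
  proof (cases "i \<in> coset_index ` carrier G \<and> j \<in> coset_index ` carrier G")
    case True
    then obtain u v where "u \<in> carrier G" "v \<in> carrier G" "i = coset_index u" "j = coset_index v" by blast
    thus ?thesis using g
      by (simp add: coset_act_index flow_index parent_prob_joined joined_prob_translate)
  next
    case False
    have "coset_act g k \<in> coset_index ` carrier G \<longleftrightarrow> k \<in> coset_index ` carrier G" for k
      using g by (auto simp: coset_act_def)
    with False show ?thesis by (auto simp: flow_def)
  qed
qed (simp_all add: coset_act_mult coset_act_one flow_nonneg)

lemma null_if_joined_prob_0:
  assumes "joined_prob \<one> s = 0" "s \<in> carrier G"
  shows "emeasure M (E s) = 0"
proof -
  have "E s \<inter> free_part \<subseteq> {x \<in> free_part. \<exists>e\<in>edges E x. joins e \<one> s}"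
  proof
    fix x assume x: "x \<in> E s \<inter> free_part"
    hence "\<phi> \<one> x \<in> E s" using free_part_space by (simp add: act_one)
    hence "(\<one>, s) \<in> edges E x" using assms(2) by (simp add: edges_def)
    moreover have "joins (\<one>, s) \<one> s" using assms(2) by (simp add: joins_def)
    ultimately show "x \<in> {x \<in> free_part. \<exists>e\<in>edges E x. joins e \<one> s}" using x by blast
  qed
  hence "emeasure M (E s \<inter> free_part) \<le> emeasure M {x \<in> free_part. \<exists>e\<in>edges E x. joins e \<one> s}"
    by (rule emeasure_mono) (rule joined_event)
  also have "\<dots> = 0" using assms(1) by (simp add: joined_prob_def emeasure_eq_measure)
  finally show ?thesis by (simp add: emeasure_free_part E_sets)
qed

text \<open>By \<open>nc\<close>, conjugation by \<open>s\<close> takes no positive power of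
  \<open>a\<close> into the group generated by \<open>a\<close>. Powers of \<open>a\<close> fix the
  coset of \<open>\<one>\<close>, the conjugates \<open>l n\<close> fix the coset of
  \<open>s\<close>, and each family has an infinite orbit on the other coset, so that
  \<open>flow_balanced\<close> applies.\<close>

lemma null_if_not_commensurated:
  assumes unit: "unitarizable TYPE(nat \<Rightarrow> complex) G"
    and s: "s \<in> carrier G" and nc: "\<And>n::nat. n > 0 \<Longrightarrow> (s, s \<otimes> a [^] n) \<notin> conn {}"
  shows "emeasure M (E s) = 0"
proof -
  define l where "l n = inv s \<otimes> a [^] n \<otimes> s" for n :: nat
  have l: "l n \<in> carrier G" "inv (l n) = inv s \<otimes> inv (a [^] n) \<otimes> s" for n
    using s by (simp_all add: l_def inv_mult_group m_assoc)
  have "flow (coset_index \<one>) (coset_index s) + flow (coset_index s) (coset_index \<one>) = 0"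
  proof (rule flow.flow_balanced[OF unit])
    show "a [^] n \<in> carrier G" "l n \<in> carrier G" for n :: nat by (simp_all add: l)
    show "coset_act (a [^] n) (coset_index \<one>) = coset_index \<one>" for n :: nat
    proof -
      have "(inv (a [^] n), a [^] n \<otimes> inv (a [^] n)) \<in> conn {}" by (rule conn_empty_pow) simp
      thus ?thesis by (simp add: coset_act_index coset_index_eq)
    qed
    show "coset_act (l n) (coset_index s) = coset_index s" for n :: nat
    proof -
      have "(inv (a [^] n) \<otimes> s, a [^] n \<otimes> (inv (a [^] n) \<otimes> s)) \<in> conn {}"
        using s by (intro conn_empty_pow) simp
      thus ?thesis using s l by (simp add: coset_act_index coset_index_eq m_assoc[symmetric])
    qed
    have cancel_s: "s \<otimes> (inv s \<otimes> x) = x" if "x \<in> carrier G" for x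
      using s that by (simp flip: m_assoc)
    have cancel: "inv (a [^] m) \<otimes> a [^] n = a [^] (n - m)" if "m < n" for m n :: nat
      using that nat_pow_mult[OF a, of m "n - m"] by (simp add: inv_solve_left')
    show "inj (\<lambda>n::nat. coset_act (a [^] n) (coset_index s))"
    proof (rule linorder_injI)
      fix m n :: nat assume "m < n"
      show "coset_act (a [^] m) (coset_index s) \<noteq> coset_act (a [^] n) (coset_index s)"
      proof
        assume "coset_act (a [^] m) (coset_index s) = coset_act (a [^] n) (coset_index s)"
        hence "(s \<otimes> inv (a [^] m), s \<otimes> inv (a [^] n)) \<in> conn {}"
          using s by (simp add: coset_act_index coset_index_eq)
        hence "(s \<otimes> inv (a [^] m) \<otimes> a [^] n, s \<otimes> inv (a [^] n) \<otimes> a [^] n) \<in> conn {}"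
          by (rule conn_empty_translate[rotated]) simp
        hence "(s \<otimes> a [^] (n - m), s) \<in> conn {}"
          using s cancel[OF \<open>m < n\<close>] by (simp add: m_assoc)
        with nc[of "n - m"] \<open>m < n\<close> show False by (simp add: conn_sym)
      qed
    qed
    show "inj (\<lambda>n. coset_act (l n) (coset_index \<one>))"
    proof (rule linorder_injI)
      fix m n :: nat assume "m < n"
      show "coset_act (l m) (coset_index \<one>) \<noteq> coset_act (l n) (coset_index \<one>)"
      proof
        assume "coset_act (l m) (coset_index \<one>) = coset_act (l n) (coset_index \<one>)"
        hence "(inv (l m), inv (l n)) \<in> conn {}"
          using l(1) by (simp add: coset_act_index coset_index_eq)
        hence "(inv (l m) \<otimes> l n, inv (l n) \<otimes> l n) \<in> conn {}"
          using l(1) by (intro conn_empty_translate)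
        moreover have "inv (l m) \<otimes> l n = inv s \<otimes> a [^] (n - m) \<otimes> s"
        proof -
          have "inv (l m) \<otimes> l n = inv s \<otimes> (inv (a [^] m) \<otimes> a [^] n) \<otimes> s"
            unfolding l(2) unfolding l_def using s by (simp add: m_assoc cancel_s)
          thus ?thesis by (simp only: cancel[OF \<open>m < n\<close>])
        qed
        ultimately have "(\<one>, inv s \<otimes> a [^] (n - m) \<otimes> s) \<in> conn {}"
          using l(1) by (simp add: conn_sym)
        \<comment> \<open>The conjugate is a power of \<open>a\<close> or the inverse of one. Then
          \<open>nc\<close> forces the exponent \<open>k\<close> to be 0, hence
          \<open>a [^] (n - m) = \<one>\<close>.\<close>
        then consider k :: nat where "inv s \<otimes> a [^] (n - m) \<otimes> s = a [^] k"
          | k :: nat where "\<one> = a [^] k \<otimes> (inv s \<otimes> a [^] (n - m) \<otimes> s)"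
          by (rule conn_empty_cases) auto
        then obtain k :: nat where k: "s \<otimes> a [^] k = a [^] (n - m) \<otimes> s \<or> a [^] (n - m) \<otimes> (s \<otimes> a [^] k) = s"
        proof cases
          case (1 k)
          have "s \<otimes> a [^] k = s \<otimes> (inv s \<otimes> a [^] (n - m) \<otimes> s)" by (simp only: 1)
          also have "\<dots> = a [^] (n - m) \<otimes> s" using s by (simp add: m_assoc cancel_s)
          finally show ?thesis using that by blast
        next
          case (2 k)
          have "inv s \<otimes> (a [^] (n - m) \<otimes> (s \<otimes> a [^] k)) = inv s \<otimes> a [^] (n - m) \<otimes> s \<otimes> a [^] k"
            using s by (simp add: m_assoc)
          also have "\<dots> = \<one>"
            by (rule inv_comm[OF 2[symmetric]]) (use s in auto)
          finally have "a [^] (n - m) \<otimes> (s \<otimes> a [^] k) = s \<otimes> \<one>"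
            using s by (subst (asm) inv_solve_left') auto
          hence "a [^] (n - m) \<otimes> (s \<otimes> a [^] k) = s" using s by simp
          thus ?thesis using that by blast
        qed
        have conn: "(s, s \<otimes> a [^] k) \<in> conn {}"
          using k conn_empty_pow[of s "n - m"] conn_empty_pow[of "s \<otimes> a [^] k" "n - m"] s
          by (auto simp: conn_sym)
        have "k = 0" using nc[of k] conn by blast
        hence "a [^] (n - m) \<otimes> s = s" using k s by auto
        hence "a [^] (n - m) = \<one>" using s by simp
        with a_pow[of "n - m"] \<open>m < n\<close> show False by simp
      qed
    qed
  qed
  hence "joined_prob \<one> s = 0" using s by (simp add: flow_index parent_prob_joined)
  thus ?thesis using s by (rule null_if_joined_prob_0)
qed

text \<open>Edges with label \<open>s\<close> at \<open>\<one>\<close> and at \<open>a^(n j)\<close>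
  join the same two cosets, and a forest contains at most one of them. So a free point of
  \<open>E s\<close> is never moved back into \<open>E s\<close> by \<open>a^(n j)\<close> with
  \<open>j > 0\<close>, and the sets \<open>F j\<close> are disjoint and of equal measure.\<close>

lemma null_if_commensurated:
  assumes s: "s \<in> carrier G" and n: "n > (0::nat)" "(s, s \<otimes> a [^] n) \<in> conn {}"
  shows "emeasure M (E s) = 0"
proof -
  have conn: "(s, s \<otimes> a [^] (n * j)) \<in> conn {}" for j :: nat
  proof (induction j)
    case (Suc j)
    have "(s \<otimes> a [^] (n * j), s \<otimes> a [^] n \<otimes> a [^] (n * j)) \<in> conn {}"
      using n(2) by (rule conn_empty_translate[rotated]) simp
    moreover have "s \<otimes> a [^] n \<otimes> a [^] (n * j) = s \<otimes> a [^] (n * Suc j)"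
      using s a by (simp add: m_assoc nat_pow_mult)
    ultimately show ?case using Suc by (auto intro: conn_trans)
  qed (use s in simp)
  define F where "F j = {x \<in> space M. \<phi> (a [^] (n * j)) x \<in> E s \<inter> free_part}" for j
  have F: "F j \<in> sets M" "emeasure M (F j) = emeasure M (E s)" for j
    unfolding F_def using act_preimage_sets act_preimage_measure[of _ "E s \<inter> free_part"]
    by (auto simp: emeasure_free_part E_sets)
  have once: "\<phi> (a [^] (n * j)) x \<notin> E s" if x: "x \<in> E s \<inter> free_part" and j: "j > 0" for x j
  proof
    assume "\<phi> (a [^] (n * j)) x \<in> E s"
    hence "(a [^] (n * j), s) \<in> edges E x" using s by (simp add: edges_def)
    moreover have one: "(\<one>, s) \<in> edges E x"
      using x s free_part_space by (simp add: edges_def act_one)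
    moreover have "a [^] (n * j) \<noteq> \<one>" using a_pow[of "n * j"] n(1) j by simp
    ultimately have e: "(a [^] (n * j), s) \<in> edges E x - {(\<one>, s)}" by simp
    \<comment> \<open>The detour from \<open>\<one>\<close> to \<open>s\<close>: along the first
      coset, across the edge at \<open>a^(n j)\<close>, and back along the second coset.\<close>
    have "(\<one>, a [^] (n * j)) \<in> conn (edges E x - {(\<one>, s)})"
      using conn_emptyD[OF conn_empty_pow[OF one_closed]] by simp
    moreover have "(a [^] (n * j), s \<otimes> a [^] (n * j)) \<in> conn (edges E x - {(\<one>, s)})"
      using conn_edge[OF e] by simp
    moreover have "(s \<otimes> a [^] (n * j), s) \<in> conn (edges E x - {(\<one>, s)})"
      by (rule conn_emptyD[OF conn_sym[OF conn]])
    ultimately have "(\<one>, s) \<in> conn (edges E x - {(\<one>, s)})" by (rule conn_trans[OF conn_trans])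
    moreover have "forest (edges E x)" using x by (intro E_forest) simp
    ultimately show False using one s unfolding forest_def by fastforce
  qed
  have disj: "F i \<inter> F j = {}" if "i < j" for i j
  proof (rule equals0I)
    fix x assume "x \<in> F i \<inter> F j"
    hence x: "x \<in> space M" "\<phi> (a [^] (n * i)) x \<in> E s \<inter> free_part" "\<phi> (a [^] (n * j)) x \<in> E s"
      by (auto simp: F_def)
    have "a [^] (n * (j - i)) \<otimes> a [^] (n * i) = a [^] (n * j)"
      using a that by (simp add: nat_pow_mult flip: distrib_left)
    hence "\<phi> (a [^] (n * (j - i))) (\<phi> (a [^] (n * i)) x) = \<phi> (a [^] (n * j)) x"
      using x(1) by (simp flip: act_mult)
    with once[OF x(2), of "j - i"] x(3) that show False by simp
  qed
  hence "disjoint_family F" by (auto simp: disjoint_family_on_def) (metis disj disjoint_iff nat_neq_iff)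
  hence "(\<Sum>j<N. prob (F j)) = prob (\<Union>j<N. F j)" for N
    by (intro finite_measure_finite_Union[symmetric]) (auto simp: F disjoint_family_on_def)
  hence "(\<Sum>j<N. prob (F j)) \<le> 1" for N by simp
  moreover have "prob (F j) = prob (E s)" for j by (simp add: measure_def F)
  ultimately have le: "real N * prob (E s) \<le> 1" for N by simp
  have "prob (E s) = 0"
  proof (rule ccontr)
    assume "prob (E s) \<noteq> 0"
    hence pos: "prob (E s) > 0" by (simp add: zero_less_measure_iff)
    obtain N :: nat where "1 / prob (E s) < N" using reals_Archimedean2 by blast
    with le[of N] pos show False by (simp add: field_simps)
  qed
  thus ?thesis by (simp add: emeasure_eq_measure)
qed

lemma null_edges:
  assumes "unitarizable TYPE(nat \<Rightarrow> complex) G" "s \<in> carrier G"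
  shows "emeasure M (E s) = 0"
  using null_if_not_commensurated[OF assms] null_if_commensurated[OF assms(2)] by blast

end

section \<open>Decreasing generating edge sets with an acyclic limit\<close>

section \<open>Pruning the cycles of a graphing\<close>

context free_pmp
begin

text \<open>One separating family is fixed, so that its indices can be part of the pruning
  codes.\<close>

definition sep :: "nat \<Rightarrow> 'x set" where
  "sep = (SOME U. (\<forall>n. U n \<in> sets M) \<and>
    (\<forall>y F. y \<in> space M \<longrightarrow> finite F \<longrightarrow> F \<subseteq> space M \<longrightarrow> y \<notin> F \<longrightarrow> (\<exists>n. y \<in> U n \<and> U n \<inter> F = {})))"

lemma sep:
  shows sep_sets [measurable]: "sep n \<in> sets M"
    and sep_separates: "\<lbrakk>y \<in> space M; finite F; F \<subseteq> space M; y \<notin> F\<rbrakk> \<Longrightarrow> \<exists>n. y \<in> sep n \<and> sep n \<inter> F = {}"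
proof -
  have "standard_borel M" using standard by (simp add: standard_prob_space_def)
  hence "\<exists>U :: nat \<Rightarrow> _. (\<forall>n. U n \<in> sets M) \<and>
    (\<forall>y F. y \<in> space M \<longrightarrow> finite F \<longrightarrow> F \<subseteq> space M \<longrightarrow> y \<notin> F \<longrightarrow> (\<exists>n. y \<in> U n \<and> U n \<inter> F = {}))"
  proof (rule standard_borel_separating)
    fix U :: "nat \<Rightarrow> 'x set"
    assume U: "\<And>n. U n \<in> sets M"
      "\<And>y F. \<lbrakk>y \<in> space M; finite F; F \<subseteq> space M; y \<notin> F\<rbrakk> \<Longrightarrow> \<exists>n. y \<in> U n \<and> U n \<inter> F = {}"
    show ?thesis by (rule exI[of _ U]) (simp add: U)
  qed
  from someI_ex[OF this, folded sep_def]
  show "sep n \<in> sets M"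
    "\<lbrakk>y \<in> space M; finite F; F \<subseteq> space M; y \<notin> F\<rbrakk> \<Longrightarrow> \<exists>n. y \<in> sep n \<and> sep n \<inter> F = {}" by auto
qed

text \<open>
  \<open>Q\<close> contains a path from \<open>\<one>\<close> to \<open>s\<close> which does not use the edge \<open>(\<one>, s)\<close>.  The points of \<open>U\<close> at
  which \<open>Q\<close> is present lose their edge with label \<open>s\<close>; the condition on \<open>U\<close> guarantees that the
  path itself is not affected.
\<close>

definition prune :: "'a \<times> ('a \<times> 'a) set \<times> nat \<Rightarrow> ('a \<Rightarrow> 'x set) \<Rightarrow> 'a \<Rightarrow> 'x set" where
  "prune = (\<lambda>(s, Q, n) E t. if t = s \<and> (\<one>, s) \<notin> Q \<and> (\<one>, s) \<in> conn Q
     then E s - {x \<in> space M. x \<in> sep n \<and> (\<forall>e\<in>Q. \<phi> (fst e) x \<in> E (snd e) - (if snd e = s then sep n else {}))}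
     else E t)"

definition codes :: "('a \<times> ('a \<times> 'a) set \<times> nat) set" where
  "codes = carrier G \<times> {Q. finite Q \<and> Q \<subseteq> carrier G \<times> carrier G} \<times> UNIV"

lemma prune_subset: "prune c E t \<subseteq> E t"
  by (cases c) (auto simp: prune_def)

lemma prune_sets:
  assumes "c \<in> codes" "\<And>t. E t \<in> sets M"
  shows "prune c E t \<in> sets M"
proof -
  obtain s Q n where c: "c = (s, Q, n)" by (cases c) auto
  have "{x \<in> space M. x \<in> sep n \<and> (\<forall>e\<in>Q. \<phi> (fst e) x \<in> E (snd e) - (if snd e = s then sep n else {}))} \<in> sets M"
  proof (intro sets.sets_Collect_conj sets.sets_Collect_countable_All')
    show "{x \<in> space M. x \<in> sep n} \<in> sets M" by measurable
    show "countable Q" using assms(1) by (auto simp: codes_def c countable_finite)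
    fix e assume "e \<in> Q"
    hence "fst e \<in> carrier G" using assms(1) by (auto simp: codes_def c)
    thus "{x \<in> space M. \<phi> (fst e) x \<in> E (snd e) - (if snd e = s then sep n else {})} \<in> sets M"
      by (rule act_preimage_sets) (use assms(2) in auto)
  qed
  thus ?thesis using assms(2) by (auto simp: prune_def c)
qed

text \<open>All deletions of one stage concern edges with label \<open>s\<close> at points of
  \<open>sep n\<close>, while the edges of the detour with label \<open>s\<close> sit outside
  \<open>sep n\<close>. So the detour survives, and right translation carries it to the place of the
  deleted edge.\<close>

lemma prune_conn:
  assumes c: "c \<in> codes" and x: "x \<in> space M" and uv: "(u, v) \<in> conn (edges E x)"
  shows "(u, v) \<in> conn (edges (prune c E) x)"
proof -
  obtain s Q n where c': "c = (s, Q, n)" by (cases c) auto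
  have s: "s \<in> carrier G" and Q: "Q \<subseteq> carrier G \<times> carrier G" using c by (auto simp: codes_def c')
  have kept: "(fst e, (\<lambda>(q, t). t \<otimes> q) e) \<in> conn (edges (prune c E) x)" if e: "e \<in> edges E x" for e
  proof (cases "e \<in> edges (prune c E) x")
    case True
    thus ?thesis by (rule conn_edge)
  next
    case False
    obtain q t where qt: "e = (q, t)" "q \<in> carrier G" "t \<in> carrier G" "\<phi> q x \<in> E t" "\<phi> q x \<notin> prune c E t"
      using e False by (auto simp: edges_def)
    define y where "y = \<phi> q x"
    have y: "y \<in> space M" using x qt by (simp add: y_def act_closed)
    have *: "t = s" "(\<one>, s) \<in> conn Q"
      "\<And>e. e \<in> Q \<Longrightarrow> \<phi> (fst e) y \<in> E (snd e) - (if snd e = s then sep n else {})"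
      using qt(4,5) by (auto simp: prune_def c' y_def split: if_splits)
    have "Q \<subseteq> edges (prune c E) y"
    proof
      fix e assume "e \<in> Q"
      with *(3)[OF this] Q show "e \<in> edges (prune c E) y"
        by (auto simp: mem_edges prune_def c' split: if_splits)
    qed
    hence "(\<one>, s) \<in> conn (edges (prune c E) y)" using *(2) conn_mono by blast
    from conn_translate[OF this qt(2) edges_subset]
    show ?thesis
      using s qt(2) unfolding y_def edges_translate[OF x qt(2), symmetric] by (simp add: qt(1) *(1))
  qed
  show ?thesis
    using uv
  proof (induction rule: conn_induct)
    case (base x y)
    show ?case by (rule conn_trans[OF base.IH conn_base[OF base.hyps(2)]])
  next
    case (base' x y)
    show ?case by (rule conn_trans[OF base'.IH conn_sym[OF conn_base[OF base'.hyps(2)]]])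
  next
    case (edge e')
    show ?case by (rule conn_trans[OF edge.IH kept[OF \<open>e' \<in> edges E x\<close>]])
  next
    case (edge' e')
    show ?case by (rule conn_trans[OF edge'.IH conn_sym[OF kept[OF \<open>e' \<in> edges E x\<close>]]])
  qed simp
qed

primrec pruned :: "'a set \<Rightarrow> nat \<Rightarrow> 'a \<Rightarrow> 'x set" where
  "pruned S 0 = (\<lambda>t. if t \<in> S then space M else {})"
| "pruned S (Suc i) = prune (from_nat_into codes i) (pruned S i)"

lemma countable_codes: "countable codes"
  unfolding codes_def
  using countable_carrier by (intro countable_SIGMA countable_Collect_finite_subset) auto

lemma range_codes: "range (from_nat_into codes) = codes"
proof (rule range_from_nat_into[OF _ countable_codes])
  have "(\<one>, {}, 0) \<in> codes" by (simp add: codes_def)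
  thus "codes \<noteq> {}" by blast
qed

lemma from_nat_into_codes: "from_nat_into codes i \<in> codes"
  using range_codes by blast

lemma pruned_sets: "pruned S i t \<in> sets M"
  by (induction i arbitrary: t) (auto intro: prune_sets from_nat_into_codes)

lemma pruned_decseq: "decseq (\<lambda>i. pruned S i t)"
  by (rule decseq_SucI) (simp add: prune_subset)

lemma pruned_conn:
  assumes S: "S \<subseteq> carrier G" "generate G S = carrier G" and x: "x \<in> space M" and g: "g \<in> carrier G"
  shows "(\<one>, g) \<in> conn (edges (pruned S i) x)"
proof (induction i)
  case 0
  have edge: "(q, t \<otimes> q) \<in> conn (edges (pruned S 0) x)" if "t \<in> S" "q \<in> carrier G" for q t
  proof -
    have "(q, t) \<in> edges (pruned S 0) x" using that S(1) x by (auto simp: mem_edges act_closed)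
    from conn_edge[OF this] show ?thesis by simp
  qed
  have "g \<in> generate G S" using S(2) g by simp
  hence "\<forall>q\<in>carrier G. (q, g \<otimes> q) \<in> conn (edges (pruned S 0) x)"
  proof (induction rule: generate.induct)
    case (inv t)
    show ?case
    proof
      fix q assume q: "q \<in> carrier G"
      have "t \<in> carrier G" using inv S(1) by blast
      hence "(inv t \<otimes> q, t \<otimes> (inv t \<otimes> q)) \<in> conn (edges (pruned S 0) x)"
        using inv q by (intro edge) auto
      moreover have "t \<otimes> (inv t \<otimes> q) = q" using \<open>t \<in> carrier G\<close> q by (simp flip: m_assoc)
      ultimately show "(q, inv t \<otimes> q) \<in> conn (edges (pruned S 0) x)" by (simp add: conn_sym)
    qed
  next
    case (eng h1 h2)
    have h: "h1 \<in> carrier G" "h2 \<in> carrier G" using eng(1,2) S(2) by auto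
    show ?case
    proof
      fix q assume q: "q \<in> carrier G"
      have "(q, h2 \<otimes> q) \<in> conn (edges (pruned S 0) x)" using eng.IH(2) q by blast
      moreover have "(h2 \<otimes> q, h1 \<otimes> (h2 \<otimes> q)) \<in> conn (edges (pruned S 0) x)"
        using eng.IH(1) q h by blast
      ultimately show "(q, h1 \<otimes> h2 \<otimes> q) \<in> conn (edges (pruned S 0) x)"
        using conn_trans h q by (simp add: m_assoc)
    qed
  qed (use edge in auto)
  hence "(\<one>, g \<otimes> \<one>) \<in> conn (edges (pruned S 0) x)" by (rule bspec) simp
  thus ?case using g by simp
next
  case (Suc i)
  thus ?case using prune_conn[OF from_nat_into_codes x] by simp
qed

text \<open>A cycle in the limit is translated so that its edge \<open>s\<close> starts at
  \<open>\<one>\<close>, at the point \<open>y\<close>. By freeness the detour \<open>Q\<close> uses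
  label \<open>s\<close> only at points other than \<open>y\<close>; some \<open>sep n\<close>
  contains \<open>y\<close> and none of these. The code \<open>(s, Q, n)\<close> then deletes the
  edge: its single visit is enough because \<open>Q\<close>, present in the limit, was present at
  every stage.\<close>

lemma pruned_forest:
  assumes S: "S \<subseteq> carrier G" and x: "x \<in> free_part"
  shows "forest (edges (\<lambda>t. \<Inter>i. pruned S i t) x)"
  unfolding forest_def
proof (intro ballI notI)
  let ?E = "\<lambda>t. \<Inter>i. pruned S i t"
  fix e assume e: "e \<in> edges ?E x" and cyc: "(fst e, case e of (q, t) \<Rightarrow> t \<otimes> q) \<in> conn (edges ?E x - {e})"
  obtain q s where qs: "e = (q, s)" "q \<in> carrier G" "s \<in> carrier G" "\<phi> q x \<in> ?E s"
    using e by (auto simp: edges_def)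
  define y where "y = \<phi> q x"
  have y: "y \<in> free_part" "y \<in> space M" using free_part_act[OF qs(2) x] free_part_space by (auto simp: y_def)
  have xy: "\<phi> (inv q) y = x" using act_inv[OF free_part_space[OF x] qs(2)] by (simp add: y_def)
  have translated: "(q \<otimes> inv q, s \<otimes> q \<otimes> inv q) \<in> conn ((\<lambda>(q', t). (q' \<otimes> inv q, t)) ` (edges ?E x - {e}))"
    using cyc edges_subset[of ?E x] qs by (intro conn_translate) auto
  have "(\<lambda>(q', t). (q' \<otimes> inv q, t)) ` (edges ?E x - {e}) \<subseteq> edges ?E y - {(\<one>, s)}"
  proof
    fix e' assume "e' \<in> (\<lambda>(q', t). (q' \<otimes> inv q, t)) ` (edges ?E x - {e})"
    then obtain q' t where e': "e' = (q' \<otimes> inv q, t)" "(q', t) \<in> edges ?E x" "(q', t) \<noteq> (q, s)"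
      using qs(1) by auto
    have "e' \<in> edges ?E y"
      unfolding edges_translate[OF y(2) inv_closed[OF qs(2)]] xy using e' by force
    moreover have "e' \<noteq> (\<one>, s)"
    proof
      assume "e' = (\<one>, s)"
      hence "q' \<otimes> inv q = \<one>" "t = s" using e'(1) by auto
      moreover have "q' \<in> carrier G" using e'(2) by (auto simp: edges_def)
      ultimately have "q' = q" using qs(2) by (simp add: inv_solve_right')
      with \<open>t = s\<close> e'(3) show False by simp
    qed
    ultimately show "e' \<in> edges ?E y - {(\<one>, s)}" by blast
  qed
  from subsetD[OF conn_mono[OF this] translated] qs
  have "(\<one>, s) \<in> conn (edges ?E y - {(\<one>, s)})" by (simp add: m_assoc)
  then obtain Q where Q: "finite Q" "Q \<subseteq> edges ?E y - {(\<one>, s)}" "(\<one>, s) \<in> conn Q"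
    by (rule conn_finite)
  define F where "F = (\<lambda>e. \<phi> (fst e) y) ` {e \<in> Q. snd e = s}"
  have "y \<notin> F"
  proof
    assume "y \<in> F"
    then obtain q' where q': "(q', s) \<in> Q" "\<phi> q' y = y" by (auto simp: F_def)
    moreover have "q' \<in> carrier G" using q'(1) Q(2) by (auto simp: edges_def)
    ultimately have "q' = \<one>" using free_part_free y(1) by blast
    with q'(1) Q(2) show False by blast
  qed
  moreover have "finite F" "F \<subseteq> space M"
    using Q(1,2) y(2) by (auto simp: F_def edges_def act_closed)
  ultimately obtain n where n: "y \<in> sep n" "sep n \<inter> F = {}"
    using sep_separates[OF y(2)] by blast
  have c: "(s, Q, n) \<in> codes" using Q(1,2) edges_subset[of ?E y] qs(3) by (auto simp: codes_def)
  then obtain i where i: "from_nat_into codes i = (s, Q, n)" using range_codes by (metis rangeE)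
  have "\<phi> (fst e) y \<in> pruned S i (snd e) - (if snd e = s then sep n else {})" if "e \<in> Q" for e
  proof -
    have "e \<in> edges ?E y" using that Q(2) by blast
    hence "\<phi> (fst e) y \<in> pruned S i (snd e)" by (auto simp: mem_edges)
    moreover have "\<phi> (fst e) y \<notin> sep n" if "snd e = s"
      using \<open>e \<in> Q\<close> that n(2) by (auto simp: F_def)
    ultimately show ?thesis by simp
  qed
  hence "y \<notin> prune (s, Q, n) (pruned S i) s"
    using Q(2,3) n(1) y(2) by (auto simp: prune_def)
  hence "y \<notin> pruned S (Suc i) s" by (simp add: i)
  moreover have "y \<in> pruned S (Suc i) s" using qs(4) unfolding y_def by blast
  ultimately show False ..
qed

section \<open>Graphings by partial translations and the upper bound for the cost\<close>

lemma act_image: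
  assumes "g \<in> carrier G" "B \<subseteq> space M"
  shows "\<phi> g ` B = {x \<in> space M. \<phi> (inv g) x \<in> B}"
proof (intro equalityI subsetI)
  fix x assume "x \<in> \<phi> g ` B"
  then obtain y where "y \<in> B" "x = \<phi> g y" by blast
  thus "x \<in> {x \<in> space M. \<phi> (inv g) x \<in> B}"
    using assms act_inv[of y g] act_closed[of g y] by auto
next
  fix x assume x: "x \<in> {x \<in> space M. \<phi> (inv g) x \<in> B}"
  hence "x = \<phi> g (\<phi> (inv g) x)" using assms(1) act_inv[of x "inv g"] by simp
  thus "x \<in> \<phi> g ` B" using x by blast
qed

lemma borel_isomorphism_act:
  assumes g: "g \<in> carrier G" and B: "B \<in> sets M"
  shows "borel_isomorphism M B (\<phi> g ` B) (\<phi> g)"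
proof -
  have sub: "B \<subseteq> space M" using B by (rule sets.sets_into_space)
  have image: "\<phi> g ` B \<in> sets M"
    unfolding act_image[OF g sub] using g B by (intro act_preimage_sets) auto
  have inj: "inj_on (\<phi> g) B" using act.inj_prop[OF g] sub by (rule inj_on_subset)
  have inv_into: "inv_into B (\<phi> g) y = \<phi> (inv g) y" if y: "y \<in> \<phi> g ` B" for y
  proof -
    obtain x where x: "x \<in> B" "y = \<phi> g x" using y by blast
    have "inv_into B (\<phi> g) y = x" using inv_into_f_f[OF inj x(1)] x(2) by simp
    moreover have "\<phi> (inv g) y = x" using act_inv[OF _ g] x sub by auto
    ultimately show ?thesis by simp
  qed
  have space: "space (restrict_space M B) = B" "space (restrict_space M (\<phi> g ` B)) = \<phi> g ` B"
    using B image sets.sets_into_space by (auto simp: space_restrict_space)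
  have "\<phi> g \<in> measurable (restrict_space M B) (restrict_space M (\<phi> g ` B))"
    by (intro measurable_restrict_space2 measurable_restrict_space1 act_measurable g) (auto simp: space)
  moreover have "inv_into B (\<phi> g) \<in> measurable (restrict_space M (\<phi> g ` B)) (restrict_space M B)"
  proof (subst measurable_cong)
    show "inv_into B (\<phi> g) y = \<phi> (inv g) y" if "y \<in> space (restrict_space M (\<phi> g ` B))" for y
      using that inv_into by (simp add: space)
    show "\<phi> (inv g) \<in> measurable (restrict_space M (\<phi> g ` B)) (restrict_space M B)"
      using g act_inv sub
      by (intro measurable_restrict_space2 measurable_restrict_space1 act_measurable) (auto simp: space)
  qed
  ultimately show ?thesis
    using B image inj by (simp add: borel_isomorphism_def bij_betw_def)
qed

lemma orbit_rel_iff: "(x, y) \<in> orbit_rel G M \<phi> \<longleftrightarrow> x \<in> space M \<and> (\<exists>g\<in>carrier G. y = \<phi> g x)"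
  by (auto simp: orbit_rel_def orbit_def)

lemma equiv_orbit_rel:
  assumes "X \<subseteq> space M"
  shows "equiv X (orbit_rel G M \<phi> \<inter> X \<times> X)"
proof (rule equivI)
  show "refl_on X (orbit_rel G M \<phi> \<inter> X \<times> X)"
    using assms act_one by (intro refl_onI) (force simp: orbit_rel_iff)
  show "sym (orbit_rel G M \<phi> \<inter> X \<times> X)"
  proof (rule symI)
    fix x y assume "(x, y) \<in> orbit_rel G M \<phi> \<inter> X \<times> X"
    then obtain g where g: "g \<in> carrier G" "y = \<phi> g x" "x \<in> X" "y \<in> X" "x \<in> space M"
      by (auto simp: orbit_rel_iff)
    hence "x = \<phi> (inv g) y" by (simp add: act_inv)
    thus "(y, x) \<in> orbit_rel G M \<phi> \<inter> X \<times> X" using g assms by (auto simp: orbit_rel_iff)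
  qed
  show "trans (orbit_rel G M \<phi> \<inter> X \<times> X)"
  proof (rule transI)
    fix x y z
    assume "(x, y) \<in> orbit_rel G M \<phi> \<inter> X \<times> X" "(y, z) \<in> orbit_rel G M \<phi> \<inter> X \<times> X"
    then obtain g h where gh: "g \<in> carrier G" "y = \<phi> g x" "h \<in> carrier G" "z = \<phi> h y"
      "x \<in> X" "z \<in> X" "x \<in> space M" by (auto simp: orbit_rel_iff)
    hence "z = \<phi> (h \<otimes> g) x" by (simp add: act_mult)
    thus "(x, z) \<in> orbit_rel G M \<phi> \<inter> X \<times> X" using gh by (auto simp: orbit_rel_iff)
  qed
qed auto

text \<open>Index 0 holds the translation by \<open>a\<close> on the whole space, which provides the
  \<open>base\<close> links and the summand 1. One partial translation for each element of
  \<open>S\<close> follows, and all later domains are empty. Paths in the group become chains inside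
  the invariant \<open>free_part\<close>.\<close>

lemma cost_le_edges:
  assumes S: "finite S" "S \<subseteq> carrier G"
    and E: "\<And>t. E t \<in> sets M" "\<And>t. t \<notin> S \<Longrightarrow> E t = {}"
    and conn: "\<And>x g. \<lbrakk>x \<in> space M; g \<in> carrier G\<rbrakk> \<Longrightarrow> (\<one>, g) \<in> conn (edges E x)"
  shows "cost M (orbit_rel G M \<phi>) \<le> 1 + (\<Sum>t\<in>S. emeasure M (E t))"
proof -
  obtain ts where ts: "set ts = S" "distinct ts" using finite_distinct_list[OF S(1)] by blast
  define el where "el i = (case i of 0 \<Rightarrow> a | Suc j \<Rightarrow> if j < length ts then ts ! j else a)" for i
  define A where "A i = (case i of 0 \<Rightarrow> space M | Suc j \<Rightarrow> if j < length ts then E (ts ! j) else {})" for i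
  have el: "el i \<in> carrier G" for i
    using a S(2) ts(1) by (auto simp: el_def split: nat.split)
  have A: "A i \<in> sets M" for i using E(1) by (auto simp: A_def split: nat.split)
  have A_space: "A i \<subseteq> space M" for i using A by (rule sets.sets_into_space)
  have "graphing M (orbit_rel G M \<phi>) A (\<lambda>i. \<phi> (el i) ` A i) (\<lambda>i. \<phi> (el i))"
    unfolding graphing_def Let_def
  proof (intro conjI allI bexI)
    fix i
    show "borel_isomorphism M (A i) (\<phi> (el i) ` A i) (\<phi> (el i))"
      by (rule borel_isomorphism_act[OF el A])
    show "AE x in M. x \<in> A i \<longrightarrow> (x, \<phi> (el i) x) \<in> orbit_rel G M \<phi>"
      using A_space el by (intro AE_I2) (auto simp: orbit_rel_iff)
  next
    let ?X = "space M - (space M - free_part)"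
    have X: "?X = free_part" using free_part_space by blast
    let ?L = "{(x, \<phi> (el i) x) |i x. x \<in> A i} \<inter> free_part \<times> free_part"
    have "smallest_equiv free_part ?L = orbit_rel G M \<phi> \<inter> free_part \<times> free_part"
    proof (rule equalityI)
      have "?L \<subseteq> orbit_rel G M \<phi> \<inter> free_part \<times> free_part"
      proof
        fix z assume "z \<in> ?L"
        then obtain x i where "z = (x, \<phi> (el i) x)" "x \<in> free_part" "\<phi> (el i) x \<in> free_part" by blast
        thus "z \<in> orbit_rel G M \<phi> \<inter> free_part \<times> free_part"
          using free_part_space[of x] el[of i] by (auto simp: orbit_rel_iff)
      qed
      moreover have "equiv free_part (orbit_rel G M \<phi> \<inter> free_part \<times> free_part)"
        using free_part_space by (intro equiv_orbit_rel) blast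
      ultimately show "smallest_equiv free_part ?L \<subseteq> orbit_rel G M \<phi> \<inter> free_part \<times> free_part"
        unfolding smallest_equiv_def by (intro Inter_lower) blast
    next
      show "orbit_rel G M \<phi> \<inter> free_part \<times> free_part \<subseteq> smallest_equiv free_part ?L"
        unfolding smallest_equiv_def
      proof (intro Inter_greatest subsetI)
        fix R z assume "R \<in> {S. equiv free_part S \<and> ?L \<subseteq> S}" and z: "z \<in> orbit_rel G M \<phi> \<inter> free_part \<times> free_part"
        hence R: "refl_on free_part R" "sym R" "trans R" "?L \<subseteq> R" by (auto simp: equiv_def)
        obtain x g where x: "x \<in> free_part" "x \<in> space M" "g \<in> carrier G" "z = (x, \<phi> g x)"
          using z by (auto simp: orbit_rel_iff)
        have link_a: "(\<phi> q x, \<phi> (a \<otimes> q) x) \<in> R" if "q \<in> carrier G" for q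
        proof -
          have "\<phi> q x \<in> A 0" "el 0 = a" using that x by (simp_all add: A_def el_def act_closed)
          moreover have "\<phi> (a \<otimes> q) x = \<phi> a (\<phi> q x)" using x a that by (simp add: act_mult)
          ultimately have "(\<phi> q x, \<phi> (a \<otimes> q) x) \<in> ?L"
            using x that a free_part_act by (auto intro!: exI[of _ 0])
          with R(4) show ?thesis by blast
        qed
        have link_t: "(\<phi> q x, \<phi> (t \<otimes> q) x) \<in> R" if e: "(q, t) \<in> edges E x" for q t
        proof -
          have q: "q \<in> carrier G" "t \<in> carrier G" "\<phi> q x \<in> E t" using e by (auto simp: edges_def)
          hence "t \<in> set ts" using E(2) ts(1) by auto
          then obtain j where j: "j < length ts" "ts ! j = t" by (auto simp: in_set_conv_nth)
          have "\<phi> q x \<in> A (Suc j)" "el (Suc j) = t" using q j by (simp_all add: A_def el_def)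
          moreover have "\<phi> (t \<otimes> q) x = \<phi> t (\<phi> q x)" using x q by (simp add: act_mult)
          ultimately have "(\<phi> q x, \<phi> (t \<otimes> q) x) \<in> ?L"
            using x q free_part_act by (auto intro!: exI[of _ "Suc j"])
          with R(4) show ?thesis by blast
        qed
        have "(\<one>, g) \<in> conn (edges E x)" by (rule conn[OF x(2,3)])
        hence "g \<in> carrier G \<and> (x, \<phi> g x) \<in> R"
        proof (induction rule: conn_induct)
          case refl
          show ?case using refl_onD[OF R(1) x(1)] x by (simp add: act_one)
        next
          case (base y z)
          then obtain "y \<in> carrier G" "z = a \<otimes> y" by auto
          thus ?case using base.IH link_a[of y] a transD[OF R(3)] by blast
        next
          case (base' y z)
          then obtain z: "z \<in> carrier G" "y = a \<otimes> z" by auto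
          thus ?case using base'.IH symD[OF R(2) link_a[of z]] transD[OF R(3)] by blast
        next
          case (edge e)
          obtain q t where e: "e = (q, t)" by (cases e)
          have "(q, t) \<in> edges E x" using edge e by blast
          hence "t \<in> carrier G" "(\<phi> q x, \<phi> (t \<otimes> q) x) \<in> R" using link_t by (auto simp: edges_def)
          thus ?case using edge.IH transD[OF R(3)] unfolding e by auto
        next
          case (edge' e)
          obtain q t where e: "e = (q, t)" by (cases e)
          have "(q, t) \<in> edges E x" using edge' e by blast
          hence "q \<in> carrier G" "(\<phi> (t \<otimes> q) x, \<phi> q x) \<in> R"
            using link_t symD[OF R(2)] by (auto simp: edges_def)
          thus ?case using edge'.IH transD[OF R(3)] unfolding e by auto
        qed
        thus "z \<in> R" using x(4) by simp
      qed
    qed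
    thus "smallest_equiv ?X ({(x, \<phi> (el i) x) |i x. x \<in> A i} \<inter> ?X \<times> ?X) = orbit_rel G M \<phi> \<inter> ?X \<times> ?X"
      unfolding X .
    show "space M - free_part \<in> null_sets M" by (rule free_part_null)
  qed
  hence "cost M (orbit_rel G M \<phi>) \<le> (\<Sum>i. emeasure M (A i))"
    unfolding cost_def by (intro Inf_lower) blast
  also have "(\<Sum>i. emeasure M (A i)) = (\<Sum>i<Suc (length ts). emeasure M (A i))"
    by (rule suminf_finite) (auto simp: A_def split: nat.split)
  also have "\<dots> = emeasure M (A 0) + (\<Sum>j<length ts. emeasure M (A (Suc j)))"
    by (rule sum.lessThan_Suc_shift)
  also have "(\<Sum>j<length ts. emeasure M (A (Suc j))) = (\<Sum>j<length ts. emeasure M (E (ts ! j)))"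
    by (intro sum.cong) (auto simp: A_def)
  also have "\<dots> = (\<Sum>t\<in>S. emeasure M (E t))"
    using sum.reindex_bij_betw[OF bij_betw_nth[OF ts(2) refl refl], of "\<lambda>t. emeasure M (E t)"]
    by (simp add: ts(1))
  finally show ?thesis by (simp add: A_def emeasure_space_1)
qed

text \<open>The estimate is made at each stage and passes to the limit by continuity of the measure,
  the limit sets being null by \<open>null_edges\<close>.\<close>

lemma cost_le_1:
  assumes S: "finite S" "S \<subseteq> carrier G" "generate G S = carrier G"
    and unit: "unitarizable TYPE(nat \<Rightarrow> complex) G"
  shows "cost M (orbit_rel G M \<phi>) \<le> 1"
proof -
  interpret E: coset_forest G a M \<phi> "\<lambda>t. \<Inter>i. pruned S i t"
  proof
    show "(\<Inter>i. pruned S i t) \<in> sets M" for t using pruned_sets by blast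
  qed (rule pruned_forest[OF S(2)])
  have "(\<lambda>i. emeasure M (pruned S i t)) \<longlonglongrightarrow> 0" if "t \<in> S" for t
  proof -
    have "(\<lambda>i. emeasure M (pruned S i t)) \<longlonglongrightarrow> emeasure M (\<Inter>i. pruned S i t)"
      using pruned_sets pruned_decseq by (intro Lim_emeasure_decseq) auto
    also have "emeasure M (\<Inter>i. pruned S i t) = 0" using that S(2) by (intro E.null_edges unit) auto
    finally show ?thesis .
  qed
  hence "(\<lambda>i. 1 + (\<Sum>t\<in>S. emeasure M (pruned S i t))) \<longlonglongrightarrow> 1 + (\<Sum>t\<in>S. 0)"
    by (intro tendsto_add tendsto_const tendsto_sum)
  moreover have "cost M (orbit_rel G M \<phi>) \<le> 1 + (\<Sum>t\<in>S. emeasure M (pruned S i t))" for i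
  proof (rule cost_le_edges[OF S(1,2) pruned_sets])
    show "pruned S i t = {}" if "t \<notin> S" for t
      using pruned_decseq[of S t] that decseqD[of "\<lambda>i. pruned S i t" 0 i] by auto
  qed (rule pruned_conn[OF S(2,3)])
  ultimately show ?thesis by (intro LIMSEQ_le_const) auto
qed

end

section \<open>Sparse complete sections and a charging argument for graphings\<close>

section \<open>The cost is at least one\<close>

context free_pmp
begin

text \<open>A marker argument: if no nontrivial element of \<open>W\<close> moves a point of
  \<open>Y\<close> into \<open>Y\<close>, then the preimages of \<open>Y\<close> under the first
  \<open>n\<close> powers of \<open>a\<close> are disjoint.\<close>

lemma sparse_section:
  assumes n: "n > 0"
  obtains Y where "Y \<in> sets M" "real n * prob Y \<le> 1" "\<And>x. x \<in> free_part \<Longrightarrow> \<exists>g\<in>carrier G. \<phi> g x \<in> Y"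
proof -
  \<comment> \<open>Closed under inverses, so that being neighbours is symmetric, and containing all
    differences \<open>a^(j - i)\<close> for \<open>i < j < n\<close>.\<close>
  define W where "W = (\<lambda>j. a [^] j) ` {..<n} \<union> (\<lambda>j. inv (a [^] j)) ` {..<n}"
  have W: "finite W" "W \<subseteq> carrier G" "\<And>w. w \<in> W \<Longrightarrow> inv w \<in> W" by (auto simp: W_def)
  \<comment> \<open>No two distinct points of \<open>C m\<close> are neighbours under
    \<open>W\<close>, and the sets \<open>C m\<close> cover the free part. \<open>Y\<close> keeps a
    point of \<open>C m\<close> if none of its neighbours lies in an earlier
    \<open>C k\<close>.\<close>
  define C where "C m = {x \<in> space M. x \<in> sep m \<inter> free_part \<and> (\<forall>w\<in>W - {\<one>}. \<phi> w x \<in> space M - sep m)}" for m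
  define Y where "Y = {x \<in> space M. \<exists>m. x \<in> C m \<and> (\<forall>w\<in>W. \<forall>k. k < m \<longrightarrow> \<phi> w x \<in> space M - C k)}"
  have sets: "{x \<in> space M. x \<in> B} \<in> sets M" if "B \<in> sets M" for B
    using that sets.sets_into_space[OF that] by (simp add: Collect_conj_eq Int_absorb1)
  have C: "C m \<in> sets M" for m
    unfolding C_def
    by (intro sets.sets_Collect_conj sets.sets_Collect_countable_All' sets act_preimage_sets)
      (use W(1,2) in \<open>auto intro: countable_finite\<close>)
  have Y: "Y \<in> sets M"
    unfolding Y_def
    by (intro sets.sets_Collect_conj sets.sets_Collect_countable_All' sets.sets_Collect_countable_Ex
        sets.sets_Collect_countable_All sets.sets_Collect_imp sets.sets_Collect_const sets C act_preimage_sets)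
      (use W(1,2) C in \<open>auto intro: countable_finite\<close>)
  have ex_C: "\<exists>m. x \<in> C m" if x: "x \<in> free_part" for x
  proof -
    define F where "F = (\<lambda>w. \<phi> w x) ` (W - {\<one>})"
    have "x \<notin> F" using free_part_free[OF _ x] W(2) by (force simp: F_def)
    moreover have "finite F" "F \<subseteq> space M"
      using W(1,2) act_closed[OF _ free_part_space[OF x]] by (auto simp: F_def)
    ultimately obtain m where "x \<in> sep m" "sep m \<inter> F = {}"
      using sep_separates[OF free_part_space[OF x]] by blast
    hence "x \<in> C m"
      using x free_part_space[OF x] W(2) act_closed[OF _ free_part_space[OF x]] by (auto simp: C_def F_def)
    thus ?thesis ..
  qed
  have meets: "\<exists>g\<in>carrier G. \<phi> g x \<in> Y" if x: "x \<in> free_part" for x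
  proof -
    define R where "R m \<longleftrightarrow> (\<exists>g\<in>carrier G. \<phi> g x \<in> C m)" for m
    obtain m0 where "x \<in> C m0" using ex_C[OF x] by blast
    hence "\<phi> \<one> x \<in> C m0" using free_part_space[OF x] by (simp add: act_one)
    hence "R m0" unfolding R_def by blast
    \<comment> \<open>A point with the least index on its whole orbit has no neighbour of smaller
      index.\<close>
    hence "R (LEAST m. R m)" by (rule LeastI)
    then obtain g where g: "g \<in> carrier G" "\<phi> g x \<in> C (LEAST m. R m)" by (auto simp: R_def)
    have "\<phi> w (\<phi> g x) \<in> space M - C k" if "w \<in> W" "k < (LEAST m. R m)" for w k
    proof -
      have w: "w \<in> carrier G" using that W by blast
      have "\<not> R k" using that(2) by (rule not_less_Least)
      hence "\<phi> (w \<otimes> g) x \<notin> C k" using w g(1) by (auto simp: R_def)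
      thus ?thesis using w g(1) free_part_space[OF x] by (simp add: act_mult act_closed)
    qed
    hence "\<phi> g x \<in> Y" using g act_closed[OF g(1) free_part_space[OF x]] by (auto simp: Y_def)
    with g(1) show ?thesis by blast
  qed
  have once: "\<phi> w x \<notin> Y" if x: "x \<in> Y" and w: "w \<in> W" "w \<noteq> \<one>" for x w
  proof
    assume "\<phi> w x \<in> Y"
    then obtain m' where m': "\<phi> w x \<in> C m'" "\<And>w' k. w' \<in> W \<Longrightarrow> k < m' \<Longrightarrow> \<phi> w' (\<phi> w x) \<notin> C k"
      by (auto simp: Y_def)
    obtain m where m: "x \<in> C m" "\<And>w' k. w' \<in> W \<Longrightarrow> k < m \<Longrightarrow> \<phi> w' x \<notin> C k"
      using x by (auto simp: Y_def)
    have "\<phi> (inv w) (\<phi> w x) = x" using w W(2) x by (intro act_inv) (auto simp: Y_def)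
    hence "\<not> m < m'" using m'(2)[OF W(3)[OF w(1)], of m] m(1) by auto
    moreover have "\<not> m' < m" using m(2)[OF w(1), of m'] m'(1) by auto
    ultimately have "m = m'" by simp
    with m(1) m'(1) w show False by (auto simp: C_def)
  qed
  define F where "F j = {x \<in> space M. \<phi> (a [^] j) x \<in> Y}" for j :: nat
  have F: "F j \<in> sets M" "prob (F j) = prob Y" for j
    unfolding F_def measure_def using act_preimage_sets[OF _ Y] act_preimage_measure[OF _ Y] by auto
  have disj: "F i \<inter> F j = {}" if "i < j" "j < n" for i j
  proof (rule equals0I)
    fix x assume "x \<in> F i \<inter> F j"
    hence x: "x \<in> space M" "\<phi> (a [^] i) x \<in> Y" "\<phi> (a [^] j) x \<in> Y" by (auto simp: F_def)
    have "a [^] (j - i) \<otimes> a [^] i = a [^] j" using a that by (simp add: nat_pow_mult)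
    hence eq: "\<phi> (a [^] (j - i)) (\<phi> (a [^] i) x) = \<phi> (a [^] j) x"
      using x(1) by (simp flip: act_mult)
    have "a [^] (j - i) \<in> W" "a [^] (j - i) \<noteq> \<one>"
      using that a_pow[of "j - i"] by (auto simp: W_def)
    from once[OF x(2) this] x(3) show False by (simp add: eq)
  qed
  have "disjoint_family_on F {..<n}"
    unfolding disjoint_family_on_def
  proof (intro ballI impI)
    fix i j assume "i \<in> {..<n}" "j \<in> {..<n}" "i \<noteq> j"
    thus "F i \<inter> F j = {}" using disj[of i j] disj[of j i] by (cases "i < j") auto
  qed
  hence "(\<Sum>j<n. prob (F j)) = prob (\<Union>j<n. F j)"
    using F(1) by (intro finite_measure_finite_Union[symmetric]) auto
  hence "(\<Sum>j<n. prob (F j)) \<le> 1" by simp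
  hence "real n * prob Y \<le> 1" by (simp add: F(2))
  from that[OF Y this meets] show ?thesis .
qed

lemma emeasure_act_image:
  assumes "g \<in> carrier G" "B \<in> sets M"
  shows "\<phi> g ` B \<in> sets M" "emeasure M (\<phi> g ` B) = emeasure M B"
  using act_image[OF assms(1) sets.sets_into_space[OF assms(2)]] assms
    act_preimage_sets[of "inv g" B] act_preimage_measure[of "inv g" B] by auto

text \<open>On \<open>Z\<close> the map is pieced together from countably many measure preserving
  translations. Images of different pieces may overlap, hence the inequality.\<close>

lemma emeasure_image_le:
  assumes Z: "Z \<in> sets M"
    and f: "\<And>B. B \<in> sets M \<Longrightarrow> {z \<in> Z. f z \<in> B} \<in> sets M"
    and orbit: "\<And>z. z \<in> Z \<Longrightarrow> \<exists>g\<in>carrier G. f z = \<phi> g z"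
  shows "emeasure M (f ` Z) \<le> emeasure M Z"
proof -
  have Zsp: "z \<in> space M" if "z \<in> Z" for z using that sets.sets_into_space[OF Z] by blast
  have fsp: "f z \<in> space M" if "z \<in> Z" for z using orbit[OF that] act_closed Zsp[OF that] by auto
  have eq: "{z \<in> Z. f z = \<phi> g z} \<in> sets M" if g: "g \<in> carrier G" for g
  proof -
    \<comment> \<open>Two points differ iff some \<open>sep n\<close> contains the first but not the
      second, so the set of agreement is measurable.\<close>
    have "{z \<in> Z. f z = \<phi> g z} = Z - (\<Union>n. {z \<in> Z. f z \<in> sep n} - {z \<in> space M. \<phi> g z \<in> sep n})"
    proof (intro equalityI subsetI)
      fix z assume z: "z \<in> Z - (\<Union>n. {z \<in> Z. f z \<in> sep n} - {z \<in> space M. \<phi> g z \<in> sep n})"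
      have "f z = \<phi> g z"
      proof (rule ccontr)
        assume "f z \<noteq> \<phi> g z"
        then obtain n where "f z \<in> sep n" "sep n \<inter> {\<phi> g z} = {}"
          using sep_separates[of "f z" "{\<phi> g z}"] fsp[of z] act_closed[OF g] Zsp[of z] z by auto
        with z show False by auto
      qed
      with z show "z \<in> {z \<in> Z. f z = \<phi> g z}" by simp
    qed (auto simp: Zsp)
    also have "\<dots> \<in> sets M"
      using Z f[OF sep_sets] act_preimage_sets[OF g sep_sets] by (intro sets.Diff sets.countable_UN) auto
    finally show ?thesis .
  qed
  define T where "T j = {z \<in> Z. f z = \<phi> (enum j) z} - (\<Union>i<j. {z \<in> Z. f z = \<phi> (enum i) z})" for j
  have T: "T j \<in> sets M" for j
    unfolding T_def by (intro sets.Diff sets.finite_UN) (auto intro: eq)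
  have cover: "(\<Union>j. T j) = Z"
  proof (intro equalityI subsetI)
    fix z assume z: "z \<in> Z"
    then obtain g where "g \<in> carrier G" "f z = \<phi> g z" using orbit by blast
    then obtain j where "f z = \<phi> (enum j) z" using range_enum by (metis rangeE)
    hence 1: "f z = \<phi> (enum (LEAST j. f z = \<phi> (enum j) z)) z" by (rule LeastI)
    obtain j0 where j0: "j0 = (LEAST j. f z = \<phi> (enum j) z)" by simp
    have "f z \<noteq> \<phi> (enum i) z" if "i < j0" for i
      using that unfolding j0 by (rule not_less_Least)
    with z 1[folded j0] have "z \<in> T j0" unfolding T_def by blast
    thus "z \<in> (\<Union>j. T j)" by blast
  qed (auto simp: T_def)
  have disj: "disjoint_family T"
    unfolding disjoint_family_on_def
  proof (intro ballI impI equals0I)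
    fix i j x assume "i \<noteq> j" "x \<in> T i \<inter> T j"
    thus False by (cases "i < j") (auto simp: T_def)
  qed
  have "f ` T j = \<phi> (enum j) ` T j" for j by (rule image_cong) (auto simp: T_def)
  hence "f ` Z = (\<Union>j. \<phi> (enum j) ` T j)" unfolding cover[symmetric] image_UN by simp
  hence "emeasure M (f ` Z) \<le> (\<Sum>j. emeasure M (\<phi> (enum j) ` T j))"
    using emeasure_act_image(1)[OF enum_closed T] by (auto intro: emeasure_subadditive_countably)
  also have "\<dots> = (\<Sum>j. emeasure M (T j))" using emeasure_act_image(2)[OF enum_closed T] by simp
  also have "\<dots> = emeasure M (\<Union>j. T j)" using T disj by (intro suminf_emeasure) auto
  finally show ?thesis by (simp add: cover)
qed

text \<open>\<open>D k\<close> consists of the points of \<open>X\<close> within \<open>k\<close>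
  edges of a complete section \<open>Y\<close> of measure at most \<open>1 / n\<close>. Each point
  of the layer \<open>L k\<close> is charged to an edge leading to \<open>D k\<close>. No edge is
  charged twice, so the layers together have at most the measure of the domains.\<close>

lemma graphing_cost_ge:
  assumes gr: "graphing M (orbit_rel G M \<phi>) A B f" and n: "n > 0"
  shows "1 \<le> ennreal (1 / real n) + (\<Sum>i. emeasure M (A i))"
proof -
  have iso: "borel_isomorphism M (A i) (B i) (f i)" for i using gr by (simp add: graphing_def)
  obtain N where N: "N \<in> null_sets M"
    and gen: "smallest_equiv (space M - N) ({(x, f i x) | i x. x \<in> A i} \<inter> (space M - N) \<times> (space M - N))
      = orbit_rel G M \<phi> \<inter> (space M - N) \<times> (space M - N)"
    using gr unfolding graphing_def Let_def by blast
  define X where "X = space M - N"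
  note gen = gen[folded X_def]
  have X: "X \<in> sets M" "X \<subseteq> space M" using N by (auto simp: X_def)
  have A: "A i \<in> sets M" "A i \<subseteq> space M" for i using iso[of i] sets.sets_into_space by (auto simp: borel_isomorphism_def)
  have pre: "{z \<in> A i. f i z \<in> Z} \<in> sets M" if Z: "Z \<in> sets M" for i Z
  proof -
    have sp: "space (restrict_space M (A i)) = A i" using A(2)[of i] by (auto simp: space_restrict_space)
    have "f i \<in> measurable (restrict_space M (A i)) M"
      using iso[of i] by (simp add: borel_isomorphism_def measurable_restrict_space2_iff)
    from measurable_sets[OF this Z] have "{z \<in> A i. f i z \<in> Z} \<in> sets (restrict_space M (A i))"
      by (simp add: sp vimage_def Int_def conj_commute)
    thus ?thesis using A(1)[of i] by (simp add: sets_restrict_space_iff A(2) Int_absorb2)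
  qed
  have im: "f i ` Z \<in> sets M" if Z: "Z \<in> sets M" "Z \<subseteq> A i" for i Z
  proof -
    have B: "B i \<in> sets M" "B i \<subseteq> space M" and bij: "bij_betw (f i) (A i) (B i)"
      using iso[of i] sets.sets_into_space by (auto simp: borel_isomorphism_def)
    have sp: "space (restrict_space M (B i)) = B i" using B(2) by (auto simp: space_restrict_space)
    have "inv_into (A i) (f i) \<in> measurable (restrict_space M (B i)) M"
      using iso[of i] by (simp add: borel_isomorphism_def measurable_restrict_space2_iff)
    from measurable_sets[OF this Z(1)]
    have "{y \<in> B i. inv_into (A i) (f i) y \<in> Z} \<in> sets (restrict_space M (B i))"
      by (simp add: sp vimage_def Int_def conj_commute)
    hence "{y \<in> B i. inv_into (A i) (f i) y \<in> Z} \<in> sets M"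
      using B by (simp add: sets_restrict_space_iff Int_absorb2)
    moreover have "{y \<in> B i. inv_into (A i) (f i) y \<in> Z} = f i ` Z"
    proof (intro equalityI subsetI)
      fix y assume y: "y \<in> {y \<in> B i. inv_into (A i) (f i) y \<in> Z}"
      hence "f i (inv_into (A i) (f i) y) = y" using bij by (intro f_inv_into_f) (auto simp: bij_betw_def)
      with y show "y \<in> f i ` Z" by force
    next
      fix y assume "y \<in> f i ` Z"
      then obtain z where "z \<in> Z" "y = f i z" by blast
      thus "y \<in> {y \<in> B i. inv_into (A i) (f i) y \<in> Z}"
        using bij Z(2) by (auto simp: bij_betw_def inv_into_f_f)
    qed
    ultimately show ?thesis by simp
  qed
  have link: "\<exists>g\<in>carrier G. f i z = \<phi> g z" if "z \<in> A i" "z \<in> X" "f i z \<in> X" for i z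
  proof -
    have "(z, f i z) \<in> smallest_equiv X ({(x, f i x) | i x. x \<in> A i} \<inter> X \<times> X)"
      using that by (auto simp: smallest_equiv_def)
    thus ?thesis unfolding gen by (auto simp: orbit_rel_iff)
  qed
  obtain Y where Y: "Y \<in> sets M" "real n * prob Y \<le> 1" "\<And>x. x \<in> free_part \<Longrightarrow> \<exists>g\<in>carrier G. \<phi> g x \<in> Y"
    using sparse_section[OF n] by blast
  \<comment> \<open>\<open>X\<close> need not be invariant but \<open>X'\<close> is: a point of
    \<open>X'\<close> moved into \<open>Y\<close> by the group stays in \<open>X\<close>, where the
    graphing generates the orbit relation.\<close>
  have "N \<union> (space M - free_part) \<in> null_sets M" using N free_part_null by auto
  from ex_free_part[OF this] obtain X' where X': "X' \<in> sets M" "space M - X' \<in> null_sets M"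
    "X' \<inter> (N \<union> (space M - free_part)) = {}" "\<And>g x. g \<in> carrier G \<Longrightarrow> x \<in> X' \<Longrightarrow> \<phi> g x \<in> X'"
    by blast
  have X'sub: "X' \<subseteq> X" "X' \<subseteq> free_part"
    using X'(3) sets.sets_into_space[OF X'(1)] by (auto simp: X_def)

  define D where "D = rec_nat (Y \<inter> X) (\<lambda>_ D. D \<union>
    (\<Union>i. {z \<in> A i. f i z \<in> D} \<inter> X) \<union> (\<Union>i. f i ` (A i \<inter> D) \<inter> X))"
  have D0: "D 0 = Y \<inter> X" by (simp add: D_def)
  have DS: "D (Suc k) = D k \<union> (\<Union>i. {z \<in> A i. f i z \<in> D k} \<inter> X) \<union> (\<Union>i. f i ` (A i \<inter> D k) \<inter> X)" for k
    by (simp add: D_def)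
  have D_sub: "D k \<subseteq> X" for k by (induction k) (auto simp: D0 DS)
  have D: "D k \<in> sets M" for k
  proof (induction k)
    case 0 show ?case using Y(1) X(1) by (simp add: D0)
  next
    case (Suc k)
    show ?case unfolding DS using Suc X(1) A(1) pre im by (intro sets.Un sets.countable_UN) auto
  qed
  have D_mono: "D k \<subseteq> D l" if "k \<le> l" for k l
    using that by (induction rule: dec_induct) (auto simp: DS)
  define L where "L k = D (Suc k) - D k" for k
  \<comment> \<open>The new end of the edge is its source in \<open>T1\<close> and its target in
    \<open>T2\<close>. Both sets consist of sources, so they are disjoint parts of
    \<open>A i\<close>; passing from targets to sources in \<open>T2\<close> is allowed by
    \<open>image\<close>.\<close>
  define T1 where "T1 i k = {z \<in> A i. f i z \<in> D k} \<inter> L k" for i k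
  define T2 where "T2 i k = {z \<in> A i. f i z \<in> L k} \<inter> D k" for i k
  have L: "L k \<in> sets M" for k using D by (simp add: L_def)
  have T: "T1 i k \<in> sets M" "T2 i k \<in> sets M" for i k using pre D L by (auto simp: T1_def T2_def)
  have image: "emeasure M (f i ` T2 i k) \<le> emeasure M (T2 i k)" for i k
  proof (rule emeasure_image_le[OF T(2)])
    fix Z assume "Z \<in> sets M"
    hence "{z \<in> A i. f i z \<in> Z} \<inter> T2 i k \<in> sets M" using pre T(2) by blast
    also have "{z \<in> A i. f i z \<in> Z} \<inter> T2 i k = {z \<in> T2 i k. f i z \<in> Z}" by (auto simp: T2_def)
    finally show "{z \<in> T2 i k. f i z \<in> Z} \<in> sets M" .
  next
    fix z assume "z \<in> T2 i k"
    thus "\<exists>g\<in>carrier G. f i z = \<phi> g z"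
      using D_sub[of k] D_sub[of "Suc k"] by (intro link) (auto simp: T2_def L_def)
  qed
  have L_le: "emeasure M (L k) \<le> (\<Sum>i. emeasure M (T1 i k \<union> T2 i k))" for k
  proof -
    have "L k \<subseteq> (\<Union>i. T1 i k \<union> f i ` T2 i k)" by (auto simp: L_def DS T1_def T2_def)
    moreover have im': "f i ` T2 i k \<in> sets M" for i by (intro im T) (auto simp: T2_def)
    ultimately have "emeasure M (L k) \<le> emeasure M (\<Union>i. T1 i k \<union> f i ` T2 i k)"
      using T by (intro emeasure_mono) auto
    also have "\<dots> \<le> (\<Sum>i. emeasure M (T1 i k \<union> f i ` T2 i k))"
      using T im' by (intro emeasure_subadditive_countably) auto
    also have "\<dots> \<le> (\<Sum>i. emeasure M (T1 i k \<union> T2 i k))"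
    proof (intro suminf_le summableI)
      fix i
      have "emeasure M (T1 i k \<union> f i ` T2 i k) \<le> emeasure M (T1 i k) + emeasure M (f i ` T2 i k)"
        using T im' by (intro emeasure_subadditive)
      also have "\<dots> \<le> emeasure M (T1 i k) + emeasure M (T2 i k)" by (intro add_left_mono image)
      also have "\<dots> = emeasure M (T1 i k \<union> T2 i k)"
        using T by (intro plus_emeasure) (auto simp: T1_def T2_def L_def)
      finally show "emeasure M (T1 i k \<union> f i ` T2 i k) \<le> emeasure M (T1 i k \<union> T2 i k)" .
    qed
    finally show ?thesis .
  qed
  \<comment> \<open>An edge charged at stage \<open>k\<close> has both ends in
    \<open>D (Suc k)\<close>, whereas at a later stage one end has to be new.\<close>
  have T_disj: "(T1 i k \<union> T2 i k) \<inter> (T1 i l \<union> T2 i l) = {}" if "k < l" for i and k l :: nat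
  proof -
    have "D (Suc k) \<subseteq> D l" "D k \<subseteq> D l" using D_mono[of "Suc k" l] D_mono[of k l] that by auto
    thus ?thesis by (auto simp: T1_def T2_def L_def)
  qed
  have T_sum: "(\<Sum>k<K. emeasure M (T1 i k \<union> T2 i k)) \<le> emeasure M (A i)" for i K
  proof -
    have "disjoint_family_on (\<lambda>k. T1 i k \<union> T2 i k) {..<K}"
      unfolding disjoint_family_on_def
    proof (intro ballI impI)
      fix k l :: nat assume "k \<noteq> l"
      thus "(T1 i k \<union> T2 i k) \<inter> (T1 i l \<union> T2 i l) = {}"
        using T_disj[of k l i] T_disj[of l k i] by (cases "k < l") auto
    qed
    hence "(\<Sum>k<K. emeasure M (T1 i k \<union> T2 i k)) = emeasure M (\<Union>k<K. T1 i k \<union> T2 i k)"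
      using T by (intro sum_emeasure) auto
    also have "\<dots> \<le> emeasure M (A i)" by (intro emeasure_mono A) (auto simp: T1_def T2_def)
    finally show ?thesis .
  qed
  have Y_le: "emeasure M Y \<le> ennreal (1 / real n)"
    using Y(2) n by (simp add: emeasure_eq_measure ennreal_leI field_simps)
  have D_le: "emeasure M (D K) \<le> ennreal (1 / real n) + (\<Sum>i. emeasure M (A i))" for K
  proof -
    have "emeasure M (D K) \<le> emeasure M (D 0) + (\<Sum>k<K. emeasure M (L k))"
    proof (induction K)
      case (Suc K)
      have "D (Suc K) = D K \<union> L K" using D_mono[of K "Suc K"] by (auto simp: L_def)
      hence "emeasure M (D (Suc K)) \<le> emeasure M (D K) + emeasure M (L K)"
        using emeasure_subadditive[OF D L, of K K] by simp
      also have "\<dots> \<le> emeasure M (D 0) + (\<Sum>k<K. emeasure M (L k)) + emeasure M (L K)"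
        using Suc by (rule add_right_mono)
      finally show ?case by (simp add: add.assoc)
    qed simp
    also have "emeasure M (D 0) \<le> ennreal (1 / real n)"
      using Y_le emeasure_mono[of "D 0" Y M] Y(1) by (auto simp: D0 intro: order_trans)
    also have "(\<Sum>k<K. emeasure M (L k)) \<le> (\<Sum>k<K. \<Sum>i. emeasure M (T1 i k \<union> T2 i k))"
      by (intro sum_mono L_le)
    also have "\<dots> = (\<Sum>i. \<Sum>k<K. emeasure M (T1 i k \<union> T2 i k))"
      by (intro suminf_sum[symmetric] summableI)
    also have "\<dots> \<le> (\<Sum>i. emeasure M (A i))" by (intro suminf_le T_sum summableI)
    finally show ?thesis by (simp add: add_mono)
  qed
  have "X' \<subseteq> (\<Union>k. D k)"
  proof
    fix x assume x: "x \<in> X'"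
    \<comment> \<open>Membership in the union of the \<open>D k\<close> is respected by every edge,
      hence by the relation that the edges generate.\<close>
    define R where "R = {(x, y) \<in> X \<times> X. x \<in> (\<Union>k. D k) \<longleftrightarrow> y \<in> (\<Union>k. D k)}"
    have "equiv X R"
      by (intro equivI) (auto simp: R_def refl_on_def sym_def trans_def)
    moreover have "{(x, f i x) | i x. x \<in> A i} \<inter> X \<times> X \<subseteq> R"
    proof
      fix z assume "z \<in> {(x, f i x) | i x. x \<in> A i} \<inter> X \<times> X"
      then obtain i y where y: "z = (y, f i y)" "y \<in> A i" "y \<in> X" "f i y \<in> X" by auto
      have "f i y \<in> D (Suc k)" if "y \<in> D k" for k using that y by (auto simp: DS)
      moreover have "y \<in> D (Suc k)" if "f i y \<in> D k" for k using that y by (auto simp: DS)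
      ultimately show "z \<in> R" using y unfolding R_def by blast
    qed
    ultimately have R: "orbit_rel G M \<phi> \<inter> X \<times> X \<subseteq> R"
      unfolding gen[symmetric] smallest_equiv_def by (intro Inter_lower) simp
    obtain g where g: "g \<in> carrier G" "\<phi> g x \<in> Y" using Y(3) X'sub(2) x by blast
    have "\<phi> g x \<in> X" using X'(4)[OF g(1) x] X'sub(1) by blast
    hence "(x, \<phi> g x) \<in> orbit_rel G M \<phi> \<inter> X \<times> X"
      using x X'sub(1) X(2) g(1) by (auto simp: orbit_rel_iff)
    hence "(x, \<phi> g x) \<in> R" using R by blast
    moreover have "\<phi> g x \<in> D 0" using g \<open>\<phi> g x \<in> X\<close> by (simp add: D0)
    ultimately show "x \<in> (\<Union>k. D k)" unfolding R_def by blast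
  qed
  hence X'_le: "emeasure M X' \<le> emeasure M (\<Union>k. D k)" using D by (intro emeasure_mono) auto
  have "1 = emeasure M X'"
    using emeasure_Diff_null_set[OF X'(2) sets.top] sets.sets_into_space[OF X'(1)]
    by (simp add: double_diff emeasure_space_1)
  also note X'_le
  also have "emeasure M (\<Union>k. D k) \<le> ennreal (1 / real n) + (\<Sum>i. emeasure M (A i))"
  proof (rule LIMSEQ_le_const2)
    show "(\<lambda>k. emeasure M (D k)) \<longlonglongrightarrow> emeasure M (\<Union>k. D k)"
      using D D_mono by (intro Lim_emeasure_incseq) (auto simp: incseq_def)
  qed (use D_le in blast)
  finally show ?thesis .
qed

lemma cost_ge_1: "1 \<le> cost M (orbit_rel G M \<phi>)"
  unfolding cost_def
proof (rule Inf_greatest)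
  fix c assume "c \<in> {\<Sum>i. emeasure M (A i) |A B f. graphing M (orbit_rel G M \<phi>) A B f}"
  then obtain A B f where c: "c = (\<Sum>i. emeasure M (A i))" and gr: "graphing M (orbit_rel G M \<phi>) A B f"
    by blast
  have "(\<lambda>n. ennreal (1 / real (Suc n)) + c) \<longlonglongrightarrow> ennreal 0 + c"
    by (intro tendsto_add tendsto_const tendsto_ennrealI LIMSEQ_Suc lim_1_over_n)
  moreover have "1 \<le> ennreal (1 / real (Suc n)) + c" for n
    using graphing_cost_ge[OF gr, of "Suc n"] by (simp add: c)
  ultimately show "1 \<le> c" using LIMSEQ_le_const[of "\<lambda>n. ennreal (1 / real (Suc n)) + c" "ennreal 0 + c" 1] by simp
qed

end

text \<open>Signed words in the generators, coded as lists over \<open>S \<times> UNIV\<close>,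
  evaluate onto the group.\<close>

lemma (in group) countable_finitely_generated:
  assumes "finite S" "S \<subseteq> carrier G" "generate G S = carrier G"
  shows "countable (carrier G)"
proof -
  have "\<exists>w\<in>lists (S \<times> UNIV). g = foldr (\<lambda>(s, b) h. (if b then s else inv s) \<otimes> h) w \<one>"
    if "g \<in> generate G S" for g
  proof -
    let ?ev = "\<lambda>w. foldr (\<lambda>(s, b) h. (if b then s else inv s) \<otimes> h) w \<one>"
    have closed: "?ev w \<in> carrier G" if "w \<in> lists (S \<times> UNIV)" for w
      using that assms(2) by (induction w) auto
    have append: "?ev (v @ w) = ?ev v \<otimes> ?ev w" if "v \<in> lists (S \<times> UNIV)" "w \<in> lists (S \<times> UNIV)" for v w
      using that(1)
    proof (induction v)
      case (Cons x v)
      have "x \<in> S \<times> UNIV" using Cons.hyps by simp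
      then obtain s b where x: "x = (s, b)" "s \<in> carrier G" using assms(2) by blast
      have "v \<in> lists (S \<times> UNIV)" using Cons.hyps by simp
      thus ?case using Cons.IH x closed that(2) by (simp add: m_assoc)
    qed (use that(2) in \<open>simp add: closed\<close>)
    from that show ?thesis
    proof (induction rule: generate.induct)
      case one show ?case by (rule bexI[of _ "[]"]) auto
    next
      case (incl s) thus ?case using assms(2) by (intro bexI[of _ "[(s, True)]"]) auto
    next
      case (inv s) thus ?case using assms(2) by (intro bexI[of _ "[(s, False)]"]) auto
    next
      case (eng g h)
      then obtain v w where "v \<in> lists (S \<times> UNIV)" "w \<in> lists (S \<times> UNIV)" "g = ?ev v" "h = ?ev w" by blast
      thus ?case using append by (intro bexI[of _ "v @ w"]) auto
    qed
  qed
  hence "carrier G \<subseteq> (\<lambda>w. foldr (\<lambda>(s, b) h. (if b then s else inv s) \<otimes> h) w \<one>) ` lists (S \<times> UNIV)"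
    unfolding assms(3) by blast
  moreover have "countable (lists (S \<times> (UNIV :: bool set)))"
    using assms(1) by (intro countable_lists countable_SIGMA countable_finite) auto
  ultimately show ?thesis by (meson countable_image countable_subset)
qed

theorem corollary6:
  fixes G :: "('g, 'm) monoid_scheme"
  assumes "group G"
    and "finitely_generated G"
    and "non_torsion G"
    and "\<not> fixed_price_one TYPE('x) G"
  shows "\<not> unitarizable TYPE(nat \<Rightarrow> complex) G"
proof
  assume unit: "unitarizable TYPE(nat \<Rightarrow> complex) G"
  obtain S where S: "finite S" "S \<subseteq> carrier G" "generate G S = carrier G"
    using assms(2) by (auto simp: finitely_generated_def)
  obtain a where a: "a \<in> carrier G" "\<And>n::nat. n > 0 \<Longrightarrow> a [^]\<^bsub>G\<^esub> n \<noteq> \<one>\<^bsub>G\<^esub>"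
    using assms(3) by (auto simp: non_torsion_def)
  interpret infinite_order G a
    using assms(1) a group.countable_finitely_generated[OF assms(1) S]
    by (simp add: infinite_order_def infinite_order_axioms_def)
  \<comment> \<open>Fixed price one includes infiniteness of the group, which the powers of
    \<open>a\<close> provide.\<close>
  have "infinite (carrier G)"
  proof
    assume "finite (carrier G)"
    moreover have "range (\<lambda>n::nat. a [^]\<^bsub>G\<^esub> n) \<subseteq> carrier G" by auto
    ultimately have "finite (range (\<lambda>n::nat. a [^]\<^bsub>G\<^esub> n))" by (rule finite_subset[rotated])
    moreover have "inj (\<lambda>n::nat. a [^]\<^bsub>G\<^esub> n)" by (simp add: inj_def a_pow_inj)
    ultimately show False using finite_imageD by blast
  qed
  moreover have "cost M (orbit_rel G M \<phi>) = 1"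
    if "standard_prob_space M" "pmp_action G M \<phi>" "essentially_free G M \<phi>" for M :: "'x measure" and \<phi>
  proof -
    interpret free_pmp G a M \<phi> by standard (fact that)+
    show ?thesis by (intro antisym cost_le_1[OF S unit] cost_ge_1)
  qed
  ultimately show False using assms(4) by (simp add: fixed_price_one_def)
qed

end
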